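(* Let $d\geq 2$ be an integer, let $c_1,\dots,c_s\in\mathbb{Z}$, and let $G=\langle x^d+c_1,\dots,x^d+c_s\rangle$ be the semigroup generated by these polynomials under composition. Then one of the following statements must hold: (1) $G$ contains a positive proportion of irreducible polynomials over $\mathbb{Q}$ if and only if $G$ contains at least one polynomial that is irreducible over $\mathbb{Q}$. (2) $d\geq 4$ is even and $\{c_1,\dots,c_s\}\subseteq\{y^p-y^{pd},\; y^p,\; -y^p,\; -y^p-y^{pd}\}$ for some $y\in\mathbb{Z}$ and some prime $p\mid d$. (3) $d\geq 5$ is odd and $\{c_1,\dots,c_s\}\subseteq\{y^p-y^{pd},\; y^p\}$ for some $y\in\mathbb{Z}$ and some prime $p\mid d$.
   Context: For polynomials $f_1,\dots,f_s\in\mathbb{Q}[x]$, $\langle f_1,\dots,f_s\rangle$ denotes the set of all finite nonempty compositions of the $f_i$ (with repetition allowed). Such a semigroup $G$ contains a positive proportion of irreducible polynomials over $\mathbb{Q}$ if $$\liminf_{B\to\infty}\frac{\#\{g\in G:\deg(g)\leq B\text{ and }g\text{ is irreducible over }\mathbb{Q}\}}{\#\{g\in G:\deg(g)\leq B\}}>0.$$ *)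

theory Defs
  imports
    "HOL-Computational_Algebra.Computational_Algebra"
    "HOL-Library.Extended_Real"
begin

text \<open>Finite nonempty compositions of polynomials in \<open>F\<close>; the identity \<open>[:0, 1:]\<close> is not
  included by default.\<close>

inductive_set comp_semigroup :: "'a::comm_semiring_0 poly set \<Rightarrow> 'a poly set"
  for F :: "'a poly set" where
  generator: "f \<in> F \<Longrightarrow> f \<in> comp_semigroup F"
| compose: "f \<in> F \<Longrightarrow> g \<in> comp_semigroup F \<Longrightarrow> pcompose f g \<in> comp_semigroup F"

lemma comp_semigroup_closed:
  fixes F :: "'a::comm_semiring_1 poly set"
  assumes "f \<in> comp_semigroup F" and "g \<in> comp_semigroup F"
  shows "pcompose f g \<in> comp_semigroup F"
  using assms
  by (induction rule: comp_semigroup.induct)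
    (auto simp: pcompose_assoc[symmetric] intro: comp_semigroup.compose)

text \<open>The counts are finite for a semigroup generated by finitely many polynomials of degree at
  least 2 (for infinite sets \<^const>\<open>card\<close> is 0). Where the denominator is 0, the quotient is 0;
  for a nonempty semigroup this affects only finitely many \<open>B\<close>, hence not the limit inferior.\<close>

definition positive_proportion_irreducible :: "rat poly set \<Rightarrow> bool" where
  "positive_proportion_irreducible G \<longleftrightarrow>
     liminf (\<lambda>B::nat. ereal (real (card {g \<in> G. degree g \<le> B \<and> irreducible g}) /
                             real (card {g \<in> G. degree g \<le> B}))) > 0"

definition unicritical_poly :: "nat \<Rightarrow> int \<Rightarrow> rat poly" where
  "unicritical_poly d c = monom 1 d + [:of_int c:]"

end

theory Submission
  imports Defs "HOL-Computational_Algebra.Field_as_Ring" "HOL-Library.Sublist"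
begin

text \<open>
  Write \<open>f\<^sub>c(x) = x ^ d + c\<close>. A member of the semigroup is \<open>f\<^sub>c\<close> composed along a word in the constants,
  and distinct words give distinct polynomials, so counting the semigroup by degree is counting
  words by length. If one word \<open>w\<close> has the property that every word beginning with \<open>w\<close> is
  irreducible, then a proportion of roughly \<open>k ^ (- length w)\<close> of all words over \<open>k\<close> letters is
  irreducible (\<open>positive_proportion_if_irreducible_extensions\<close>). Everything is about finding such a \<open>w\<close>,
  knowing that some irreducible word, and hence its first letter \<open>a\<close>, exists.

  The test for irreducibility is a norm argument. If \<open>g\<close> is irreducible and \<open>g(x ^ d + c)\<close> is not, then
  for some prime \<open>p\<close> dividing \<open>d\<close> the number \<open>g(c)\<close> is a \<open>p\<close>-th power up to a sign that causes no harm
  (\<open>irreducible_word_snoc\<close>). For \<open>g\<close> given by a word, \<open>g(c)\<close> is the integer obtained by letting the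
  extended word act on \<open>0\<close>. So the question becomes dynamical: can an orbit of \<open>0\<close> under the maps
  \<open>f\<^sub>c\<close>, finished by many steps of \<open>f\<^sub>a\<close>, end in a \<open>p\<close>-th power? As \<open>a\<close> is nonzero, \<open>u ^ d + a\<close> is such a power
  only for \<open>\<bar>u\<bar> \<le> \<bar>a\<bar>\<close>, and an orbit of \<open>f\<^sub>a\<close> that is still small after many steps has reached a periodic
  integer (\<open>power_value_imp_periodic\<close>). For \<open>d \<ge> 3\<close> that is a fixed point \<open>t = y ^ p\<close>, so \<open>a = t - t ^ d\<close>;
  for \<open>d = 2\<close> it may also lie on a cycle of length two. The iterates of \<open>f\<^sub>a\<close> itself are always irreducible,
  because the orbit of \<open>0\<close> under a single map contains no new powers (\<open>critical_orbit_power\<close>).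

  If \<open>a = t - t ^ d\<close>, powers can occur only after the orbit enters \<open>{t, - t}\<close>. A long run of a second
  letter \<open>b\<close> keeps every orbit out of that set unless \<open>t\<close> or \<open>- t\<close> is fixed by \<open>f\<^sub>b\<close> or is the value
  \<open>f\<^sub>b(0)\<close>; for odd \<open>d\<close> the set is \<open>{t}\<close>, and only \<open>t\<close> counts. The constants \<open>b\<close> left over are the
  exceptional ones, and this settles all degrees \<open>d \<ge> 4\<close> (\<open>positive_proportion_or_exceptional\<close>).

  In degrees 2 and 3 the exceptional families have to be treated as well, where the norm test is
  silent because the relevant value really is a power. Here a factorisation is excluded by comparing
  coefficients. For \<open>d = 3\<close> and the letters \<open>t - t\<^sup>3\<close>, \<open>t = y\<^sup>3\<close>, the word \<open>[t - t\<^sup>3, t]\<close> is irreducible: the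
  coefficients give a rational curve whose integral points, after splitting coprime factors into
  cubes, satisfy \<open>x\<^sup>3 + 1 = 9 w\<^sup>3\<close>, and this is an instance of Fermat's equation for exponent 3
  (\<open>cubic_norm_system\<close>, \<open>sum_of_three_cubes_eq_0\<close>). For \<open>d = 2\<close> the possible limits of orbits are squares
  lying on fixed points or on two-cycles. A single letter has irreducible iterates anyway. If there
  are several, a run of a second letter does what is needed, where on a two-cycle the parity of the
  run of \<open>a\<close> selects the set to be avoided. Only the letters \<open>a = t - t\<^sup>2\<close> and \<open>- t\<close> with \<open>t = y\<^sup>2\<close> resist.
  There the word \<open>[a, a, - t]\<close> is irreducible
  (\<open>irreducible_quadratic_word\<close>), although the shorter word \<open>[a, - t]\<close> can be reducible, for instance
  when \<open>y = 8\<close>.\<close>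

section \<open>Complex roots of irreducible rational polynomials\<close>

abbreviation cpoly :: "rat poly \<Rightarrow> complex poly" where
  "cpoly \<equiv> map_poly of_rat"

abbreviation croots :: "rat poly \<Rightarrow> complex set" where
  "croots P \<equiv> {z. poly (cpoly P) z = 0}"

lemma cpoly_mult: "cpoly (P * Q) = cpoly P * cpoly Q"
  by (rule poly_eqI) (simp add: coeff_map_poly coeff_mult of_rat_sum of_rat_mult)

lemma cpoly_add: "cpoly (P + Q) = cpoly P + cpoly Q"
  by (rule poly_eqI) (simp add: coeff_map_poly of_rat_add)

lemma cpoly_diff: "cpoly (P - Q) = cpoly P - cpoly Q"
  by (rule poly_eqI) (simp add: coeff_map_poly of_rat_diff)

lemma cpoly_smult: "cpoly (smult c P) = smult (of_rat c) (cpoly P)"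
  by (rule poly_eqI) (simp add: coeff_map_poly of_rat_mult)

lemma cpoly_pderiv: "cpoly (pderiv P) = pderiv (cpoly P)"
  by (rule poly_eqI) (simp add: coeff_map_poly coeff_pderiv of_rat_mult of_rat_add)

lemma cpoly_eq_0_iff [simp]: "cpoly P = 0 \<longleftrightarrow> P = 0"
  by (rule map_poly_eq_0_iff) auto

lemma degree_cpoly [simp]: "degree (cpoly P) = degree P"
  by (rule degree_map_poly) auto

lemma lead_coeff_cpoly: "lead_coeff (cpoly P) = of_rat (lead_coeff P)"
  by (simp add: coeff_map_poly)

lemma finite_croots: "P \<noteq> 0 \<Longrightarrow> finite (croots P)"
  by (rule poly_roots_finite) simp

lemma poly_cpoly_of_rat: "poly (cpoly P) (of_rat x) = of_rat (poly P x)"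
  by (induction P) (auto simp: map_poly_pCons of_rat_add of_rat_mult)

lemma irreducible_dvd_if_common_root:
  assumes "irreducible H" and "z \<in> croots H" and "z \<in> croots Q"
  shows "H dvd Q"
proof (rule ccontr)
  assume "\<not> H dvd Q"
  then have "coprime H Q"
    using prime_elem_imp_coprime[OF field_poly_irreducible_imp_prime[OF assms(1)]] by blast
  then obtain u v where "u * H + v * Q = 1"
    by (metis bezout_coefficients_fst_snd coprime_imp_gcd_eq_1)
  then have "cpoly u * cpoly H + cpoly v * cpoly Q = 1"
    by (metis cpoly_add cpoly_mult map_poly_1' of_rat_1)
  then have "poly (cpoly u * cpoly H + cpoly v * cpoly Q) z = 1"
    by simp
  with assms(2,3) show False by simp
qed

lemma irreducible_degree_pos: "irreducible (H :: rat poly) \<Longrightarrow> degree H > 0"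
  by (metis irreducible_def gr0I is_unit_iff_degree)

lemma irreducible_pderiv_nonzero_at_root:
  assumes "irreducible H" and "z \<in> croots H"
  shows "poly (pderiv (cpoly H)) z \<noteq> 0"
proof
  assume "poly (pderiv (cpoly H)) z = 0"
  then have "z \<in> croots (pderiv H)" by (simp add: cpoly_pderiv)
  then have "H dvd pderiv H" by (rule irreducible_dvd_if_common_root[OF assms])
  then show False using irreducible_degree_pos[OF assms(1)] by simp
qed

lemma cpoly_irreducible_decompose:
  assumes "irreducible P" and "lead_coeff P = 1"
  shows "cpoly P = (\<Prod>z\<in>croots P. [:- z, 1:])"
proof -
  have "rsquarefree (cpoly P)"
    unfolding rsquarefree_roots using irreducible_pderiv_nonzero_at_root[OF assms(1)] by auto
  from complex_poly_decompose_rsquarefree[OF this] show ?thesis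
    using assms(2) by (simp add: lead_coeff_cpoly del: degree_cpoly)
qed

lemma card_croots_irreducible:
  assumes "irreducible P" and "lead_coeff P = 1"
  shows "card (croots P) = degree P"
proof -
  have "degree P = degree (\<Prod>z\<in>croots P. [:- z, 1:])"
    using cpoly_irreducible_decompose[OF assms] by (metis degree_cpoly)
  also have "\<dots> = (\<Sum>z\<in>croots P. degree [:- z, 1:])"
    by (rule degree_prod_eq_sum_degree) auto
  finally show ?thesis by simp
qed

lemma prod_croots_irreducible:
  assumes "irreducible P" and "lead_coeff P = 1"
  shows "\<Prod>(croots P) = of_rat ((-1) ^ degree P * poly P 0)"
proof -
  have fin: "finite (croots P)" using assms by (intro finite_croots) auto
  have "of_rat (poly P 0) = poly (cpoly P) 0"
    using poly_cpoly_of_rat[of P 0] by simp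
  also have "\<dots> = (\<Prod>z\<in>croots P. (-1) * z)"
    by (subst cpoly_irreducible_decompose[OF assms]) (simp add: poly_prod)
  also have "\<dots> = (-1) ^ degree P * \<Prod>(croots P)"
    unfolding prod.distrib using card_croots_irreducible[OF assms] by simp
  finally show ?thesis
    by (simp add: of_rat_mult of_rat_power of_rat_minus flip: mult.assoc power_mult_distrib)
qed

text \<open>The trace formula of Euler: modulo \<open>P\<close>, the polynomial \<open>x ^ k * P'\<close> equals the sum of
  \<open>z ^ k * P / (x - z)\<close> over the roots \<open>z\<close>, which has degree below that of \<open>P\<close>. Its top coefficient is the
  power sum, and it is rational because the remainder is computed over the rationals.\<close>

lemma power_sum_croots_rational:
  assumes irr: "irreducible P" and monic: "lead_coeff P = 1"
  shows "\<exists>T. (\<Sum>z\<in>croots P. z ^ k) = of_rat T"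
proof -
  define n where "n = degree P"
  have n: "n > 0" using irreducible_degree_pos[OF irr] by (simp add: n_def)
  have P0: "P \<noteq> 0" using irr by auto
  define Z where "Z = croots P"
  have fin: "finite Z" unfolding Z_def using P0 by (rule finite_croots)
  have dec: "cpoly P = (\<Prod>z\<in>Z. [:- z, 1:])"
    unfolding Z_def by (rule cpoly_irreducible_decompose[OF irr monic])
  define L where "L z = (\<Prod>w\<in>Z - {z}. [:- w, 1:])" for z :: complex
  have PL: "cpoly P = [:- z, 1:] * L z" if "z \<in> Z" for z
    unfolding dec L_def by (rule prod.remove[OF fin that])
  have degL: "degree (L z) = n - 1" and lcL: "coeff (L z) (n - 1) = 1" if "z \<in> Z" for z
  proof -
    have "L z \<noteq> 0" unfolding L_def using fin by auto
    then have "degree (cpoly P) = 1 + degree (L z)"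
      unfolding PL[OF that] by (subst degree_mult_eq) auto
    then show d: "degree (L z) = n - 1" by (simp add: n_def)
    have "lead_coeff (L z) = 1"
      unfolding L_def by (simp add: lead_coeff_prod)
    then show "coeff (L z) (n - 1) = 1" by (simp add: d)
  qed
  have deriv: "pderiv (cpoly P) = (\<Sum>z\<in>Z. L z)"
    unfolding dec pderiv_prod L_def by (simp add: pderiv_pCons)
  define S where "S = (\<Sum>z\<in>Z. synthetic_div (monom 1 k) z)"
  define C where "C = (\<Sum>z\<in>Z. smult (z ^ k) (L z))"
  have step: "monom 1 k * L z = cpoly P * synthetic_div (monom 1 k) z + smult (z ^ k) (L z)"
    if "z \<in> Z" for z
  proof -
    have "monom 1 k = [:- z, 1:] * synthetic_div (monom 1 k) z + [:z ^ k:]"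
      using synthetic_div_correct'[of z "monom 1 k"] by (simp add: poly_monom)
    then have "monom 1 k * L z = ([:- z, 1:] * synthetic_div (monom 1 k) z + [:z ^ k:]) * L z"
      by simp
    also have "\<dots> = cpoly P * synthetic_div (monom 1 k) z + smult (z ^ k) (L z)"
      unfolding PL[OF that] by (simp add: algebra_simps)
    finally show ?thesis .
  qed
  have eq1: "monom 1 k * pderiv (cpoly P) = cpoly P * S + C"
    unfolding deriv S_def C_def by (simp add: sum_distrib_left step sum.distrib)
  define Q R where "Q = (monom 1 k * pderiv P) div P" and "R = (monom 1 k * pderiv P) mod P"
  have "monom 1 k * pderiv P = P * Q + R" by (simp add: Q_def R_def)
  then have "cpoly (monom 1 k * pderiv P) = cpoly P * cpoly Q + cpoly R"
    by (simp add: cpoly_add cpoly_mult)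
  then have eq2: "monom 1 k * pderiv (cpoly P) = cpoly P * cpoly Q + cpoly R"
    by (simp add: cpoly_mult cpoly_pderiv map_poly_monom)
  have dR: "degree (cpoly R) < n"
    using degree_mod_less[OF P0, of "monom 1 k * pderiv P"] n unfolding R_def n_def by auto
  have dC: "degree C \<le> n - 1"
    unfolding C_def by (rule degree_sum_le[OF fin]) (metis degL degree_smult_le)
  have "cpoly P * (S - cpoly Q) = cpoly R - C"
    using eq1 eq2 by (simp add: algebra_simps)
  moreover have "degree (cpoly R - C) < n"
    using dR dC n by (metis degree_diff_less diff_less le_less_trans zero_less_one)
  ultimately have "S - cpoly Q = 0"
    using P0 by (metis cpoly_eq_0_iff degree_cpoly degree_mult_eq le_add1 linorder_not_less n_def)
  with \<open>cpoly P * (S - cpoly Q) = cpoly R - C\<close> have "C = cpoly R" by simp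
  then have "coeff C (n - 1) = of_rat (coeff R (n - 1))"
    by (simp add: coeff_map_poly)
  moreover have "coeff C (n - 1) = (\<Sum>z\<in>Z. z ^ k)"
    unfolding C_def coeff_sum coeff_smult by (intro sum.cong) (simp_all only: lcL mult_1_right)
  ultimately show ?thesis unfolding Z_def by metis
qed

section \<open>Substituting a power of the variable\<close>

lemma croots_factor_pcompose_power:
  assumes "P dvd pcompose H (monom 1 p)" and "z \<in> croots P"
  shows "z ^ p \<in> croots H"
proof -
  obtain Q where "pcompose H (monom 1 p) = P * Q" using assms(1) by (elim dvdE)
  then have "poly (cpoly (pcompose H (monom 1 p))) z = 0"
    using assms(2) by (simp add: cpoly_mult)
  moreover have "cpoly (pcompose H (monom 1 p)) = pcompose (cpoly H) (monom 1 p)"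
    by (induction H) (auto simp: pcompose_pCons map_poly_pCons cpoly_add cpoly_mult map_poly_monom)
  ultimately show ?thesis by (simp add: poly_pcompose poly_monom)
qed

text \<open>This replaces the tower of fields generated by a root \<open>z\<close> of \<open>P\<close> over the field generated by \<open>z ^ p\<close>.
  The rational polynomial \<open>V\<close> below takes at each root \<open>\<beta>\<close> of \<open>H\<close> the value \<open>c(\<beta>) * H'(\<beta>)\<close>, where \<open>c(\<beta>)\<close>
  counts the roots of \<open>P\<close> above \<open>\<beta>\<close>. Hence \<open>V - c(\<alpha>) * H'\<close> vanishes at the root \<open>\<alpha>\<close>, is therefore
  divisible by the irreducible \<open>H\<close>, and vanishes at all roots.\<close>

lemma card_power_fibre_constant:
  fixes H P :: "rat poly" and p :: nat
  assumes irrH: "irreducible H" and irrP: "irreducible P" and monP: "lead_coeff P = 1"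
    and dvd: "P dvd pcompose H (monom 1 p)"
  shows "\<exists>m. \<forall>\<alpha>\<in>croots H. card {z \<in> croots P. z ^ p = \<alpha>} = m"
proof -
  have cardP: "finite (croots P)" using irrP by (intro finite_croots) auto
  have finH: "finite (croots H)" using irrH by (intro finite_croots) auto
  have img: "z ^ p \<in> croots H" if "z \<in> croots P" for z
    by (rule croots_factor_pcompose_power[OF dvd that])
  obtain T where T: "(\<Sum>z\<in>croots P. z ^ k) = of_rat (T k)" for k
    using power_sum_croots_rational[OF irrP monP] by metis
  define c where "c \<alpha> = card {z \<in> croots P. z ^ p = \<alpha>}" for \<alpha> :: complex
  define D where "D = degree H"
  define V :: "rat poly" where
    "V = (\<Sum>j\<le>D. \<Sum>i<j. monom (coeff H j * T (p * (j - Suc i))) i)"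
  \<comment> \<open>\<open>q\<close> is the divided difference \<open>(H(\<beta>) - H(\<alpha>)) / (\<beta> - \<alpha>)\<close>, and \<open>V\<close> is the sum of \<open>q (z ^ p)\<close> over
    the roots \<open>z\<close> of \<open>P\<close>; only power sums of those roots enter, so \<open>V\<close> is rational.\<close>
  define q where
    "q \<alpha> \<beta> = (\<Sum>j\<le>D. of_rat (coeff H j) * (\<Sum>i<j. \<alpha> ^ (j - Suc i) * \<beta> ^ i))" for \<alpha> \<beta> :: complex
  have Hval: "poly (cpoly H) x = (\<Sum>j\<le>D. of_rat (coeff H j) * x ^ j)" for x
    by (simp add: poly_altdef coeff_map_poly D_def)
  have q_diff: "(\<beta> - \<alpha>) * q \<alpha> \<beta> = poly (cpoly H) \<beta> - poly (cpoly H) \<alpha>" for \<alpha> \<beta>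
  proof -
    have "(\<beta> - \<alpha>) * q \<alpha> \<beta> =
        (\<Sum>j\<le>D. of_rat (coeff H j) * ((\<beta> - \<alpha>) * (\<Sum>i<j. \<alpha> ^ (j - Suc i) * \<beta> ^ i)))"
      unfolding q_def by (subst sum_distrib_left) (simp only: mult.left_commute)
    also have "\<dots> = (\<Sum>j\<le>D. of_rat (coeff H j) * (\<beta> ^ j - \<alpha> ^ j))"
      by (simp only: power_diff_sumr2)
    finally show ?thesis
      by (simp add: Hval right_diff_distrib sum_subtractf)
  qed
  have q_diag: "q \<alpha> \<alpha> = poly (pderiv (cpoly H)) \<alpha>" for \<alpha>
  proof -
    have "q \<alpha> \<alpha> = (\<Sum>j\<le>D. of_rat (coeff H j) * (of_nat j * \<alpha> ^ (j - 1)))"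
      unfolding q_def
    proof (intro sum.cong arg_cong2[where f = "(*)"] refl)
      fix j
      have "(\<Sum>i<j. \<alpha> ^ (j - Suc i) * \<alpha> ^ i) = (\<Sum>i<j. \<alpha> ^ (j - 1))"
        by (intro sum.cong) (auto simp flip: power_add)
      then show "(\<Sum>i<j. \<alpha> ^ (j - Suc i) * \<alpha> ^ i) = of_nat j * \<alpha> ^ (j - 1)" by simp
    qed
    also have "\<dots> = poly (pderiv (\<Sum>j\<le>D. monom (of_rat (coeff H j)) j)) \<alpha>"
    proof -
      have "pderiv (sum f A) = (\<Sum>x\<in>A. pderiv (f x))" for f :: "nat \<Rightarrow> complex poly" and A
        by (induction A rule: infinite_finite_induct) (auto simp: pderiv_add)
      then show ?thesis by (simp add: poly_sum pderiv_monom poly_monom algebra_simps)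
    qed
    also have "(\<Sum>j\<le>D. monom (of_rat (coeff H j)) j) = cpoly H"
      using poly_as_sum_of_monoms[of "cpoly H"] by (simp add: coeff_map_poly D_def)
    finally show ?thesis .
  qed
  have V_eq: "poly (cpoly V) \<beta> = of_nat (c \<beta>) * poly (pderiv (cpoly H)) \<beta>"
    if \<beta>: "\<beta> \<in> croots H" for \<beta>
  proof -
    have "cpoly V = (\<Sum>j\<le>D. \<Sum>i<j. monom (of_rat (coeff H j) * of_rat (T (p * (j - Suc i)))) i)"
      unfolding V_def by (rule poly_eqI) (simp add: coeff_map_poly coeff_sum of_rat_sum of_rat_mult if_distrib cong: if_cong)
    then have "poly (cpoly V) \<beta> =
      (\<Sum>j\<le>D. \<Sum>i<j. of_rat (coeff H j) * (\<Sum>z\<in>croots P. z ^ (p * (j - Suc i))) * \<beta> ^ i)"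
      by (simp add: poly_sum poly_monom T)
    also have "\<dots> = (\<Sum>j\<le>D. \<Sum>i<j. \<Sum>z\<in>croots P. of_rat (coeff H j) * ((z ^ p) ^ (j - Suc i) * \<beta> ^ i))"
      by (simp add: sum_distrib_left sum_distrib_right power_mult mult.assoc)
    also have "\<dots> = (\<Sum>z\<in>croots P. q (z ^ p) \<beta>)"
      unfolding q_def sum_distrib_left
      by (subst (2) sum.swap, subst sum.swap) (rule refl)
    also have "\<dots> = (\<Sum>z\<in>croots P. if z ^ p = \<beta> then poly (pderiv (cpoly H)) \<beta> else 0)"
    proof (intro sum.cong refl)
      fix z assume z: "z \<in> croots P"
      have "q (z ^ p) \<beta> = 0" if "z ^ p \<noteq> \<beta>"
        using q_diff[of \<beta> "z ^ p"] img[OF z] \<beta> that by simp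
      then show "q (z ^ p) \<beta> = (if z ^ p = \<beta> then poly (pderiv (cpoly H)) \<beta> else 0)"
        using q_diag by auto
    qed
    also have "\<dots> = of_nat (c \<beta>) * poly (pderiv (cpoly H)) \<beta>"
      unfolding c_def by (simp add: sum.If_cases cardP Int_def)
    finally show ?thesis .
  qed
  show ?thesis
  proof (cases "croots H = {}")
    case False
    then obtain \<alpha> where \<alpha>: "\<alpha> \<in> croots H" by blast
    have "\<alpha> \<in> croots (V - smult (of_nat (c \<alpha>)) (pderiv H))"
      using V_eq[OF \<alpha>] by (simp add: cpoly_diff cpoly_smult cpoly_pderiv)
    then have "H dvd V - smult (of_nat (c \<alpha>)) (pderiv H)"
      by (rule irreducible_dvd_if_common_root[OF irrH \<alpha>])
    then obtain W where W: "V - smult (of_nat (c \<alpha>)) (pderiv H) = H * W" by (elim dvdE)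
    have "c \<beta> = c \<alpha>" if \<beta>: "\<beta> \<in> croots H" for \<beta>
    proof -
      have "poly (cpoly (V - smult (of_nat (c \<alpha>)) (pderiv H))) \<beta> = 0"
        unfolding W using \<beta> by (simp add: cpoly_mult)
      then have "of_nat (c \<beta>) * poly (pderiv (cpoly H)) \<beta> = of_nat (c \<alpha>) * poly (pderiv (cpoly H)) \<beta>"
        using V_eq[OF \<beta>] by (simp add: cpoly_diff cpoly_smult cpoly_pderiv)
      then show ?thesis using irreducible_pderiv_nonzero_at_root[OF irrH \<beta>] by simp
    qed
    then show ?thesis unfolding c_def by blast
  qed auto
qed

lemma coprime_exponents_root:
  fixes a b :: "'a :: field"
  assumes "b ^ p = a ^ m" and "coprime m p" and "p > 0"
  shows "\<exists>r. a = r ^ p"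
proof (cases "a = 0")
  case True
  then show ?thesis using assms(3) by (intro exI[of _ 0]) simp
next
  case False
  then have b0: "b \<noteq> 0" if "m > 0" using assms that by (auto simp: power_0_left)
  obtain u v where uv: "u * int m + v * int p = 1"
    using assms(2) by (metis bezout_int coprime_imp_gcd_eq_1 coprime_int_iff)
  show ?thesis
  proof (cases "m = 0")
    case True
    with assms(2) show ?thesis by (intro exI[of _ a]) simp
  next
    case m: False
    with b0 have b0: "b \<noteq> 0" by simp
    have "a = a powi (u * int m + v * int p)" using uv by simp
    also have "\<dots> = a powi (int m * u) * a powi (v * int p)"
      using False by (simp add: power_int_add mult.commute)
    also have "\<dots> = (a powi int m) powi u * (a powi v) powi int p"
      by (simp only: power_int_mult)
    also have "a powi int m = b powi int p" using assms(1) by simp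
    also have "(b powi int p) powi u = (b powi u) powi int p"
      by (simp only: mult.commute flip: power_int_mult)
    finally have "a = (b powi u * a powi v) ^ p"
      by (simp add: power_mult_distrib)
    then show ?thesis by blast
  qed
qed

text \<open>Taking the product of \<open>z ^ p\<close> over the roots of \<open>P\<close> meets each root of \<open>H\<close> exactly \<open>m\<close> times. Up to
  sign, the products of the roots are the constant coefficients.\<close>

lemma irreducible_factor_pcompose_power:
  fixes H P :: "rat poly"
  assumes irrH: "irreducible H" and monH: "lead_coeff H = 1"
    and irrP: "irreducible P" and monP: "lead_coeff P = 1"
    and p: "p > 0" and dvd: "P dvd pcompose H (monom 1 p)"
  obtains m where "degree P = m * degree H"
    and "((-1) ^ degree P * poly P 0) ^ p = ((-1) ^ degree H * poly H 0) ^ m"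
proof -
  obtain m where m: "\<And>\<alpha>. \<alpha> \<in> croots H \<Longrightarrow> card {z \<in> croots P. z ^ p = \<alpha>} = m"
    using card_power_fibre_constant[OF irrH irrP monP dvd] by blast
  have finP: "finite (croots P)" using irrP by (intro finite_croots) auto
  have finH: "finite (croots H)" using irrH by (intro finite_croots) auto
  have img: "(\<lambda>z. z ^ p) ` croots P \<subseteq> croots H"
    using croots_factor_pcompose_power[OF dvd] by blast
  have "card (croots P) = (\<Sum>\<alpha>\<in>croots H. card {z \<in> croots P. z ^ p = \<alpha>})"
    using sum.group[OF finP finH img, of "\<lambda>_. 1 :: nat"] by simp
  then have deg: "degree P = m * degree H"
    using m card_croots_irreducible[OF irrP monP] card_croots_irreducible[OF irrH monH] by simp
  have "(\<Prod>(croots P)) ^ p = (\<Prod>z\<in>croots P. z ^ p)"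
    by (simp add: prod_power_distrib)
  also have "\<dots> = (\<Prod>\<alpha>\<in>croots H. \<Prod>z\<in>{z \<in> croots P. z ^ p = \<alpha>}. z ^ p)"
    using prod.group[OF finP finH img, of "\<lambda>z. z ^ p"] by simp
  also have "\<dots> = (\<Prod>\<alpha>\<in>croots H. \<alpha> ^ m)"
  proof (intro prod.cong refl)
    fix \<alpha> assume "\<alpha> \<in> croots H"
    have "(\<Prod>z\<in>{z \<in> croots P. z ^ p = \<alpha>}. z ^ p) = (\<Prod>z\<in>{z \<in> croots P. z ^ p = \<alpha>}. \<alpha>)"
      by (intro prod.cong) auto
    then show "(\<Prod>z\<in>{z \<in> croots P. z ^ p = \<alpha>}. z ^ p) = \<alpha> ^ m"
      using m[OF \<open>\<alpha> \<in> croots H\<close>] by simp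
  qed
  also have "\<dots> = (\<Prod>(croots H)) ^ m"
    by (simp add: prod_power_distrib)
  finally have "complex_of_rat (((-1) ^ degree P * poly P 0) ^ p) = of_rat (((-1) ^ degree H * poly H 0) ^ m)"
    unfolding prod_croots_irreducible[OF irrP monP] prod_croots_irreducible[OF irrH monH] of_rat_power .
  then have "((-1) ^ degree P * poly P 0) ^ p = ((-1) ^ degree H * poly H 0) ^ m"
    by (simp only: of_rat_eq_iff)
  with deg show ?thesis by (rule that)
qed

lemma monic_scaling:
  fixes P :: "rat poly"
  assumes "irreducible P"
  obtains P' where "irreducible P'" "lead_coeff P' = 1" "degree P' = degree P" "\<And>Q. P' dvd Q \<longleftrightarrow> P dvd Q"
proof
  have l0: "lead_coeff P \<noteq> 0" using assms by auto
  let ?P = "smult (inverse (lead_coeff P)) P"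
  show "lead_coeff ?P = 1" "degree ?P = degree P" using l0 by auto
  show "?P dvd Q \<longleftrightarrow> P dvd Q" for Q using l0 by (simp add: smult_dvd_iff)
  have "?P = [:inverse (lead_coeff P):] * P" by simp
  moreover have "is_unit [:inverse (lead_coeff P):]" using l0 by (simp add: is_unit_pCons_iff)
  ultimately show "irreducible ?P" using assms irreducible_mult_unit_left by metis
qed

lemma reducible_imp_small_irreducible_factor:
  fixes F :: "rat poly"
  assumes deg: "degree F > 0" and red: "\<not> irreducible F"
  obtains P where "irreducible P" "lead_coeff P = 1" "P dvd F" "2 * degree P \<le> degree F"
proof -
  note result = that
  have F0: "F \<noteq> 0" using deg by auto
  have "\<not> is_unit F" using deg by (simp add: is_unit_iff_degree F0)
  with red F0 obtain A B where AB: "F = A * B" "\<not> is_unit A" "\<not> is_unit B"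
    unfolding irreducible_def by blast
  have *: thesis if AB: "F = A * B" "\<not> is_unit A" "degree A \<le> degree B" for A B
  proof -
    have "A \<noteq> 0" "B \<noteq> 0" using AB F0 by auto
    then have degs: "degree F = degree A + degree B" using AB by (simp add: degree_mult_eq)
    obtain P where P: "P dvd A" "prime P" using prime_divisor_exists[OF \<open>A \<noteq> 0\<close> AB(2)] by blast
    from P(2) have irrP: "irreducible P" by (simp add: prime_imp_prime_elem prime_elem_imp_irreducible)
    obtain P' where P': "irreducible P'" "lead_coeff P' = 1" "degree P' = degree P"
      "\<And>Q. P' dvd Q \<longleftrightarrow> P dvd Q" using monic_scaling[OF irrP] by blast
    have "degree P \<le> degree A" using P(1) \<open>A \<noteq> 0\<close> by (rule dvd_imp_degree_le)
    then show thesis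
      using AB(1,3) P(1) degs by (intro result[OF P'(1,2)]) (auto simp: P'(3,4))
  qed
  show thesis
  proof (cases "degree A \<le> degree B")
    case True
    with * AB show thesis by blast
  next
    case False
    with *[of B A] AB show thesis by (simp add: mult.commute)
  qed
qed

lemma reducible_pcompose_power_factor:
  fixes H :: "rat poly"
  assumes irrH: "irreducible H" and monH: "lead_coeff H = 1" and p: "p > 0"
    and red: "\<not> irreducible (pcompose H (monom 1 p))"
  obtains P m where "irreducible P" "lead_coeff P = 1" "P dvd pcompose H (monom 1 p)"
    "degree P = m * degree H" "m > 0" "2 * m \<le> p"
    "((-1) ^ degree P * poly P 0) ^ p = ((-1) ^ degree H * poly H 0) ^ m"
proof -
  have D: "degree H > 0" by (rule irreducible_degree_pos[OF irrH])
  have deg: "degree (pcompose H (monom 1 p)) = degree H * p"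
    by (simp add: degree_pcompose degree_monom_eq)
  then have pos: "degree (pcompose H (monom 1 p)) > 0" using D p by simp
  obtain P where P: "irreducible P" "lead_coeff P = 1" "P dvd pcompose H (monom 1 p)"
    "2 * degree P \<le> degree H * p"
    using reducible_imp_small_irreducible_factor[OF pos red] deg by metis
  obtain m where m: "degree P = m * degree H"
    "((-1) ^ degree P * poly P 0) ^ p = ((-1) ^ degree H * poly H 0) ^ m"
    using irreducible_factor_pcompose_power[OF irrH monH P(1,2) p P(3)] .
  have "m > 0" using irreducible_degree_pos[OF P(1)] m(1) by (cases m) auto
  moreover have "2 * m * degree H \<le> p * degree H" using P(4) m(1) by (simp add: algebra_simps)
  then have "2 * m \<le> p" using D by simp
  ultimately show thesis using P m that by blast
qed

text \<open>A proper factor gives \<open>b ^ p = a ^ m\<close> with \<open>0 < m < p\<close>, where \<open>a\<close> is the signed constant coefficient of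
  \<open>H\<close>. As \<open>m\<close> and \<open>p\<close> are coprime, \<open>a\<close> is a \<open>p\<close>-th power.\<close>

lemma irreducible_pcompose_prime_power:
  fixes H :: "rat poly"
  assumes irrH: "irreducible H" and monH: "lead_coeff H = 1" and p: "prime p"
    and np: "\<And>r. (-1) ^ degree H * poly H 0 \<noteq> r ^ p"
  shows "irreducible (pcompose H (monom 1 p))"
proof (rule ccontr)
  assume red: "\<not> irreducible (pcompose H (monom 1 p))"
  have p0: "p > 0" using p by (simp add: prime_gt_0_nat)
  obtain P m where m: "m > 0" "2 * m \<le> p"
    "((-1) ^ degree P * poly P 0) ^ p = ((-1) ^ degree H * poly H 0) ^ m"
    using reducible_pcompose_power_factor[OF irrH monH p0 red] by metis
  have "\<not> p dvd m" using m(1,2) by (auto dest: dvd_imp_le)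
  then have "coprime m p" using p prime_imp_coprime coprime_commute by blast
  from coprime_exponents_root[OF m(3) this p0] np show False by blast
qed

lemma pcompose_monom_one: "pcompose (monom 1 d) q = (q :: 'a :: comm_semiring_1 poly) ^ d"
  by (induction d) (simp_all add: monom_Suc pcompose_pCons monom_0 pcompose_1 flip: one_pCons)

lemma pcompose_monom_monom: "pcompose (monom 1 p) (monom 1 e) = (monom 1 (p * e) :: 'a :: comm_semiring_1 poly)"
  by (simp add: pcompose_monom_one monom_power mult.commute)

lemma lead_coeff_pcompose_monic:
  fixes F g :: "rat poly"
  assumes "lead_coeff F = 1" "lead_coeff g = 1" "degree g > 0"
  shows "lead_coeff (pcompose F g) = 1"
  using assms by (simp add: lead_coeff_comp)

text \<open>The exponent \<open>d\<close> is built up one prime at a time, which leaves the constant coefficient unchanged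
  and avoids the exceptional fourth powers in the criterion of Capelli for \<open>x ^ d - \<alpha>\<close>. The parity
  condition removes the sign \<open>(-1) ^ degree H\<close>: it matters only for \<open>p = 2\<close>, and then the degree is even.\<close>

lemma irreducible_pcompose_power:
  fixes H :: "rat poly"
  assumes "irreducible H" and "lead_coeff H = 1" and "d > 0"
    and "even (degree H) \<or> odd d"
    and "\<And>p r. prime p \<Longrightarrow> p dvd d \<Longrightarrow> poly H 0 \<noteq> r ^ p"
  shows "irreducible (pcompose H (monom 1 d))"
  using assms
proof (induction d arbitrary: H rule: less_induct)
  case (less d)
  show ?case
  proof (cases "d = 1")
    case True
    have "monom 1 1 = ([:0, 1:] :: rat poly)" by (simp add: monom_Suc monom_0)
    with True less.prems show ?thesis by (simp add: monom_Suc monom_0)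
  next
    case False
    then obtain p where p: "prime p" "p dvd d" using prime_factor_nat by blast
    then obtain e where e: "d = p * e" by (elim dvdE)
    with less.prems have e0: "e > 0" by auto
    have ed: "e < d" using e e0 prime_gt_1_nat[OF p(1)] by simp
    define H1 where "H1 = pcompose H (monom 1 p)"
    have irr1: "irreducible H1" unfolding H1_def
    proof (rule irreducible_pcompose_prime_power[OF less.prems(1,2) p(1)])
      fix r
      show "(-1) ^ degree H * poly H 0 \<noteq> r ^ p"
      proof (cases "even (degree H)")
        case True
        with less.prems(5)[OF p] show ?thesis by simp
      next
        case False
        with less.prems(4) e have "odd p" by auto
        then have "(- r) ^ p = - (r ^ p)" by simp
        with False less.prems(5)[OF p, of "- r"] show ?thesis
          by (metis add.inverse_inverse mult_minus1 neg_one_odd_power)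
      qed
    qed
    have p0: "p > 0" using p by (simp add: prime_gt_0_nat)
    have "irreducible (pcompose H1 (monom 1 e))"
    proof (rule less.IH[OF ed irr1 _ e0])
      show "lead_coeff H1 = 1" unfolding H1_def
        by (rule lead_coeff_pcompose_monic) (use less.prems(2) p0 in \<open>auto simp: degree_monom_eq\<close>)
      show "even (degree H1) \<or> odd e"
        using less.prems(4) by (auto simp: H1_def degree_pcompose degree_monom_eq e)
      fix q r assume "prime q" "q dvd e"
      then show "poly H1 0 \<noteq> r ^ q"
        using less.prems(5)[of q r] p0 by (simp add: H1_def poly_pcompose poly_monom e power_0_left)
    qed
    then show ?thesis
      unfolding H1_def pcompose_assoc[symmetric] pcompose_monom_monom e[symmetric] .
  qed
qed

lemma rat_root_of_int_is_int:
  fixes r :: rat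
  assumes "of_int N = r ^ p" and "p > 0"
  obtains z where "N = z ^ p"
proof -
  obtain a b where ab: "quotient_of r = (a, b)" by force
  then have b: "b > 0" and cop: "coprime a b" and r: "r = of_int a / of_int b"
    using quotient_of_denom_pos quotient_of_coprime quotient_of_div by auto
  have "of_int N * of_int b ^ p = (of_int a ^ p :: rat)"
    using assms(1) b by (simp add: r power_divide)
  then have eq: "N * b ^ p = a ^ p" by (metis of_int_eq_iff of_int_mult of_int_power)
  then have "b ^ p dvd a ^ p" by (metis dvd_triv_right)
  then have "b dvd a" using assms(2) by simp
  with cop b have "b = 1" by (metis coprime_common_divisor dvd_refl zdvd1_eq abs_of_pos)
  with eq that show thesis by simp
qed

section \<open>Words and the polynomials they compose\<close>

definition ucrit :: "nat \<Rightarrow> int \<Rightarrow> int \<Rightarrow> int" where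
  "ucrit d c x = x ^ d + c"

definition word_val :: "nat \<Rightarrow> int list \<Rightarrow> int \<Rightarrow> int" where
  "word_val d cs x = foldr (ucrit d) cs x"

definition word_poly :: "nat \<Rightarrow> int list \<Rightarrow> rat poly" where
  "word_poly d cs = foldr (\<lambda>c g. pcompose (unicritical_poly d c) g) cs [:0, 1:]"

definition divisor_power :: "nat \<Rightarrow> int \<Rightarrow> bool" where
  "divisor_power d x \<longleftrightarrow> (\<exists>p z. prime p \<and> p dvd d \<and> x = z ^ p)"

lemma word_val_simps [simp]:
  "word_val d [] x = x" "word_val d (c # cs) x = ucrit d c (word_val d cs x)"
  "word_val d (cs @ ds) x = word_val d cs (word_val d ds x)"
  by (simp_all add: word_val_def)

lemma word_val_replicate [simp]: "word_val d (replicate n c) x = (ucrit d c ^^ n) x"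
  by (induction n) auto

lemma word_poly_simps [simp]:
  "word_poly d [] = [:0, 1:]"
  "word_poly d (c # cs) = pcompose (unicritical_poly d c) (word_poly d cs)"
  by (simp_all add: word_poly_def)

lemma pcompose_id_left: "pcompose [:0, 1:] g = (g :: 'a :: comm_semiring_1 poly)"
  by (simp add: pcompose_pCons)

lemma word_poly_append: "word_poly d (cs @ ds) = pcompose (word_poly d cs) (word_poly d ds)"
  by (induction cs) (simp_all add: pcompose_id_left pcompose_assoc)

lemma degree_unicritical: "d > 0 \<Longrightarrow> degree (unicritical_poly d c) = d"
  unfolding unicritical_poly_def by (subst degree_add_eq_left) (auto simp: degree_monom_eq)

lemma lead_coeff_unicritical: "d > 0 \<Longrightarrow> lead_coeff (unicritical_poly d c) = 1"
  by (simp only: degree_unicritical) (simp add: unicritical_poly_def coeff_pCons split: nat.split)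

lemma degree_word_poly: "d > 0 \<Longrightarrow> degree (word_poly d cs) = d ^ length cs"
  by (induction cs) (simp_all add: degree_pcompose degree_unicritical)

lemma lead_coeff_word_poly: "d > 0 \<Longrightarrow> lead_coeff (word_poly d cs) = 1"
  by (induction cs)
    (simp_all only: word_poly_simps, simp_all add: lead_coeff_pcompose_monic lead_coeff_unicritical degree_word_poly
      del: word_poly_simps)

lemma poly_word_poly: "poly (word_poly d cs) (of_int x) = of_int (word_val d cs x)"
  by (induction cs) (simp_all add: poly_pcompose unicritical_poly_def poly_monom ucrit_def)

lemma unit_poly_degree: "is_unit (f :: rat poly) \<Longrightarrow> degree f = 0"
proof (cases "f = 0")
  case False
  assume "is_unit f"
  with False show ?thesis by (metis is_unit_iff_degree)
qed simp

lemma irreducible_pcompose_imp_irreducible: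
  fixes f g :: "rat poly"
  assumes "irreducible (pcompose f g)" and g: "degree g > 0"
  shows "irreducible f"
proof (rule irreducibleI)
  have deg: "degree (pcompose f g) = degree f * degree g" by (rule degree_pcompose)
  with irreducible_degree_pos[OF assms(1)] have f: "degree f > 0" by (simp add: zero_less_mult_iff)
  then show "f \<noteq> 0" by auto
  show "\<not> is_unit f" using f unit_poly_degree by force
  fix a b assume ab: "f = a * b"
  then have "pcompose f g = pcompose a g * pcompose b g" by (simp add: pcompose_mult)
  then have "is_unit (pcompose a g) \<or> is_unit (pcompose b g)"
    using irreducibleD[OF assms(1)] by blast
  then have "degree (pcompose a g) = 0 \<or> degree (pcompose b g) = 0"
    by (elim disjE) (simp_all add: unit_poly_degree)
  then have "degree a = 0 \<or> degree b = 0" using g by (simp add: degree_pcompose)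
  then show "is_unit a \<or> is_unit b"
    using \<open>f \<noteq> 0\<close> ab by (auto simp: is_unit_iff_degree)
qed

lemma irreducible_shift:
  fixes f :: "rat poly"
  assumes "irreducible f"
  shows "irreducible (pcompose f [:c, 1:])"
proof (rule irreducible_pcompose_imp_irreducible[of _ "[:- c, 1:]"])
  show "irreducible (pcompose (pcompose f [:c, 1:]) [:- c, 1:])"
    using assms by (simp flip: pcompose_assoc add: pcompose_pCons)
qed simp

lemma word_poly_snoc:
  "word_poly d (cs @ [c]) = pcompose (pcompose (word_poly d cs) [:of_int c, 1:]) (monom 1 d)"
  by (simp add: word_poly_append unicritical_poly_def pcompose_pCons add.commute flip: pcompose_assoc)

text \<open>Appending a letter composes on the inside. After the shift \<open>x + c\<close> the polynomial \<open>H\<close> of the shorter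
  word has constant coefficient \<open>word_val d cs c\<close>, and what remains is the substitution of \<open>x ^ d\<close>.\<close>

lemma irreducible_word_snoc:
  assumes d: "d \<ge> 2" and ne: "cs \<noteq> []" and irr: "irreducible (word_poly d cs)"
    and np: "\<not> divisor_power d (word_val d cs c)"
  shows "irreducible (word_poly d (cs @ [c]))"
  unfolding word_poly_snoc
proof (rule irreducible_pcompose_power)
  let ?H = "pcompose (word_poly d cs) [:rat_of_int c, 1:]"
  show "irreducible ?H" by (rule irreducible_shift[OF irr])
  show "lead_coeff ?H = 1"
    by (rule lead_coeff_pcompose_monic) (use lead_coeff_word_poly d in auto)
  show "d > 0" using d by simp
  show "even (degree ?H) \<or> odd d"
    using ne d by (auto simp: degree_pcompose degree_word_poly)
  fix p r assume p: "prime p" "p dvd d"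
  have p0: "p > 0" using p by (simp add: prime_gt_0_nat)
  have val: "poly ?H 0 = of_int (word_val d cs c)"
    by (simp add: poly_pcompose poly_word_poly)
  show "poly ?H 0 \<noteq> r ^ p"
  proof
    assume "poly ?H 0 = r ^ p"
    then obtain z where "word_val d cs c = z ^ p"
      using rat_root_of_int_is_int[OF _ p0] val by metis
    with p np show False by (auto simp: divisor_power_def)
  qed
qed

lemma irreducible_word_first_letter:
  assumes "irreducible (word_poly d (c # cs))" and "d > 0"
  shows "irreducible (word_poly d [c])"
  using irreducible_pcompose_imp_irreducible[of "unicritical_poly d c" "word_poly d cs"] assms
  by (simp add: degree_word_poly)

lemma comp_semigroup_unicritical:
  "comp_semigroup (unicritical_poly d ` C) = {word_poly d cs |cs. cs \<noteq> [] \<and> set cs \<subseteq> C}"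
proof (intro equalityI subsetI)
  fix g assume "g \<in> comp_semigroup (unicritical_poly d ` C)"
  then show "g \<in> {word_poly d cs |cs. cs \<noteq> [] \<and> set cs \<subseteq> C}"
  proof induction
    case (generator f)
    then obtain c where "c \<in> C" "f = word_poly d [c]" by auto
    then show ?case by (intro CollectI exI[of _ "[c]"]) auto
  next
    case (compose f g)
    then obtain c cs where "c \<in> C" "f = unicritical_poly d c" "g = word_poly d cs" "set cs \<subseteq> C" by blast
    then show ?case by (intro CollectI exI[of _ "c # cs"]) auto
  qed
next
  have "word_poly d cs \<in> comp_semigroup (unicritical_poly d ` C)" if "cs \<noteq> []" "set cs \<subseteq> C" for cs
    using that
  proof (induction cs rule: list_nonempty_induct)
    case (single c)
    then show ?case by (auto intro!: comp_semigroup.generator)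
  next
    case (cons c cs)
    then show ?case by (auto intro!: comp_semigroup.compose)
  qed
  then show "g \<in> comp_semigroup (unicritical_poly d ` C)"
    if "g \<in> {word_poly d cs |cs. cs \<noteq> [] \<and> set cs \<subseteq> C}" for g
    using that by auto
qed

text \<open>If \<open>g \<noteq> h\<close>, then \<open>g ^ d - h ^ d\<close> has the cofactor \<open>g ^ (d-1) + \<dots> + h ^ (d-1)\<close> with leading
  coefficient \<open>d\<close>, hence positive degree, and cannot be the constant \<open>c' - c\<close>.\<close>

lemma unicritical_cancel:
  fixes g h :: "rat poly"
  assumes d: "d \<ge> 2" and mon: "lead_coeff g = 1" "lead_coeff h = 1"
    and deg: "degree h = degree g" "degree g > 0"
    and eq: "pcompose (unicritical_poly d c) g = pcompose (unicritical_poly d c') h"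
  shows "c = c' \<and> g = h"
proof -
  have eq': "g ^ d - h ^ d = [:of_int (c' - c):]"
    using eq by (simp add: unicritical_poly_def pcompose_add pcompose_monom_one algebra_simps) (simp add: algebra_simps flip: eq_diff_eq)
  have gh: "g = h"
  proof (rule ccontr)
    assume "g \<noteq> h"
    define n where "n = degree g"
    define S where "S = (\<Sum>i<d. h ^ (d - Suc i) * g ^ i)"
    have "g \<noteq> 0" "h \<noteq> 0" using mon by auto
    have "coeff (h ^ (d - Suc i) * g ^ i) ((d - 1) * n) = 1" if "i < d" for i
    proof -
      have "degree (h ^ (d - Suc i) * g ^ i) = (d - Suc i) * n + i * n"
        using \<open>g \<noteq> 0\<close> \<open>h \<noteq> 0\<close> deg by (subst degree_mult_eq) (auto simp: degree_power_eq n_def)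
      also have "\<dots> = (d - 1) * n" using that by (simp flip: add_mult_distrib)
      finally have "coeff (h ^ (d - Suc i) * g ^ i) ((d - 1) * n) = lead_coeff (h ^ (d - Suc i) * g ^ i)"
        by simp
      then show ?thesis by (simp add: lead_coeff_mult lead_coeff_power mon)
    qed
    then have "coeff S ((d - 1) * n) = of_nat d" by (simp add: S_def coeff_sum)
    then have cS: "coeff S ((d - 1) * n) \<noteq> 0" using d by simp
    then have "degree S \<ge> (d - 1) * n" by (rule le_degree)
    moreover have "(d - 1) * n > 0" using d deg by (simp add: n_def)
    ultimately have degS: "degree S > 0" by linarith
    have S0: "S \<noteq> 0" using cS by auto
    have "g ^ d - h ^ d = (g - h) * S" unfolding S_def by (rule power_diff_sumr2)
    then have "degree (g ^ d - h ^ d) = degree (g - h) + degree S"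
      using \<open>g \<noteq> h\<close> S0 by (simp add: degree_mult_eq)
    with degS eq' show False by simp
  qed
  with eq' have "[:rat_of_int (c' - c):] = 0" by simp
  with gh show ?thesis by simp
qed

lemma word_poly_inj:
  assumes d: "d \<ge> 2" and eq: "word_poly d cs = word_poly d ds"
  shows "cs = ds"
proof -
  have d0: "d > 0" using d by simp
  have "d ^ length cs = d ^ length ds"
    using eq degree_word_poly[OF d0] by metis
  then have "length cs = length ds" using d by (simp add: power_inject_exp)
  then show ?thesis using eq
  proof (induction cs ds rule: list_induct2)
    case (Cons c cs c' ds)
    have "c = c' \<and> word_poly d cs = word_poly d ds"
      by (rule unicritical_cancel[OF d lead_coeff_word_poly[OF d0] lead_coeff_word_poly[OF d0]])
        (use Cons.prems Cons.hyps d0 in \<open>simp_all add: degree_word_poly\<close>)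
    with Cons.IH show ?case by simp
  qed simp
qed

section \<open>From one stably irreducible word to a positive proportion\<close>

text \<open>A word splits into its first \<open>length cs\<close> letters and a rest. The rest, put behind \<open>cs\<close>, is irreducible
  of no larger degree, and only finitely many beginnings are possible. So their number bounds the
  ratio of all words to irreducible words uniformly in \<open>B\<close>.\<close>

lemma positive_proportion_if_irreducible_extensions:
  assumes d: "d \<ge> 2" and fin: "finite C"
    and ne: "cs \<noteq> []" and C: "set cs \<subseteq> C"
    and irr: "\<And>ws. set ws \<subseteq> C \<Longrightarrow> irreducible (word_poly d (cs @ ws))"
  shows "positive_proportion_irreducible (comp_semigroup (unicritical_poly d ` C))"
proof -
  define G where "G = comp_semigroup (unicritical_poly d ` C)"
  have d0: "d > 0" using d by simp
  define l where "l = length cs"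
  define X where "X B = {w. w \<noteq> [] \<and> set w \<subseteq> C \<and> d ^ length w \<le> B}" for B
  define Y where "Y B = {w. set w \<subseteq> C \<and> d ^ (l + length w) \<le> B}" for B
  define L where "L = {w. set w \<subseteq> C \<and> length w \<le> l}"
  have finL: "finite L" unfolding L_def by (rule finite_lists_length_le[OF fin])
  have len: "length w \<le> B" if "d ^ length w \<le> B" for w :: "int list" and B
    using that less_exp[of "length w"] power_mono[of 2 d "length w"] d by linarith
  have finX: "finite (X B)" for B
    by (rule finite_subset[OF _ finite_lists_length_le[OF fin, of B]]) (auto simp: X_def dest: len)
  have "d ^ length w \<le> d ^ (l + length w)" for w :: "int list"
    using d0 by (intro power_increasing) auto
  then have finY: "finite (Y B)" for B
    by (intro finite_subset[OF _ finite_lists_length_le[OF fin, of B]]) (auto simp: Y_def intro: len le_trans)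
  have inj: "inj_on (word_poly d) A" for A
    using word_poly_inj[OF d] by (auto intro: inj_onI)
  have Xeq: "{g \<in> G. degree g \<le> B} = word_poly d ` X B" for B
    unfolding G_def comp_semigroup_unicritical X_def using degree_word_poly[OF d0] by auto
  have Ysub: "word_poly d ` (\<lambda>w. cs @ w) ` Y B \<subseteq> {g \<in> G. degree g \<le> B \<and> irreducible g}" for B
    unfolding G_def comp_semigroup_unicritical Y_def
    using irr C ne by (auto simp: degree_word_poly[OF d0] l_def intro!: exI[of _ "cs @ _"])
  have ratio: "1 / real (card L) \<le>
      real (card {g \<in> G. degree g \<le> B \<and> irreducible g}) / real (card {g \<in> G. degree g \<le> B})"
    if B: "B \<ge> d ^ l" for B
  proof -
    let ?split = "\<lambda>w :: int list. (take l w, drop l w)"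
    have "?split ` X B \<subseteq> L \<times> Y B"
    proof safe
      fix w assume w: "w \<in> X B"
      then show "take l w \<in> L" by (auto simp: X_def L_def dest: in_set_takeD)
      have "l + length (drop l w) = max l (length w)" by simp
      then have "d ^ (l + length (drop l w)) \<le> B"
        using w B unfolding X_def max_def by auto
      then show "drop l w \<in> Y B" using w by (auto simp: X_def Y_def dest: in_set_dropD)
    qed
    moreover have "inj_on ?split (X B)"
      by (rule inj_onI) (metis append_take_drop_id prod.inject)
    ultimately have "card (X B) \<le> card (L \<times> Y B)"
      using finL finY by (intro card_inj_on_le) auto
    then have le: "card (X B) \<le> card L * card (Y B)" by (simp add: card_cartesian_product)
    have "card (Y B) = card (word_poly d ` (\<lambda>w. cs @ w) ` Y B)"
      by (subst card_image[OF inj], subst card_image) (auto intro: inj_onI)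
    also have "\<dots> \<le> card {g \<in> G. degree g \<le> B \<and> irreducible g}"
    proof (rule card_mono[OF _ Ysub])
      have "{g \<in> G. degree g \<le> B \<and> irreducible g} \<subseteq> {g \<in> G. degree g \<le> B}" by auto
      then show "finite {g \<in> G. degree g \<le> B \<and> irreducible g}"
        unfolding Xeq by (rule finite_subset) (simp add: finX)
    qed
    finally have "card (X B) \<le> card L * card {g \<in> G. degree g \<le> B \<and> irreducible g}"
      using le by (meson le_trans mult_le_mono2)
    moreover have "card {g \<in> G. degree g \<le> B} = card (X B)"
      unfolding Xeq by (simp add: card_image inj)
    moreover have "cs \<in> X B" using B ne C by (simp add: X_def l_def)
    then have "card (X B) > 0" using finX card_gt_0_iff by blast
    moreover have "[] \<in> L" by (simp add: L_def)
    then have "card L > 0" using finL card_gt_0_iff by blast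
    ultimately show ?thesis
      by (simp add: field_simps flip: of_nat_mult)
  qed
  have "[] \<in> L" by (simp add: L_def)
  then have "card L > 0" using finL card_gt_0_iff by blast
  then have "0 < ereal (1 / real (card L))" by simp
  also have "\<dots> \<le> liminf (\<lambda>B. ereal (real (card {g \<in> G. degree g \<le> B \<and> irreducible g}) /
                             real (card {g \<in> G. degree g \<le> B})))"
    by (rule Liminf_bounded) (use ratio in \<open>auto simp: eventually_sequentially\<close>)
  finally show ?thesis
    unfolding positive_proportion_irreducible_def G_def .
qed

lemma positive_proportion_imp_irreducible:
  assumes "positive_proportion_irreducible G"
  shows "\<exists>g\<in>G. irreducible g"
proof (rule ccontr)
  assume "\<not> ?thesis"
  then have "{g \<in> G. degree g \<le> B \<and> irreducible g} = {}" for B by auto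
  with assms show False
    by (simp add: positive_proportion_irreducible_def Liminf_const flip: zero_ereal_def)
qed

text \<open>Starting from the irreducible word \<open>cs\<close>, letters are appended one at a time, first along \<open>ds\<close> and then
  freely. Each step needs one value not to be a power; the words \<open>ws\<close> met on the way are those
  comparable with \<open>ds\<close> in the prefix order.\<close>

lemma positive_proportion_if_no_power:
  assumes d: "d \<ge> 2" and fin: "finite C"
    and cs: "cs \<noteq> []" "set cs \<subseteq> C" "irreducible (word_poly d cs)" and ds: "set ds \<subseteq> C"
    and np: "\<And>ws. set ws \<subseteq> C \<Longrightarrow> ws \<noteq> [] \<Longrightarrow> prefix ws ds \<or> prefix ds ws \<Longrightarrow>
      \<not> divisor_power d (word_val d (cs @ ws) 0)"
  shows "positive_proportion_irreducible (comp_semigroup (unicritical_poly d ` C))"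
proof (rule positive_proportion_if_irreducible_extensions[OF d fin, of "cs @ ds"])
  have *: "irreducible (word_poly d (cs @ us))"
    if "set us \<subseteq> C" "prefix us ds \<or> prefix ds us" for us
    using that
  proof (induction us rule: rev_induct)
    case Nil
    then show ?case using cs by simp
  next
    case (snoc c us)
    have cmp: "prefix us ds \<or> prefix ds us"
      using snoc.prems(2) by (auto simp: prefix_snoc dest: append_prefixD)
    have "irreducible (word_poly d ((cs @ us) @ [c]))"
    proof (rule irreducible_word_snoc[OF d])
      show "cs @ us \<noteq> []" using cs by simp
      show "irreducible (word_poly d (cs @ us))" using snoc cmp by simp
      have "word_val d (cs @ us @ [c]) 0 = word_val d (cs @ us) c"
        using d by (simp add: ucrit_def power_0_left)
      then show "\<not> divisor_power d (word_val d (cs @ us) c)"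
        using np[of "us @ [c]"] snoc.prems by auto
    qed
    then show ?case by simp
  qed
  show "irreducible (word_poly d ((cs @ ds) @ ws))" if "set ws \<subseteq> C" for ws
    using *[of "ds @ ws"] that ds by simp
qed (use cs ds in auto)

lemma positive_proportion_by_repeated_letter:
  assumes d: "d \<ge> 2" and fin: "finite C"
    and cs: "cs \<noteq> []" "set cs \<subseteq> C" "irreducible (word_poly d cs)" and b: "b \<in> C"
    and orbit: "\<And>i. 1 \<le> i \<Longrightarrow> \<not> divisor_power d (word_val d cs ((ucrit d b ^^ i) 0))"
    and all: "\<And>x. \<not> divisor_power d (word_val d cs ((ucrit d b ^^ m) x))"
  shows "positive_proportion_irreducible (comp_semigroup (unicritical_poly d ` C))"
proof (rule positive_proportion_if_no_power[OF d fin cs])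
  show "set (replicate m b) \<subseteq> C" using b by auto
  fix ws assume ws: "ws \<noteq> []" "prefix ws (replicate m b) \<or> prefix (replicate m b) ws"
  from ws(2) show "\<not> divisor_power d (word_val d (cs @ ws) 0)"
  proof
    assume "prefix ws (replicate m b)"
    then have "set ws \<subseteq> {b}" using set_mono_prefix by fastforce
    then have "ws = replicate (length ws) b" by (metis replicate_eqI singletonD subsetD)
    then show ?thesis using orbit[of "length ws"] ws(1)
      by (metis One_nat_def Suc_leI length_greater_0_conv word_val_replicate word_val_simps(3))
  next
    assume "prefix (replicate m b) ws"
    then obtain us where "ws = replicate m b @ us" by (elim prefixE)
    then show ?thesis using all by simp
  qed
qed

section \<open>Gaps between powers\<close>

lemma power_gap:
  fixes x y :: int
  assumes "\<bar>x\<bar> < \<bar>y\<bar>" and "e \<ge> 2"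
  shows "\<bar>y\<bar> ^ (e - 2) * (2 * \<bar>y\<bar> - 1) \<le> \<bar>y\<bar> ^ e - \<bar>x\<bar> ^ e"
proof -
  obtain k where e: "e = k + 2" using assms(2) le_Suc_ex by (metis add.commute)
  have "\<bar>x\<bar> ^ 2 \<le> (\<bar>y\<bar> - 1) ^ 2" using assms(1) by (intro power_mono) auto
  then have sq: "\<bar>x\<bar> ^ 2 + (2 * \<bar>y\<bar> - 1) \<le> \<bar>y\<bar> ^ 2" by (simp add: power2_eq_square algebra_simps)
  have "\<bar>x\<bar> ^ e = \<bar>x\<bar> ^ k * \<bar>x\<bar> ^ 2" by (simp add: e power_add power2_eq_square)
  also have "\<dots> \<le> \<bar>y\<bar> ^ k * \<bar>x\<bar> ^ 2" using assms(1) by (intro mult_right_mono power_mono) auto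
  finally have "\<bar>x\<bar> ^ e + \<bar>y\<bar> ^ k * (2 * \<bar>y\<bar> - 1) \<le> \<bar>y\<bar> ^ k * (\<bar>x\<bar> ^ 2 + (2 * \<bar>y\<bar> - 1))"
    by (simp add: algebra_simps)
  also have "\<dots> \<le> \<bar>y\<bar> ^ k * \<bar>y\<bar> ^ 2" using sq by (intro mult_left_mono) auto
  also have "\<dots> = \<bar>y\<bar> ^ e" by (simp add: e power_add power2_eq_square)
  finally show ?thesis by (simp add: e)
qed

lemma gap_ge_3:
  fixes x y :: int
  assumes "\<bar>x\<bar> < \<bar>y\<bar>" and "d \<ge> 3"
  shows "\<bar>y\<bar> * (2 * \<bar>y\<bar> - 1) \<le> \<bar>y\<bar> ^ d - \<bar>x\<bar> ^ d"
proof -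
  have y: "\<bar>y\<bar> \<ge> 1" using assms(1) abs_ge_zero[of x] by linarith
  have "\<bar>y\<bar> ^ 1 \<le> \<bar>y\<bar> ^ (d - 2)" using assms(2) y by (intro power_increasing) simp_all
  then have "\<bar>y\<bar> * (2 * \<bar>y\<bar> - 1) \<le> \<bar>y\<bar> ^ (d - 2) * (2 * \<bar>y\<bar> - 1)"
    using y by (intro mult_right_mono) simp_all
  also have "\<dots> \<le> \<bar>y\<bar> ^ d - \<bar>x\<bar> ^ d" using assms by (intro power_gap) simp_all
  finally show ?thesis .
qed

lemma abs_power_diff_ge: "\<bar>y\<bar> ^ d - \<bar>x\<bar> ^ d \<le> \<bar>y ^ d - (x :: int) ^ d\<bar>"
  using abs_triangle_ineq2[of "y ^ d" "x ^ d"] by (simp add: power_abs)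

lemma power_diff_ge_abs:
  fixes x y :: int
  assumes "x ^ p \<noteq> y ^ p" and "p \<ge> 2"
  shows "\<bar>x\<bar> \<le> \<bar>x ^ p - y ^ p\<bar>"
proof -
  have gap: "\<bar>v\<bar> \<le> \<bar>v\<bar> ^ p - \<bar>u\<bar> ^ p" if "\<bar>u\<bar> < \<bar>v\<bar>" for u v :: int
  proof -
    have "1 * (2 * \<bar>v\<bar> - 1) \<le> \<bar>v\<bar> ^ (p - 2) * (2 * \<bar>v\<bar> - 1)"
      using that by (intro mult_right_mono one_le_power) auto
    moreover have "\<bar>v\<bar> \<le> 1 * (2 * \<bar>v\<bar> - 1)" using that abs_ge_zero[of u] by simp
    ultimately show ?thesis using order_trans[OF order_trans power_gap[OF that assms(2)]] by blast
  qed
  have abs: "\<bar>\<bar>x\<bar> ^ p - \<bar>y\<bar> ^ p\<bar> \<le> \<bar>x ^ p - y ^ p\<bar>"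
    by (metis abs_triangle_ineq3 power_abs)
  consider "\<bar>y\<bar> < \<bar>x\<bar>" | "\<bar>x\<bar> < \<bar>y\<bar>" | "\<bar>x\<bar> = \<bar>y\<bar>" by linarith
  then show ?thesis
  proof cases
    case 1
    with gap[of y x] abs show ?thesis by linarith
  next
    case 2
    with gap[of x y] abs show ?thesis by linarith
  next
    case 3
    with assms(1) have y: "y = - x" and "odd p" by (auto simp: abs_eq_iff)
    then have "\<bar>x ^ p - y ^ p\<bar> = 2 * \<bar>x\<bar> ^ p" by (simp add: power_abs abs_mult)
    moreover have "\<bar>x\<bar> \<le> \<bar>x\<bar> ^ p"
      using assms(2) by (cases "x = 0") (auto intro!: self_le_power)
    ultimately show ?thesis by simp
  qed
qed

text \<open>Both \<open>u ^ d\<close> and \<open>u ^ d + a\<close> are \<open>p\<close>-th powers, and they are different, so they differ by at least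
  \<open>\<bar>u\<bar>\<close>.\<close>

lemma divisor_power_value_bound:
  assumes "a \<noteq> 0" and "d > 0" and "divisor_power d (ucrit d a u)"
  shows "\<bar>u\<bar> \<le> \<bar>a\<bar>"
proof -
  obtain p z where p: "prime p" "p dvd d" "u ^ d + a = z ^ p"
    using assms(3) by (auto simp: divisor_power_def ucrit_def)
  then obtain e where e: "d = p * e" by (elim dvdE)
  with assms(2) have e0: "e > 0" by auto
  have eq: "u ^ d = (u ^ e) ^ p" by (simp add: e mult.commute flip: power_mult)
  have "\<bar>u ^ e\<bar> \<le> \<bar>(u ^ e) ^ p - z ^ p\<bar>"
    using p assms(1) eq prime_ge_2_nat by (intro power_diff_ge_abs) auto
  also have "\<dots> = \<bar>a\<bar>" using p(3) eq by simp
  finally have "\<bar>u\<bar> ^ e \<le> \<bar>a\<bar>" by (simp add: power_abs)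
  moreover have "\<bar>u\<bar> \<le> \<bar>u\<bar> ^ e"
    using e0 by (cases "u = 0") (auto intro!: self_le_power)
  ultimately show ?thesis by simp
qed

section \<open>Periodic integers of unicritical maps\<close>

definition periodic :: "('a \<Rightarrow> 'a) \<Rightarrow> 'a \<Rightarrow> bool" where
  "periodic f x \<longleftrightarrow> (\<exists>n>0. (f ^^ n) x = x)"

lemma ucrit_escape:
  assumes "d \<ge> 2" and "\<bar>x\<bar> \<ge> \<bar>b\<bar> + 2"
  shows "\<bar>x\<bar> < \<bar>ucrit d b x\<bar>"
proof -
  have "(\<bar>b\<bar> + 2) * \<bar>x\<bar> \<le> \<bar>x\<bar> * \<bar>x\<bar>" using assms(2) by (intro mult_right_mono) auto
  also have "\<dots> = \<bar>x\<bar> ^ 2" by (simp add: power2_eq_square)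
  also have "\<dots> \<le> \<bar>x\<bar> ^ d" using assms by (intro power_increasing) auto
  finally have "(\<bar>b\<bar> + 2) * \<bar>x\<bar> \<le> \<bar>x ^ d\<bar>" by (simp add: power_abs)
  moreover have "\<bar>b\<bar> * 1 \<le> \<bar>b\<bar> * \<bar>x\<bar>" using assms by (intro mult_left_mono) auto
  moreover have "(\<bar>b\<bar> + 2) * \<bar>x\<bar> = \<bar>b\<bar> * \<bar>x\<bar> + 2 * \<bar>x\<bar>" by (rule distrib_right)
  moreover have "\<bar>x\<bar> > 0" using assms(2) by linarith
  ultimately have "\<bar>x\<bar> < \<bar>x ^ d\<bar> - \<bar>b\<bar>" by linarith
  then show ?thesis unfolding ucrit_def by linarith
qed

text \<open>Beyond \<open>\<bar>b\<bar> + 1\<close> absolute values grow strictly, so an orbit that is small after \<open>k\<close> steps was small all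
  along. With more steps than small integers, it has repeated a value, and everything afterwards is
  periodic. The bound \<open>K\<close> does not depend on the starting point.\<close>

lemma bounded_iterate_eventually_periodic:
  assumes d: "d \<ge> 2"
  shows "\<exists>K. \<forall>k\<ge>K. \<forall>x. \<bar>(ucrit d b ^^ k) x\<bar> \<le> R \<longrightarrow> periodic (ucrit d b) ((ucrit d b ^^ k) x)"
proof (intro exI allI impI)
  define f where "f = ucrit d b"
  define S where "S = max R (\<bar>b\<bar> + 1)"
  fix k x assume k: "k \<ge> nat (2 * S + 1)" and bd: "\<bar>(ucrit d b ^^ k) x\<bar> \<le> R"
  have bounded: "\<bar>(f ^^ i) x\<bar> \<le> S" if "i \<le> k" for i
  proof (rule ccontr)
    assume "\<not> ?thesis"
    then have i: "\<bar>(f ^^ i) x\<bar> > S" by simp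
    have "\<bar>(f ^^ (i + j)) x\<bar> > S" for j
    proof (induction j)
      case (Suc j)
      then have "\<bar>(f ^^ (i + j)) x\<bar> \<ge> \<bar>b\<bar> + 2" by (simp add: S_def)
      from ucrit_escape[OF d this] Suc show ?case by (simp add: f_def)
    qed (use i in simp)
    from this[of "k - i"] bd that show False by (simp add: S_def f_def)
  qed
  have "\<not> inj_on (\<lambda>i. (f ^^ i) x) {..k}"
  proof
    assume "inj_on (\<lambda>i. (f ^^ i) x) {..k}"
    moreover have "(\<lambda>i. (f ^^ i) x) ` {..k} \<subseteq> {- S..S}"
      using bounded by (auto simp: abs_le_iff minus_le_iff)
    ultimately have "card {..k} \<le> card {- S..S}" by (intro card_inj_on_le) auto
    with k show False by (simp add: algebra_simps)
  qed
  then obtain i j where ij: "i < j" "j \<le> k" "(f ^^ i) x = (f ^^ j) x"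
    unfolding inj_on_def by (metis atMost_iff linorder_neqE_nat)
  have k1: "j - i + k = k - i + j" and k2: "k - i + i = k" using ij by auto
  have "(f ^^ (j - i)) ((f ^^ k) x) = (f ^^ (j - i + k)) x" by (simp add: funpow_add)
  also have "\<dots> = (f ^^ (k - i)) ((f ^^ i) x)" unfolding k1 by (simp add: funpow_add ij(3))
  also have "\<dots> = (f ^^ (k - i + i)) x" by (simp add: funpow_add)
  also have "\<dots> = (f ^^ k) x" unfolding k2 ..
  finally show "periodic (ucrit d b) ((ucrit d b ^^ k) x)"
    using ij unfolding periodic_def f_def by (intro exI[of _ "j - i"]) auto
qed

lemma periodic_orbit:
  assumes "periodic f z"
  shows "\<exists>Orb. finite Orb \<and> z \<in> Orb \<and> f ` Orb = Orb \<and> (\<forall>y\<in>Orb. f y = y \<longrightarrow> f z = z)"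
proof -
  obtain n where n: "n > 0" "(f ^^ n) z = z" using assms by (auto simp: periodic_def)
  define Orb where "Orb = (\<lambda>i. (f ^^ i) z) ` {..<n}"
  have "f ` Orb = Orb"
  proof (intro equalityI subsetI)
    fix y assume "y \<in> f ` Orb"
    then obtain i where i: "i < n" "y = (f ^^ Suc i) z" by (auto simp: Orb_def)
    show "y \<in> Orb"
    proof (cases "Suc i = n")
      case True
      with i n have "y = (f ^^ 0) z" by simp
      with n show ?thesis unfolding Orb_def by blast
    next
      case False
      with i have "Suc i < n" by simp
      with i show ?thesis unfolding Orb_def by blast
    qed
  next
    fix y assume "y \<in> Orb"
    then obtain i where i: "i < n" "y = (f ^^ i) z" by (auto simp: Orb_def)
    define j where "j = (if i = 0 then n - 1 else i - 1)"
    have "j < n" using i n by (auto simp: j_def)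
    moreover have "y = f ((f ^^ j) z)"
    proof (cases "i = 0")
      case True
      then have "Suc j = n" using n by (simp add: j_def)
      then have "f ((f ^^ j) z) = (f ^^ n) z" by auto
      with True i n show ?thesis by simp
    next
      case False
      then have "Suc j = i" by (simp add: j_def)
      then have "f ((f ^^ j) z) = (f ^^ i) z" by auto
      with i show ?thesis by simp
    qed
    ultimately show "y \<in> f ` Orb" unfolding Orb_def by blast
  qed
  moreover have "z \<in> Orb" unfolding Orb_def using n by (intro image_eqI[of _ _ 0]) auto
  moreover have "finite Orb" by (simp add: Orb_def)
  moreover have "f z = z" if "y \<in> Orb" "f y = y" for y
  proof -
    from that obtain i where i: "i < n" "y = (f ^^ i) z" by (auto simp: Orb_def)
    have fix_y: "(f ^^ k) y = y" for k by (induction k) (auto simp: that)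
    have "z = (f ^^ (n - i + i)) z" using i n by simp
    also have "\<dots> = (f ^^ (n - i)) y" by (simp only: funpow_add o_apply i(2))
    finally show ?thesis using fix_y that by simp
  qed
  ultimately show ?thesis by blast
qed

text \<open>Let \<open>A\<close> be the largest absolute value on the cycle. Values on the cycle differ by at most \<open>2 * A\<close>,
  whereas for \<open>A \<ge> 2\<close> the \<open>d\<close>-th powers of integers of different absolute value, the larger being
  \<open>A\<close>, differ by more. Hence all points have absolute value \<open>A\<close> and the map is constant on the cycle. The
  case \<open>A \<le> 1\<close> is a finite check.\<close>

lemma periodic_degree_ge_3:
  assumes d: "d \<ge> 3" and per: "periodic (ucrit d b) z"
  shows "ucrit d b z = z \<or> (b = -1 \<and> even d \<and> z \<in> {0, -1})"
proof -
  define f where "f = ucrit d b"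
  obtain Orb where fin: "finite Orb" and z: "z \<in> Orb" and im: "f ` Orb = Orb"
    using periodic_orbit[OF per[folded f_def]] by blast
  define A where "A = Max (abs ` Orb)"
  have le_A: "\<bar>y\<bar> \<le> A" if "y \<in> Orb" for y unfolding A_def using fin that by simp
  have "A \<in> abs ` Orb" unfolding A_def using fin z by (intro Max_in) auto
  then obtain x where x: "x \<in> Orb" "\<bar>x\<bar> = A" by auto
  have A0: "A \<ge> 0" using x by auto
  have diff: "\<bar>u ^ d - v ^ d\<bar> \<le> 2 * A" if "u \<in> Orb" "v \<in> Orb" for u v
  proof -
    have "\<bar>f u\<bar> \<le> A" "\<bar>f v\<bar> \<le> A" using that im le_A by blast+
    then show ?thesis by (simp add: f_def ucrit_def)
  qed
  show ?thesis
  proof (cases "A \<ge> 2")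
    case True
    have big: "2 * A < A * (2 * A - 1)"
    proof -
      have "2 * A < A * 3" using True by simp
      also have "\<dots> \<le> A * (2 * A - 1)" by (rule mult_left_mono) (use True in simp_all)
      finally show ?thesis .
    qed
    have all_A: "\<bar>y\<bar> = A" if y: "y \<in> Orb" for y
    proof (rule ccontr)
      assume "\<bar>y\<bar> \<noteq> A"
      with le_A[OF y] x have "\<bar>y\<bar> < \<bar>x\<bar>" by simp
      from gap_ge_3[OF this d] x(2) big have "2 * A < \<bar>x\<bar> ^ d - \<bar>y\<bar> ^ d" by simp
      also have "\<dots> \<le> \<bar>x ^ d - y ^ d\<bar>" by (rule abs_power_diff_ge)
      also have "\<dots> \<le> 2 * A" by (rule diff[OF x(1) y])
      finally show False by simp
    qed
    have same: "u ^ d = v ^ d" if "u \<in> Orb" "v \<in> Orb" for u v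
    proof (cases "u = v")
      case False
      have u: "\<bar>u\<bar> = A" and "\<bar>v\<bar> = A" using all_A that by blast+
      with False have v: "v = - u" by linarith
      show ?thesis
      proof (cases "even d")
        case odd: False
        then have "\<bar>u ^ d - v ^ d\<bar> = 2 * A ^ d" using u by (simp add: v power_abs abs_mult)
        moreover have "A ^ 1 < A ^ d" using True d by (intro power_strict_increasing) auto
        ultimately show ?thesis using diff[OF that] by simp
      qed (simp add: v)
    qed simp
    obtain w where w: "w \<in> Orb" "f w = z" using im z by (metis imageE)
    have "f z = f w" using same[OF z w(1)] by (simp add: f_def ucrit_def)
    with w show ?thesis by (simp add: f_def)
  next
    case False
    then have small: "y = 0 \<or> y = 1 \<or> y = -1" if "y \<in> Orb" for y
      using le_A[OF that] by linarith
    obtain w where w: "w \<in> Orb" "f w = z" using im z by (metis imageE)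
    have "f z \<in> Orb" "f (f z) \<in> Orb" using im z by blast+
    have f0: "f 0 = b" using d by (simp add: f_def ucrit_def power_0_left)
    have f1: "f 1 = 1 + b" by (simp add: f_def ucrit_def)
    have fm: "f (-1) = (if even d then 1 else -1) + b" by (simp add: f_def ucrit_def)
    have goal: "f z = z \<or> (b = -1 \<and> even d \<and> (z = 0 \<or> z = -1))"
    proof -
      consider "z = 0" | "z = 1" | "z = -1" using small[OF z] by blast
      then show ?thesis
      proof cases
        case 1
        then have fz: "f z = b" by (simp only: f0)
        consider "b = 0" | "b = 1" | "b = -1" using small[OF \<open>f z \<in> Orb\<close>] fz by auto
        then show ?thesis
        proof cases
          case 2
          then have "f (f z) = 2" using fz f1 by simp
          with small[OF \<open>f (f z) \<in> Orb\<close>] show ?thesis by simp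
        next
          case 3
          then have "f (f z) = (if even d then 0 else -2)" using fz fm by simp
          with small[OF \<open>f (f z) \<in> Orb\<close>] 3 1 show ?thesis by (simp split: if_splits)
        qed (use 1 fz in simp)
      next
        case 2
        consider "w = 0" | "w = 1" | "w = -1" using small[OF w(1)] by blast
        then show ?thesis
        proof cases
          case 1
          then have "b = 1" using w(2) f0 2 by simp
          then have "f z = 2" using 2 f1 by simp
          with small[OF \<open>f z \<in> Orb\<close>] show ?thesis by simp
        next
          case 3
          show ?thesis
          proof (cases "even d")
            case True
            then have "b = 0" using w(2) fm 2 3 by simp
            then show ?thesis using 2 f1 by simp
          next
            case False
            then have "b = 2" using w(2) fm 2 3 by simp
            then have "f z = 3" using 2 f1 by simp
            with small[OF \<open>f z \<in> Orb\<close>] show ?thesis by simp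
          qed
        qed (use 2 w(2) in simp)
      next
        case 3
        consider "w = 0" | "w = 1" | "w = -1" using small[OF w(1)] by blast
        then show ?thesis
        proof cases
          case 1
          then have b: "b = -1" using w(2) f0 3 by simp
          then have "f z = (if even d then 0 else -2)" using 3 fm by simp
          with small[OF \<open>f z \<in> Orb\<close>] b 3 show ?thesis by (simp split: if_splits)
        next
          case 2
          then have "b = -2" using w(2) f1 3 by simp
          then have "f z = (if even d then -1 else -3)" using 3 fm by simp
          with small[OF \<open>f z \<in> Orb\<close>] 3 show ?thesis by (simp split: if_splits)
        qed (use 3 w(2) in simp)
      qed
    qed
    then show ?thesis by (simp add: f_def)
  qed
qed

text \<open>Replacing \<open>x\<close> by \<open>f x\<close> permutes the cycle and hence the differences \<open>f x - x\<close>, while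
  \<open>f (f x) - f x = (f x - x) * (f x + x)\<close>. So the product of all \<open>f x + x\<close> is 1 unless a point is fixed,
  and each \<open>f x + x\<close> is \<open>1\<close> or \<open>-1\<close>. The value \<open>-1\<close> closes the cycle after two steps, and the value \<open>1\<close>
  at two successive points is impossible.\<close>

lemma periodic_degree_2:
  assumes per: "periodic (ucrit 2 b) z"
  shows "ucrit 2 b z = z \<or> z + ucrit 2 b z = -1"
proof (rule disjCI)
  define f where "f = ucrit 2 b"
  assume no2: "z + ucrit 2 b z \<noteq> -1"
  obtain Orb where fin: "finite Orb" and z: "z \<in> Orb" and im: "f ` Orb = Orb"
    and fixp: "\<forall>y\<in>Orb. f y = y \<longrightarrow> f z = z"
    using periodic_orbit[OF per[folded f_def]] by blast
  have inj: "inj_on f Orb" using fin im by (intro eq_card_imp_inj_on) auto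
  have step: "f (f x) - f x = (f x - x) * (f x + x)" for x
    by (simp add: f_def ucrit_def power2_eq_square algebra_simps)
  show "ucrit 2 b z = z"
  proof (rule ccontr)
    assume "ucrit 2 b z \<noteq> z"
    then have nofix: "f y \<noteq> y" if "y \<in> Orb" for y using fixp that by (auto simp: f_def)
    have "(\<Prod>x\<in>Orb. f x - x) = (\<Prod>x\<in>f ` Orb. f x - x)" by (simp add: im)
    also have "\<dots> = (\<Prod>x\<in>Orb. f (f x) - f x)" by (simp add: prod.reindex[OF inj])
    also have "\<dots> = (\<Prod>x\<in>Orb. f x - x) * (\<Prod>x\<in>Orb. f x + x)"
      by (simp add: step prod.distrib)
    finally have "(\<Prod>x\<in>Orb. f x + x) = 1" using nofix fin by auto
    then have unit: "\<bar>f x + x\<bar> = 1" if "x \<in> Orb" for x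
      using dvd_prodI[OF fin that, of "\<lambda>x. f x + x"] by auto
    have fz: "f z \<in> Orb" "f (f z) \<in> Orb" using im z by blast+
    have one: "f z + z = 1" using unit[OF z] no2 by (auto simp: f_def)
    show False
    proof (cases "f (f z) + f z = 1")
      case True
      with one step[of z] have "2 * z = 1" by (simp add: algebra_simps)
      then show False by presburger
    next
      case False
      then have m: "f (f z) + f z = -1" using unit[OF fz(1)] by auto
      then have "f (f (f z)) = f z" using step[of "f z"] by (simp add: algebra_simps)
      then have "f (f z) = z" using inj fz z by (auto dest: inj_onD)
      with one m show False by simp
    qed
  qed
qed

section \<open>Powers in the orbit of zero\<close>

lemma consecutive_powers_nat:
  fixes r s :: nat
  assumes "s ^ p = Suc (r ^ p)" and "p \<ge> 2"
  shows "r = 0"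
proof (rule ccontr)
  assume r: "r \<noteq> 0"
  have "r ^ p < s ^ p" using assms(1) by simp
  then have "r < s" by (rule power_less_imp_less_base) simp
  then have "\<bar>int r\<bar> < \<bar>int s\<bar>" by simp
  from power_gap[OF this assms(2)]
  have "int s ^ (p - 2) * (2 * int s - 1) \<le> int (s ^ p) - int (r ^ p)" by simp
  also have "\<dots> = 1" using assms(1) by simp
  finally have le: "int s ^ (p - 2) * (2 * int s - 1) \<le> 1" .
  have "1 * (2 * int s - 1) \<le> int s ^ (p - 2) * (2 * int s - 1)"
    using \<open>r < s\<close> by (intro mult_right_mono one_le_power) auto
  from order_trans[OF this le] \<open>r < s\<close> r show False by simp
qed

text \<open>Every value of the orbit after the start has the form \<open>b * (1 + X)\<close> with \<open>X\<close> divisible by \<open>b\<close>. If this is a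
  \<open>p\<close>-th power up to sign, so are the coprime factors \<open>b\<close> and \<open>1 + X\<close>. But then \<open>X\<close>, which is
  \<open>b ^ (d - 1)\<close> times a \<open>d\<close>-th power, is one as well, and of two consecutive powers one is \<open>0\<close>.\<close>

lemma critical_orbit_power:
  assumes d: "d \<ge> 2" and i: "i \<ge> 1" and p: "prime p" "p dvd d"
    and pow: "\<bar>(ucrit d b ^^ i) 0\<bar> = \<bar>y\<bar> ^ p"
  shows "(ucrit d b ^^ i) 0 \<in> {0, b}"
proof -
  define f where "f = ucrit d b"
  have div: "b dvd (f ^^ n) 0" for n
  proof (induction n)
    case (Suc n)
    then have "b dvd ((f ^^ n) 0) ^ d" using d by (intro dvd_trans[OF _ dvd_power]) auto
    moreover have "(f ^^ Suc n) 0 = ((f ^^ n) 0) ^ d + b" by (simp add: f_def ucrit_def)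
    ultimately show ?case by simp
  qed simp
  obtain n where n: "i = Suc n" using i by (cases i) auto
  obtain v where v: "(f ^^ n) 0 = b * v" using div[of n] by (elim dvdE)
  define X where "X = b ^ (d - 1) * v ^ d"
  have "b ^ d = b * b ^ (d - 1)" using d by (simp add: power_eq_if)
  then have val: "(f ^^ i) 0 = b * (1 + X)"
  proof -
    have "(f ^^ i) 0 = (b * v) ^ d + b" using v by (simp add: n) (simp add: f_def ucrit_def)
    with \<open>b ^ d = _\<close> show ?thesis by (simp add: X_def power_mult_distrib algebra_simps)
  qed
  have p2: "p \<ge> 2" using p prime_ge_2_nat by blast
  have "b dvd b ^ (d - 1)" using d by (intro dvd_power) auto
  then have "b dvd X" by (simp add: X_def)
  have "coprime b (1 + X)"
  proof (rule coprimeI)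
    fix c assume c: "c dvd b" "c dvd 1 + X"
    then have "c dvd X" using \<open>b dvd X\<close> dvd_trans by blast
    with c(2) show "is_unit c" by (simp add: dvd_add_left_iff)
  qed
  then have cop: "coprime (nat \<bar>b\<bar>) (nat \<bar>1 + X\<bar>)"
    by (simp add: coprime_int_iff[symmetric])
  have "nat \<bar>b\<bar> * nat \<bar>1 + X\<bar> = nat \<bar>y\<bar> ^ p"
  proof -
    have "\<bar>b\<bar> * \<bar>1 + X\<bar> = \<bar>y\<bar> ^ p" using pow val by (simp add: f_def abs_mult)
    then have "nat (\<bar>b\<bar> * \<bar>1 + X\<bar>) = nat (\<bar>y\<bar> ^ p)" by simp
    then show ?thesis by (simp add: nat_mult_distrib nat_power_eq)
  qed
  then have "is_nth_power p (nat \<bar>b\<bar> * nat \<bar>1 + X\<bar>)" by simp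
  with cop p2 have "is_nth_power p (nat \<bar>b\<bar>)" "is_nth_power p (nat \<bar>1 + X\<bar>)"
    by (simp_all add: is_nth_power_mult_coprime_nat_iff)
  then obtain \<beta> \<sigma> where \<beta>: "nat \<bar>b\<bar> = \<beta> ^ p" and \<sigma>: "nat \<bar>1 + X\<bar> = \<sigma> ^ p"
    by (auto simp: is_nth_power_def)
  obtain e where e: "d = p * e" using p by (elim dvdE)
  define \<rho> where "\<rho> = \<beta> ^ (d - 1) * nat \<bar>v\<bar> ^ e"
  have "nat \<bar>X\<bar> = nat \<bar>b\<bar> ^ (d - 1) * nat \<bar>v\<bar> ^ d"
    by (simp add: X_def abs_mult nat_mult_distrib power_abs nat_power_eq)
  also have "\<dots> = (\<beta> ^ (d - 1)) ^ p * (nat \<bar>v\<bar> ^ e) ^ p"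
    unfolding \<beta> by (simp only: e mult.commute flip: power_mult)
  also have "\<dots> = \<rho> ^ p" by (simp only: \<rho>_def power_mult_distrib)
  finally have \<rho>: "nat \<bar>X\<bar> = \<rho> ^ p" .
  consider "X \<ge> 0" | "X = -1" | "X < -1" by linarith
  then have "X = 0 \<or> X = -1"
  proof cases
    case 1
    then have "nat \<bar>1 + X\<bar> = Suc (nat \<bar>X\<bar>)" by (simp add: nat_add_distrib)
    then have "\<sigma> ^ p = Suc (\<rho> ^ p)" by (simp only: \<sigma> \<rho>)
    then have "\<rho> = 0" using p2 by (rule consecutive_powers_nat)
    with \<rho> p2 show ?thesis by (simp add: power_0_left)
  next
    case 3
    then have "nat \<bar>X\<bar> = Suc (nat \<bar>1 + X\<bar>)" by linarith
    then have "\<rho> ^ p = Suc (\<sigma> ^ p)" by (simp only: \<sigma> \<rho>)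
    then have "\<sigma> = 0" using p2 by (rule consecutive_powers_nat)
    with \<sigma> p2 3 show ?thesis by (simp add: power_0_left)
  qed simp
  then show ?thesis using val by (auto simp: f_def)
qed

lemma irreducible_letter_no_root:
  assumes d: "d \<ge> 2" and irr: "irreducible (word_poly d [a])"
  shows "x ^ d + a \<noteq> 0"
proof
  assume root: "x ^ d + a = 0"
  let ?f = "word_poly d [a]"
  have "poly ?f (of_int x) = 0"
    using root by (simp only: poly_word_poly) (simp add: ucrit_def)
  then have "[:- of_int x, 1:] dvd ?f" by (simp only: poly_eq_0_iff_dvd)
  then obtain q where q: "?f = [:- of_int x, 1:] * q" by (elim dvdE)
  have deg: "degree ?f = d" using d by (simp add: degree_word_poly del: word_poly_simps)
  have q0: "q \<noteq> 0" using q irr by auto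
  have "degree ([:- of_int x, 1:] * q) = 1 + degree q"
    using q0 by (subst degree_mult_eq) auto
  then have "degree q \<noteq> 0" using deg d q by simp
  moreover have "is_unit [:- rat_of_int x, 1:] \<or> is_unit q" by (rule irreducibleD[OF irr q])
  ultimately show False by (auto dest: unit_poly_degree)
qed

lemma critical_orbit_nonzero:
  assumes "\<And>x. x ^ d + a \<noteq> 0" and "n \<ge> 1"
  shows "(ucrit d a ^^ n) 0 \<noteq> 0"
  using assms by (cases n) (auto simp: ucrit_def)

text \<open>By the norm test a reducible iterate would need a power in the orbit of \<open>0\<close>. Such a value is \<open>0\<close> or
  \<open>a\<close>, and either makes \<open>0\<close> periodic, giving the irreducible polynomial \<open>x ^ d + a\<close> an integer root.\<close>

lemma irreducible_iterates:
  assumes d: "d \<ge> 2" and irr: "irreducible (word_poly d [a])"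
  shows "irreducible (word_poly d (replicate (Suc n) a))"
proof (induction n)
  case 0
  show ?case using irr by simp
next
  case (Suc n)
  note noroot = irreducible_letter_no_root[OF d irr]
  have "irreducible (word_poly d (replicate (Suc n) a @ [a]))"
  proof (rule irreducible_word_snoc[OF d])
    show "irreducible (word_poly d (replicate (Suc n) a))" by (rule Suc)
    have "word_val d (replicate (Suc n) a) a = (ucrit d a ^^ Suc n) (ucrit d a 0)"
      using d by (simp only: word_val_replicate) (simp add: ucrit_def power_0_left)
    then have val: "word_val d (replicate (Suc n) a) a = (ucrit d a ^^ Suc (Suc n)) 0"
      by (simp only: funpow_Suc_right o_apply)
    show "\<not> divisor_power d (word_val d (replicate (Suc n) a) a)"
    proof
      assume "divisor_power d (word_val d (replicate (Suc n) a) a)"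
      then obtain p z where p: "prime p" "p dvd d" "(ucrit d a ^^ Suc (Suc n)) 0 = z ^ p"
        unfolding val divisor_power_def by blast
      from p(3) have "\<bar>(ucrit d a ^^ Suc (Suc n)) 0\<bar> = \<bar>z\<bar> ^ p" by (simp only: power_abs)
      from critical_orbit_power[OF d _ p(1,2) this]
      have "(ucrit d a ^^ Suc (Suc n)) 0 = 0 \<or> (ucrit d a ^^ Suc (Suc n)) 0 = a" by simp
      then show False
      proof
        assume "(ucrit d a ^^ Suc (Suc n)) 0 = 0"
        with critical_orbit_nonzero[OF noroot, of "Suc (Suc n)"] show False by simp
      next
        assume "(ucrit d a ^^ Suc (Suc n)) 0 = a"
        then have "((ucrit d a ^^ Suc n) 0) ^ d = 0" by (simp add: ucrit_def)
        then have "(ucrit d a ^^ Suc n) 0 = 0" using d by simp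
        with critical_orbit_nonzero[OF noroot, of "Suc n"] show False by simp
      qed
    qed
  qed simp
  then show ?case unfolding replicate_append_same by simp
qed

lemma positive_proportion_single:
  assumes d: "d \<ge> 2" and irr: "irreducible (word_poly d [a])"
  shows "positive_proportion_irreducible (comp_semigroup (unicritical_poly d ` {a}))"
proof (rule positive_proportion_if_irreducible_extensions[OF d, of _ "[a]"])
  fix ws assume "set ws \<subseteq> {a}"
  then have "ws = replicate (length ws) a" by (metis replicate_eqI singletonD subsetD)
  then have "[a] @ ws = replicate (Suc (length ws)) a" by simp
  then show "irreducible (word_poly d ([a] @ ws))" using irreducible_iterates[OF d irr] by metis
qed auto

section \<open>Fermat's equation for exponent three\<close>

lemma coprime_mult_cube_left:
  fixes a b c :: int
  assumes "a * b = c ^ 3" and "coprime a b"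
  shows "\<exists>u. a = u ^ 3"
proof -
  have "nat \<bar>a\<bar> * nat \<bar>b\<bar> = nat \<bar>c\<bar> ^ 3"
  proof -
    have "\<bar>a\<bar> * \<bar>b\<bar> = \<bar>c\<bar> ^ 3" using assms(1) by (simp add: power_abs flip: abs_mult)
    then have "nat (\<bar>a\<bar> * \<bar>b\<bar>) = nat (\<bar>c\<bar> ^ 3)" by simp
    then show ?thesis by (simp add: nat_mult_distrib nat_power_eq)
  qed
  then have "is_nth_power 3 (nat \<bar>a\<bar> * nat \<bar>b\<bar>)" by simp
  moreover have "coprime (nat \<bar>a\<bar>) (nat \<bar>b\<bar>)"
    using assms(2) by (simp add: coprime_int_iff[symmetric])
  ultimately have "is_nth_power 3 (nat \<bar>a\<bar>)"
    by (simp add: is_nth_power_mult_coprime_nat_iff)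
  then obtain r where r: "nat \<bar>a\<bar> = r ^ 3" by (auto simp: is_nth_power_def)
  then have "int (nat \<bar>a\<bar>) = int r ^ 3" by simp
  then have "\<bar>a\<bar> = int r ^ 3" by simp
  then have "a = int r ^ 3 \<or> a = (- int r) ^ 3" by (auto simp: abs_if split: if_splits)
  then show ?thesis by blast
qed

lemma coprime_mult_cube:
  fixes a b c :: int
  assumes "a * b = c ^ 3" and "coprime a b"
  obtains u v where "a = u ^ 3" "b = v ^ 3"
  using coprime_mult_cube_left[OF assms] coprime_mult_cube_left[of b a c] assms
  by (metis coprime_commute mult.commute)

text \<open>The lemma of Thue, by the pigeonhole principle: more than \<open>s\<close> pairs \<open>(x, y)\<close> with
  \<open>0 \<le> x, y \<le> \<surd>s\<close> compete for \<open>s\<close> residues of \<open>x - k * y\<close>.\<close>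

lemma congruent_pair_small:
  fixes k s :: int
  assumes s: "s > 0"
  obtains c e where "(c, e) \<noteq> (0, 0)" "s dvd c - k * e" "c ^ 2 \<le> s" "e ^ 2 \<le> s"
proof -
  define m where "m = nth_root_nat 2 (nat s)"
  have "m ^ 2 \<le> nat s" unfolding m_def by (simp add: nth_root_nat_power_le)
  moreover have "nat s < (m + 1) ^ 2"
    using nth_root_nat_ge[of 2 "m + 1" "nat s"] by (auto simp: m_def simp flip: not_le)
  ultimately have "int (m ^ 2) \<le> s" "s < int ((m + 1) ^ 2)" using s by linarith+
  then have m_le: "int m ^ 2 \<le> s" and m_gt: "s < (int m + 1) ^ 2" by (simp_all add: add.commute)
  define A where "A = {0..int m} \<times> {0..int m}"
  define f where "f = (\<lambda>(x, y). (x - k * y) mod s)"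
  have "card A = (m + 1) ^ 2" by (simp add: A_def card_cartesian_product power2_eq_square nat_add_distrib)
  have "\<not> inj_on f A"
  proof
    assume "inj_on f A"
    moreover have "f ` A \<subseteq> {0..<s}" using s by (auto simp: f_def)
    ultimately have "card A \<le> card {0..<s}" by (intro card_inj_on_le) auto
    then have "(m + 1) ^ 2 \<le> nat s" using \<open>card A = _\<close> by simp
    then have "int ((m + 1) ^ 2) \<le> s" using s by linarith
    with m_gt show False by (simp add: add.commute)
  qed
  then obtain x y x' y' where xy: "(x, y) \<in> A" "(x', y') \<in> A" "(x, y) \<noteq> (x', y')" "f (x, y) = f (x', y')"
    unfolding inj_on_def by (metis surj_pair)
  have "s dvd (x - k * y) - (x' - k * y')"
    using xy(4) by (simp add: f_def mod_eq_dvd_iff)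
  then have dv: "s dvd (x - x') - k * (y - y')" by (simp add: algebra_simps)
  have sq: "(u - u') ^ 2 \<le> s" if "u \<in> {0..int m}" "u' \<in> {0..int m}" for u u'
  proof -
    have "\<bar>u - u'\<bar> \<le> \<bar>int m\<bar>" using that by auto
    then have "(u - u') ^ 2 \<le> int m ^ 2" by (simp only: abs_le_square_iff)
    with m_le show ?thesis by simp
  qed
  show thesis
    by (rule that[OF _ dv]) (use xy sq in \<open>auto simp: A_def\<close>)
qed

lemma sum_square_three_square_mod_4:
  fixes c e :: int
  assumes "c ^ 2 + 3 * e ^ 2 = 2 * s"
  shows "even s"
proof -
  have "even (c ^ 2 + 3 * e ^ 2)" using assms by simp
  then have "even c \<longleftrightarrow> even e" by auto
  show ?thesis
  proof (cases "even c")
    case True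
    with \<open>even c \<longleftrightarrow> even e\<close> obtain c' e' where "c = 2 * c'" "e = 2 * e'" by (auto elim!: evenE)
    with assms have "s = 2 * (c' ^ 2 + 3 * e' ^ 2)" by (simp add: power2_eq_square)
    then show ?thesis by simp
  next
    case False
    with \<open>even c \<longleftrightarrow> even e\<close> obtain c' e' where "c = 2 * c' + 1" "e = 2 * e' + 1" by (auto elim!: oddE)
    with assms have "s = 2 * (c' ^ 2 + c' + 3 * e' ^ 2 + 3 * e' + 1)"
      by (simp add: power2_eq_square algebra_simps)
    then show ?thesis by simp
  qed
qed

text \<open>This is unique factorisation for cubes \<open>p + q * \<surd>(-3)\<close> of norm \<open>s\<^sup>3\<close>, obtained without ideals. Let \<open>k\<close> be
  \<open>p / q\<close> modulo \<open>s\<^sup>3\<close>, a square root of \<open>-3\<close>. The lemma of Thue produces \<open>c + e * \<surd>(-3)\<close> of norm \<open>s\<close> with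
  \<open>c \<equiv> k * e\<close> modulo \<open>s\<close>; the competing norms \<open>2 * s\<close>, \<open>3 * s\<close> and \<open>4 * s\<close> are excluded or reduced to this
  one. The product of \<open>p + q * \<surd>(-3)\<close> with the conjugate cube \<open>(c - e * \<surd>(-3))\<^sup>3\<close> is then divisible by
  \<open>s\<^sup>3\<close>, since \<open>(c - k * e)\<^sup>3\<close> and \<open>k\<^sup>2 + 3\<close> are, and the quotient has norm 1, so it is \<open>1\<close> or \<open>-1\<close>.\<close>

lemma cube_norm_form_neg3:
  fixes p q s :: int
  assumes eq: "p ^ 2 + 3 * q ^ 2 = s ^ 3" and cop: "coprime p q" and odd: "odd s"
  obtains c e where "p = c * (c ^ 2 - 9 * e ^ 2)" "q = 3 * e * (c ^ 2 - e ^ 2)"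
proof (cases "s = 1")
  case True
  then have "q = 0"
  proof -
    have "q ^ 2 = 0 \<or> q ^ 2 \<ge> 1" using zero_le_power2[of q] by linarith
    moreover have "p ^ 2 \<ge> 0" by simp
    moreover have "p ^ 2 + 3 * q ^ 2 = 1" using eq True by simp
    ultimately have "q ^ 2 = 0" by linarith
    then show ?thesis by simp
  qed
  with eq True have "p ^ 2 = 1" by simp
  then have "p * p ^ 2 = p" by simp
  with \<open>q = 0\<close> show thesis by (intro that[of p 0]) auto
next
  case False
  have "s ^ 3 \<ge> 0" unfolding eq[symmetric] by simp
  then have "s \<ge> 0" by (metis odd_numeral zero_le_odd_power)
  with odd False have s: "s > 1" by (cases "s = 0") auto
  have three: "\<not> 3 dvd s"
  proof
    assume "3 dvd s"
    then obtain t where t: "s = 3 * t" by (elim dvdE)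
    have p2: "p ^ 2 = 3 * (9 * t ^ 3 - q ^ 2)" using eq by (simp add: t power3_eq_cube algebra_simps)
    then have "3 dvd p ^ 2" by simp
    then have "3 dvd p" using prime_dvd_power[of "3 :: int" p 2] by simp
    then obtain u where u: "p = 3 * u" by (elim dvdE)
    have "q ^ 2 = 3 * (3 * t ^ 3 - u ^ 2)" using p2 by (simp add: u power2_eq_square algebra_simps)
    then have "3 dvd q ^ 2" by simp
    then have "3 dvd q" using prime_dvd_power[of "3 :: int" q 2] by simp
    with \<open>3 dvd p\<close> have "is_unit (3 :: int)" using cop coprime_common_divisor by blast
    then show False by simp
  qed
  then have cop3: "coprime 3 s" using prime_imp_coprime[of "3 :: int" s] by simp
  have "coprime (s ^ 3) q"
  proof (rule coprimeI)
    fix r assume r: "r dvd s ^ 3" "r dvd q"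
    have "coprime q (p ^ 2)" using cop by (simp add: coprime_commute)
    moreover have "r dvd p ^ 2"
    proof -
      have "p ^ 2 = s ^ 3 - 3 * q ^ 2" using eq by simp
      moreover have "r dvd 3 * q ^ 2" using r(2) by (simp add: power2_eq_square)
      ultimately show ?thesis using r(1) by simp
    qed
    ultimately show "is_unit r" using r(2) coprime_common_divisor by blast
  qed
  then obtain u q' where "u * s ^ 3 + q' * q = 1"
    by (metis bezout_int coprime_imp_gcd_eq_1)
  then have "q * q' - 1 = s ^ 3 * (- u)" by (simp add: algebra_simps)
  then have inv: "s ^ 3 dvd q * q' - 1" by (metis dvd_triv_left)
  define k where "k = p * q'"
  have kq: "s ^ 3 dvd k * q - p"
  proof -
    have "k * q - p = p * (q * q' - 1)" by (simp add: k_def algebra_simps)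
    with inv show ?thesis by simp
  qed
  have k3: "s ^ 3 dvd k ^ 2 + 3"
  proof -
    have "q ^ 2 * (k ^ 2 + 3) = (k * q - p) * (k * q + p) + s ^ 3"
      using eq by (simp add: power2_eq_square algebra_simps)
    then have "s ^ 3 dvd q ^ 2 * (k ^ 2 + 3)" using kq by simp
    moreover have "coprime (s ^ 3) (q ^ 2)" using \<open>coprime (s ^ 3) q\<close> by simp
    ultimately show ?thesis by (simp add: coprime_dvd_mult_right_iff)
  qed
  then have k3': "s dvd k ^ 2 + 3" by (meson dvd_power dvd_trans zero_less_numeral)
  obtain c e where ce: "(c, e) \<noteq> (0, 0)" "s dvd c - k * e" "c ^ 2 \<le> s" "e ^ 2 \<le> s"
    using congruent_pair_small[of s k] s by auto
  have "c ^ 2 + 3 * e ^ 2 = (c - k * e) * (c + k * e) + e ^ 2 * (k ^ 2 + 3)"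
    by (simp add: power2_eq_square algebra_simps)
  then have "s dvd c ^ 2 + 3 * e ^ 2" using ce(2) k3' by simp
  then obtain j where j: "c ^ 2 + 3 * e ^ 2 = s * j" by (elim dvdE)
  have "c ^ 2 + 3 * e ^ 2 > 0"
  proof -
    have "c ^ 2 > 0 \<or> e ^ 2 > 0" using ce(1) by auto
    moreover have "c ^ 2 \<ge> 0" "e ^ 2 \<ge> 0" by simp_all
    ultimately show ?thesis by linarith
  qed
  then have "j > 0" using j s by (simp add: zero_less_mult_iff)
  moreover have "s * j \<le> s * 4" using j ce(3,4) by linarith
  then have "j \<le> 4" using s by simp
  ultimately have jcases: "j = 1 \<or> j = 2 \<or> j = 3 \<or> j = 4" by linarith
  have "\<exists>c e. s dvd c - k * e \<and> c ^ 2 + 3 * e ^ 2 = s"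
    using jcases
  proof (elim disjE)
    assume "j = 1"
    with j ce(2) show ?thesis by auto
  next
    assume "j = 2"
    with j have "c ^ 2 + 3 * e ^ 2 = 2 * s" by simp
    then have "even s" by (rule sum_square_three_square_mod_4)
    with odd show ?thesis by simp
  next
    assume j3: "j = 3"
    have "c ^ 2 = 3 * (s - e ^ 2)" using j j3 by simp
    then have "3 dvd c ^ 2" by simp
    then have "3 dvd c" using prime_dvd_power[of "3 :: int" c 2] by simp
    then obtain c' where c': "c = 3 * c'" by (elim dvdE)
    have norm: "e ^ 2 + 3 * (- c') ^ 2 = s" using j j3 by (simp add: c' power2_eq_square)
    have "3 * (e - k * (- c')) = k * (c - k * e) + (k ^ 2 + 3) * e"
      by (simp add: c' power2_eq_square algebra_simps)
    then have "s dvd 3 * (e - k * (- c'))" using ce(2) k3' by simp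
    moreover have "coprime s 3" using cop3 by (simp add: coprime_commute)
    ultimately have "s dvd e - k * (- c')" by (simp only: coprime_dvd_mult_right_iff)
    with norm show ?thesis by blast
  next
    assume j4: "j = 4"
    have "c ^ 2 + 3 * e ^ 2 = 4 * s" using j j4 by simp
    then have c2: "c ^ 2 = s" and e2: "e ^ 2 = s" using ce(3,4) by linarith+
    have "\<bar>c\<bar> = \<bar>e\<bar>" using c2 e2 by (metis power2_eq_iff abs_eq_iff)
    have "c dvd k ^ 2 + 3"
      using k3' c2 by (metis dvd_triv_left dvd_trans power2_eq_square)
    have "c * c dvd c - k * e" using ce(2) c2 by (simp add: power2_eq_square)
    then obtain t where t: "c - k * e = c * c * t" by (elim dvdE)
    have "e = c \<or> e = - c" using \<open>\<bar>c\<bar> = \<bar>e\<bar>\<close> by (auto simp: abs_eq_iff)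
    then obtain \<epsilon> where \<epsilon>: "e = \<epsilon> * c" "\<epsilon> * \<epsilon> = 1"
      by (metis mult_1 mult_minus1 mult_1_right square_eq_1_iff mult.commute)
    have c0: "c \<noteq> 0" using c2 s by auto
    have "c * (1 - k * \<epsilon>) = c * (c * t)" using t \<epsilon>(1) by (simp add: algebra_simps)
    then have ke: "1 - k * \<epsilon> = c * t" using c0 by simp
    have "k ^ 2 + 3 = (1 - k * \<epsilon>) * (- 1 - k * \<epsilon>) + 4"
    proof -
      have "(1 - k * \<epsilon>) * (- 1 - k * \<epsilon>) = k ^ 2 * (\<epsilon> * \<epsilon>) - 1" by (simp add: power2_eq_square algebra_simps)
      with \<epsilon>(2) show ?thesis by simp
    qed
    then have "4 = (k ^ 2 + 3) - (1 - k * \<epsilon>) * (- 1 - k * \<epsilon>)" by linarith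
    then have "4 = (k ^ 2 + 3) - c * (t * (- 1 - k * \<epsilon>))" by (simp only: ke mult.assoc)
    then have "c dvd 4" using \<open>c dvd k ^ 2 + 3\<close> by (metis dvd_diff dvd_triv_left)
    then have "c dvd 2 ^ 2" by simp
    moreover have "odd c" using c2 odd by (metis even_power zero_less_numeral)
    then have "coprime c 2" by simp
    then have "coprime c (2 ^ 2)" by (simp only: coprime_power_right_iff simp_thms)
    ultimately have "is_unit c" using coprime_absorb_left by blast
    then have "\<bar>c\<bar> = 1" by simp
    then have "c ^ 2 = 1" by (metis power2_abs one_power2)
    with c2 s show ?thesis by simp
  qed
  then obtain c e where ce: "s dvd c - k * e" "c ^ 2 + 3 * e ^ 2 = s" by blast
  \<comment> \<open>The coordinates of \<open>(c + e * \<surd>(-3))\<^sup>3\<close>.\<close>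
  define A B where "A = c * (c ^ 2 - 9 * e ^ 2)" and "B = 3 * e * (c ^ 2 - e ^ 2)"
  have AB: "A ^ 2 + 3 * B ^ 2 = s ^ 3"
    unfolding A_def B_def ce(2)[symmetric] by (simp add: power2_eq_square power3_eq_cube algebra_simps)
  have "A - k * B = (c - k * e) ^ 3 - (k ^ 2 + 3) * (3 * c * e ^ 2 - k * e ^ 3)"
    unfolding A_def B_def by (simp add: power2_eq_square power3_eq_cube algebra_simps)
  moreover have "s ^ 3 dvd (c - k * e) ^ 3" using ce(1) by (rule dvd_power_same)
  ultimately have d1: "s ^ 3 dvd A - k * B" using k3 by simp
  have "k * A + 3 * B = k * (A - k * B) + (k ^ 2 + 3) * B" by (simp add: power2_eq_square algebra_simps)
  then have d2: "s ^ 3 dvd k * A + 3 * B" using d1 k3 by simp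
  have "p * A + 3 * q * B = q * (k * A + 3 * B) - (k * q - p) * A" by (simp add: algebra_simps)
  then have "s ^ 3 dvd p * A + 3 * q * B" using d2 kq by simp
  then obtain p' where p': "p * A + 3 * q * B = s ^ 3 * p'" by (elim dvdE)
  have "q * A - p * B = q * (A - k * B) + (k * q - p) * B" by (simp add: algebra_simps)
  then have "s ^ 3 dvd q * A - p * B" using d1 kq by simp
  then obtain q' where q': "q * A - p * B = s ^ 3 * q'" by (elim dvdE)
  have s30: "s ^ 3 \<noteq> 0" using s by simp
  have "(p * A + 3 * q * B) ^ 2 + 3 * (q * A - p * B) ^ 2 = (p ^ 2 + 3 * q ^ 2) * (A ^ 2 + 3 * B ^ 2)"
    by (simp add: power2_eq_square algebra_simps)
  then have "s ^ 3 * s ^ 3 * (p' ^ 2 + 3 * q' ^ 2) = s ^ 3 * s ^ 3 * 1"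
    unfolding p' q' eq AB by (simp add: power2_eq_square algebra_simps)
  then have one: "p' ^ 2 + 3 * q' ^ 2 = 1" using s30 by simp
  have q0: "q' = 0"
  proof -
    have "q' ^ 2 = 0 \<or> q' ^ 2 \<ge> 1" using zero_le_power2[of q'] by linarith
    moreover have "p' ^ 2 \<ge> 0" by simp
    ultimately have "q' ^ 2 = 0" using one by linarith
    then show ?thesis by simp
  qed
  with one have "p' = 1 \<or> p' = -1" by (simp add: power2_eq_1_iff)
  have "p * (A ^ 2 + 3 * B ^ 2) = A * (p * A + 3 * q * B) - 3 * B * (q * A - p * B)"
    by (simp add: power2_eq_square algebra_simps)
  then have "s ^ 3 * p = s ^ 3 * (p' * A)" unfolding AB p' q' q0 by (simp add: algebra_simps)
  then have pA: "p = p' * A" using s30 by simp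
  have "q * (A ^ 2 + 3 * B ^ 2) = B * (p * A + 3 * q * B) + A * (q * A - p * B)"
    by (simp add: power2_eq_square algebra_simps)
  then have "s ^ 3 * q = s ^ 3 * (p' * B)" unfolding AB p' q' q0 by (simp add: algebra_simps)
  then have qB: "q = p' * B" using s30 by simp
  from \<open>p' = 1 \<or> p' = -1\<close> show thesis
  proof
    assume "p' = 1"
    with pA qB show thesis by (intro that[of c e]) (simp_all add: A_def B_def)
  next
    assume "p' = -1"
    with pA qB show thesis by (intro that[of "- c" "- e"]) (simp_all add: A_def B_def)
  qed
qed

lemma coprime_triple_cube:
  fixes a b c r :: int
  assumes "a * b * c = r ^ 3" "coprime a b" "coprime a c" "coprime b c"
  obtains u v w where "a = u ^ 3" "b = v ^ 3" "c = w ^ 3"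
proof -
  have "coprime (a * b) c" using assms by simp
  then obtain t w where t: "a * b = t ^ 3" and w: "c = w ^ 3"
    using assms(1) coprime_mult_cube by metis
  obtain u v where "a = u ^ 3" "b = v ^ 3" using t assms(2) coprime_mult_cube by metis
  with w show thesis using that by blast
qed

lemma cube_eq_iff_int: "(a :: int) ^ 3 = b ^ 3 \<longleftrightarrow> a = b"
proof
  assume eq: "a ^ 3 = b ^ 3"
  have "(a - b) * (a ^ 2 + a * b + b ^ 2) = a ^ 3 - b ^ 3"
    by (simp add: power2_eq_square power3_eq_cube algebra_simps)
  with eq have "a = b \<or> a ^ 2 + a * b + b ^ 2 = 0" by auto
  then show "a = b"
  proof
    assume 0: "a ^ 2 + a * b + b ^ 2 = 0"
    have "2 * (a ^ 2 + a * b + b ^ 2) = (a + b) ^ 2 + a ^ 2 + b ^ 2"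
      by (simp add: power2_eq_square algebra_simps)
    then have "(a + b) ^ 2 + a ^ 2 + b ^ 2 = 0" using 0 by simp
    moreover have "(a + b) ^ 2 \<ge> 0" "a ^ 2 \<ge> 0" "b ^ 2 \<ge> 0" by simp_all
    ultimately have "a ^ 2 = 0" "b ^ 2 = 0" by linarith+
    then show "a = b" by simp
  qed
qed simp

lemma int_coprimeI_prime:
  fixes a b :: int
  assumes "\<And>p. prime p \<Longrightarrow> p dvd a \<Longrightarrow> p dvd b \<Longrightarrow> False" and "a \<noteq> 0 \<or> b \<noteq> 0"
  shows "coprime a b"
proof (rule ccontr)
  assume "\<not> coprime a b"
  then have "\<not> is_unit (gcd a b)" by (simp add: coprime_iff_gcd_eq_1)
  moreover have "gcd a b \<noteq> 0" using assms(2) by simp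
  ultimately obtain p where "p dvd gcd a b" "prime p" using prime_divisor_exists by blast
  with assms(1)[of p] show False by simp
qed

lemma coprime_plus_minus:
  fixes c m :: int
  assumes cop: "coprime c m" and odd: "odd (c + m)"
  shows "coprime (2 * c) (c - m)" "coprime (2 * c) (c + m)" "coprime (c - m) (c + m)"
    "coprime (2 * m) (c - m)" "coprime (2 * m) (c + m)"
proof -
  have c1: "coprime c (c - m)" "coprime c (c + m)" "coprime m (c - m)" "coprime m (c + m)"
  proof -
    have "is_unit t" if "t dvd c" "t dvd c - m" for t
    proof -
      have "t dvd c - (c - m)" using that by (rule dvd_diff)
      then have "t dvd m" by simp
      with cop that(1) show ?thesis by (rule coprime_common_divisor)
    qed
    then show "coprime c (c - m)" by (rule coprimeI)
    have "is_unit t" if "t dvd c" "t dvd c + m" for t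
    proof -
      have "t dvd (c + m) - c" using that(2,1) by (rule dvd_diff)
      then have "t dvd m" by simp
      with cop that(1) show ?thesis by (rule coprime_common_divisor)
    qed
    then show "coprime c (c + m)" by (rule coprimeI)
    have "is_unit t" if "t dvd m" "t dvd c - m" for t
    proof -
      have "t dvd (c - m) + m" using that(2,1) by (rule dvd_add)
      then have "t dvd c" by simp
      from coprime_common_divisor[OF cop this that(1)] show ?thesis .
    qed
    then show "coprime m (c - m)" by (rule coprimeI)
    have "is_unit t" if "t dvd m" "t dvd c + m" for t
    proof -
      have "t dvd (c + m) - m" using that(2,1) by (rule dvd_diff)
      then have "t dvd c" by simp
      from coprime_common_divisor[OF cop this that(1)] show ?thesis .
    qed
    then show "coprime m (c + m)" by (rule coprimeI)
  qed
  have "odd (c - m)" using odd by simp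
  with c1 odd show "coprime (2 * c) (c - m)" "coprime (2 * c) (c + m)"
    "coprime (2 * m) (c - m)" "coprime (2 * m) (c + m)" by simp_all
  have "is_unit t" if "t dvd c - m" "t dvd c + m" for t
  proof -
    have "t dvd (c - m) + (c + m)" using that by (rule dvd_add)
    then have "t dvd 2 * c" by simp
    with that(1) \<open>coprime (2 * c) (c - m)\<close> show ?thesis using coprime_common_divisor by blast
  qed
  then show "coprime (c - m) (c + m)" by (rule coprimeI)
qed

text \<open>Euler's descent. With \<open>x + y = 2 * p\<close> and \<open>x - y = 2 * q\<close> the equation reads
  \<open>2 * p * (p\<^sup>2 + 3 * q\<^sup>2) = (- z)\<^sup>3\<close>. The two factors are coprime, or become so after moving a factor \<open>3\<close>,
  and the quadratic one is a cube of the form treated above. The linear one then splits into three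
  coprime cubes, two of which add up to, or differ by, the third.\<close>

lemma cube_descent:
  fixes x y z :: int
  assumes eq: "x ^ 3 + y ^ 3 + z ^ 3 = 0" and nz: "z \<noteq> 0"
    and cop: "coprime x y" and odd: "odd x" "odd y"
  obtains X Y Z where "X ^ 3 + Y ^ 3 + Z ^ 3 = 0" "X * Y * Z \<noteq> 0" "\<bar>X * Y * Z\<bar> < \<bar>z\<bar>"
proof -
  note result = that
  have "even (x + y)" "even (x - y)" using odd by simp_all
  obtain p where p: "x + y = 2 * p" using \<open>even (x + y)\<close> by (elim evenE)
  obtain q where q: "x - y = 2 * q" using \<open>even (x - y)\<close> by (elim evenE)
  have x: "x = p + q" and y: "y = p - q" using p q by linarith+
  have par: "odd (p + q)" using odd x by simp
  have prod: "2 * p * (p ^ 2 + 3 * q ^ 2) = (- z) ^ 3"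
  proof -
    have "2 * p * (p ^ 2 + 3 * q ^ 2) = x ^ 3 + y ^ 3"
      by (simp add: x y power2_eq_square power3_eq_cube algebra_simps)
    also have "\<dots> = - (z ^ 3)" using eq by linarith
    finally show ?thesis by simp
  qed
  have p0: "p \<noteq> 0" using nz prod by auto
  have cpq: "coprime p q"
  proof (rule coprimeI)
    fix c assume "c dvd p" "c dvd q"
    then have "c dvd x" "c dvd y" by (simp_all add: x y)
    with cop show "is_unit c" using coprime_common_divisor by blast
  qed
  have oddn: "odd (p ^ 2 + 3 * q ^ 2)" using par by auto
  have prime_2: "r = 2" if "prime r" "r dvd 2" for r :: int
    using primes_dvd_imp_eq[OF that(1) _ that(2)] by simp
  have prime_3: "r = 3" if "prime r" "r dvd 3" for r :: int
    using primes_dvd_imp_eq[OF that(1) _ that(2)] by simp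
  have prime_pq: False if "prime r" "r dvd p" "r dvd q" for r
    using cpq that coprime_common_divisor not_prime_unit by blast
  show thesis
  proof (cases "3 dvd p")
    case False
    have "coprime (2 * p) (p ^ 2 + 3 * q ^ 2)"
    proof (rule int_coprimeI_prime)
      fix r :: int assume r: "prime r" "r dvd 2 * p" "r dvd p ^ 2 + 3 * q ^ 2"
      have "r \<noteq> 2" using r(3) oddn by auto
      then have rp: "r dvd p" using r(1,2) prime_2 prime_dvd_mult_iff by blast
      then have "r dvd p ^ 2" by (simp add: power2_eq_square)
      with r(3) have "r dvd 3 * q ^ 2" by (simp add: dvd_add_right_iff)
      then have "r dvd 3 \<or> r dvd q" using r(1) prime_dvd_mult_iff prime_dvd_power by blast
      with rp False prime_3[OF r(1)] prime_pq[OF r(1) rp] show False by auto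
    qed (use p0 in auto)
    then obtain r s where r: "2 * p = r ^ 3" and s: "p ^ 2 + 3 * q ^ 2 = s ^ 3"
      using coprime_mult_cube[OF prod] by blast
    have "odd s" using oddn s by auto
    obtain c e where c: "p = c * (c ^ 2 - 9 * e ^ 2)" and e: "q = 3 * e * (c ^ 2 - e ^ 2)"
      using cube_norm_form_neg3[OF s cpq \<open>odd s\<close>] .
    have cce: "coprime c e"
    proof (rule coprimeI)
      fix t assume "t dvd c" "t dvd e"
      then have "t dvd p" "t dvd q" by (auto simp: c e)
      with cpq show "is_unit t" using coprime_common_divisor by blast
    qed
    have pce: "odd (c + 3 * e)"
    proof
      assume "even (c + 3 * e)"
      then have "even p \<and> even q" by (auto simp: c e)
      with par show False by simp
    qed
    have "\<not> 3 dvd c" using False c by auto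
    then have cp1: "coprime c (3 * e)"
      using cce prime_imp_coprime[of "3 :: int" c] by (simp add: coprime_commute)
    have fac: "2 * c * (c - 3 * e) * (c + 3 * e) = r ^ 3"
      unfolding r[symmetric] c by (simp add: power2_eq_square algebra_simps)
    obtain X Y Z where XYZ: "2 * c = X ^ 3" "c - 3 * e = Y ^ 3" "c + 3 * e = Z ^ 3"
      using coprime_triple_cube[OF fac coprime_plus_minus(1,2,3)[OF cp1 pce]] by blast
    have "(X * Y * Z) ^ 3 = r ^ 3" using fac XYZ by (simp add: power_mult_distrib)
    then have XYZr: "X * Y * Z = r" by (simp only: cube_eq_iff_int)
    have "(r * s) ^ 3 = (- z) ^ 3" using prod r s by (simp add: power_mult_distrib)
    then have "r * s = - z" by (simp only: cube_eq_iff_int)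
    then have rs: "\<bar>r\<bar> * \<bar>s\<bar> = \<bar>z\<bar>" by (metis abs_minus_cancel abs_mult)
    have "r \<noteq> 0" using r p0 by auto
    have "s \<noteq> 0" using rs nz by auto
    have "\<bar>s\<bar> \<noteq> 1"
    proof
      assume s1: "\<bar>s\<bar> = 1"
      have "s ^ 3 \<ge> 0" unfolding s[symmetric] by simp
      then have "s = 1" using s1 by (auto simp: abs_if split: if_splits)
      then have one: "p ^ 2 + 3 * q ^ 2 = 1" using s by simp
      have "q ^ 2 = 0 \<or> q ^ 2 \<ge> 1" using zero_le_power2[of q] by linarith
      moreover have "p ^ 2 \<ge> 0" by simp
      ultimately have "q ^ 2 = 0" using one by linarith
      then have "p ^ 2 = 1" using one by simp
      then have "p = 1 \<or> p = -1" by (simp add: power2_eq_1_iff)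
      then have r2: "r ^ 3 = 2 \<or> r ^ 3 = -2" using r by auto
      moreover have "even (2 :: int)" "even (- 2 :: int)" by simp_all
      ultimately have "even (r ^ 3)" by (elim disjE) (simp_all only:)
      then have "even r" by simp
      then obtain t where "r = 2 * t" by (elim evenE)
      then have "r ^ 3 = 8 * t ^ 3" by (simp add: power_mult_distrib)
      with r2 show False by presburger
    qed
    then have "\<bar>s\<bar> \<ge> 2" using \<open>s \<noteq> 0\<close> by linarith
    then have "\<bar>r\<bar> * 2 \<le> \<bar>r\<bar> * \<bar>s\<bar>" by (intro mult_left_mono) auto
    then have "\<bar>r\<bar> < \<bar>z\<bar>" using rs \<open>r \<noteq> 0\<close> by linarith
    then show thesis
      using XYZ XYZr \<open>r \<noteq> 0\<close> by (intro result[of "- X" Y Z]) auto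
  next
    case True
    then obtain t where t: "p = 3 * t" by (elim dvdE)
    have t0: "t \<noteq> 0" using p0 t by simp
    have q3: "\<not> 3 dvd q" using True prime_pq[of 3] by auto
    have cqt: "coprime q t" using cpq t by (simp add: coprime_commute)
    have oddn': "odd (q ^ 2 + 3 * t ^ 2)" using par t by auto
    have prod': "18 * t * (q ^ 2 + 3 * t ^ 2) = (- z) ^ 3"
      unfolding prod[symmetric] by (simp add: t power2_eq_square algebra_simps)
    have "coprime (18 * t) (q ^ 2 + 3 * t ^ 2)"
    proof (rule int_coprimeI_prime)
      fix r :: int assume r: "prime r" "r dvd 18 * t" "r dvd q ^ 2 + 3 * t ^ 2"
      have "r dvd q" if "r dvd 3 * t"
      proof -
        have "r dvd 3 * t * t" using that by simp
        then have "r dvd 3 * t ^ 2" by (simp add: power2_eq_square mult.assoc)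
        with r(3) have "r dvd q ^ 2" by (simp add: dvd_add_left_iff)
        then show ?thesis using r(1) prime_dvd_power by blast
      qed
      moreover have "r \<noteq> 2" using r(3) oddn' by auto
      moreover have "18 * t = 2 * (3 * (3 * t))" by simp
      then have "r dvd 2 \<or> r dvd 3 \<or> r dvd 3 * t"
        using r(1,2) prime_dvd_mult_iff by metis
      then have "r dvd 2 \<or> r dvd 3 * t" by auto
      ultimately have "r dvd q" "r dvd p" using prime_2[OF r(1)] t by auto
      then show False using prime_pq[OF r(1)] by simp
    qed (use t0 in auto)
    then obtain r s where r: "18 * t = r ^ 3" and s: "q ^ 2 + 3 * t ^ 2 = s ^ 3"
      using coprime_mult_cube[OF prod'] by blast
    have "odd s" using oddn' s by auto
    obtain c e where c: "q = c * (c ^ 2 - 9 * e ^ 2)" and e: "t = 3 * e * (c ^ 2 - e ^ 2)"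
      using cube_norm_form_neg3[OF s cqt \<open>odd s\<close>] .
    have cce: "coprime c e"
    proof (rule coprimeI)
      fix u assume "u dvd c" "u dvd e"
      then have "u dvd q" "u dvd t" by (auto simp: c e)
      with cqt show "is_unit u" using coprime_common_divisor by blast
    qed
    have pce: "odd (c + e)"
    proof
      assume "even (c + e)"
      then have "even q \<and> even t" by (auto simp: c e)
      with par t show False by simp
    qed
    have "r ^ 3 = 3 * (18 * e * (c ^ 2 - e ^ 2))" using r e by simp
    then have "3 dvd r ^ 3" by simp
    then have "3 dvd r" using prime_dvd_power[of "3 :: int" r 3] by simp
    then obtain r' where r': "r = 3 * r'" by (elim dvdE)
    have fac: "2 * e * (c - e) * (c + e) = r' ^ 3"
    proof -
      have "27 * (2 * e * (c - e) * (c + e)) = r ^ 3"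
        unfolding r[symmetric] e by (simp add: power2_eq_square algebra_simps)
      also have "\<dots> = 27 * r' ^ 3" by (simp add: r' power_mult_distrib)
      finally show ?thesis by simp
    qed
    obtain X Y Z where XYZ: "2 * e = X ^ 3" "c - e = Y ^ 3" "c + e = Z ^ 3"
      using coprime_triple_cube[OF fac coprime_plus_minus(4,5,3)[OF cce pce]] by blast
    have "(X * Y * Z) ^ 3 = r' ^ 3" using fac XYZ by (simp add: power_mult_distrib)
    then have XYZr: "X * Y * Z = r'" by (simp only: cube_eq_iff_int)
    have "(r * s) ^ 3 = (- z) ^ 3" using prod' r s by (simp add: power_mult_distrib)
    then have "r * s = - z" by (simp only: cube_eq_iff_int)
    then have rs: "\<bar>r\<bar> * \<bar>s\<bar> = \<bar>z\<bar>" by (metis abs_minus_cancel abs_mult)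
    have "r' \<noteq> 0" using r r' t0 by auto
    have "s \<noteq> 0" using rs nz by auto
    then have "\<bar>s\<bar> \<ge> 1" by linarith
    then have "\<bar>r\<bar> * 1 \<le> \<bar>r\<bar> * \<bar>s\<bar>" by (intro mult_left_mono) auto
    then have "\<bar>r'\<bar> < \<bar>z\<bar>" using rs \<open>r' \<noteq> 0\<close> r' by linarith
    then show thesis
      using XYZ XYZr \<open>r' \<noteq> 0\<close> by (intro result[of X Y "- Z"]) auto
  qed
qed

text \<open>A solution with the smallest nonzero product is pairwise coprime, so exactly two of its entries
  are odd and \<open>cube_descent\<close> gives a smaller one.\<close>

theorem sum_of_three_cubes_eq_0:
  fixes x y z :: int
  assumes "x ^ 3 + y ^ 3 + z ^ 3 = 0"
  shows "x * y * z = 0"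
  using assms
proof (induction "nat \<bar>x * y * z\<bar>" arbitrary: x y z rule: less_induct)
  case less
  show ?case
  proof (rule ccontr)
    assume nz: "x * y * z \<noteq> 0"
    have IH: False if "X ^ 3 + Y ^ 3 + Z ^ 3 = 0" "X * Y * Z \<noteq> 0" "\<bar>X * Y * Z\<bar> < \<bar>x * y * z\<bar>" for X Y Z :: int
    proof -
      have "nat \<bar>X * Y * Z\<bar> < nat \<bar>x * y * z\<bar>" using that(3) by linarith
      from less.hyps[OF this that(1)] that(2) show False by contradiction
    qed
    have le: "\<bar>u\<bar> \<le> \<bar>x * y * z\<bar>" if "x * y * z = u * v" for u v
    proof -
      have "v \<noteq> 0" using that nz by auto
      then have "\<bar>u\<bar> * 1 \<le> \<bar>u\<bar> * \<bar>v\<bar>" by (intro mult_left_mono) auto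
      with that show ?thesis by (simp add: abs_mult)
    qed
    have cop: "coprime x y"
    proof (rule ccontr)
      assume "\<not> coprime x y"
      then obtain g where g: "prime g" "g dvd x" "g dvd y"
        using int_coprimeI_prime[of x y] nz by auto
      then obtain x' y' where xy: "x = g * x'" "y = g * y'" by (elim dvdE)
      have "z ^ 3 = g * (- (g ^ 2 * x' ^ 3) - g ^ 2 * y' ^ 3)"
        using less.prems by (simp add: xy power_mult_distrib power2_eq_square power3_eq_cube algebra_simps)
      then have "g dvd z ^ 3" by simp
      then have "g dvd z" using g(1) prime_dvd_power by blast
      then obtain z' where z: "z = g * z'" by (elim dvdE)
      have g3: "g ^ 3 \<noteq> 0" and g2: "g \<ge> 2" using g(1) prime_ge_2_int by auto
      have "g ^ 3 * (x' ^ 3 + y' ^ 3 + z' ^ 3) = 0"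
        using less.prems by (simp add: xy z power_mult_distrib algebra_simps)
      then have eq': "x' ^ 3 + y' ^ 3 + z' ^ 3 = 0" using g3 by simp
      have prod: "x * y * z = g * (g * g * (x' * y' * z'))" by (simp add: xy z)
      have nz': "x' * y' * z' \<noteq> 0" using nz by (auto simp: xy z)
      have "\<bar>g * g * (x' * y' * z')\<bar> \<ge> 1 * \<bar>x' * y' * z'\<bar>"
      proof -
        have "1 * 1 \<le> g * g" using g2 by (intro mult_mono) auto
        then have "1 \<le> \<bar>g * g\<bar>" by simp
        then show ?thesis unfolding abs_mult[of "g * g"] by (intro mult_right_mono) auto
      qed
      moreover have "\<bar>g\<bar> * \<bar>g * g * (x' * y' * z')\<bar> \<ge> 2 * \<bar>g * g * (x' * y' * z')\<bar>"
        using g2 by (intro mult_right_mono) auto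
      ultimately have "\<bar>x' * y' * z'\<bar> < \<bar>x * y * z\<bar>"
        unfolding prod abs_mult[of g] using nz' by linarith
      from IH[OF eq' nz' this] show False .
    qed
    have copI: "coprime u w" if "coprime u v" "u ^ 3 + v ^ 3 + w ^ 3 = 0" for u v w :: int
    proof (rule coprimeI)
      fix t assume t: "t dvd u" "t dvd w"
      have "v ^ 3 = - (u ^ 3 + w ^ 3)" using that(2) by linarith
      moreover have "t dvd u ^ 3 + w ^ 3" using t by (simp add: power3_eq_cube)
      ultimately have "t dvd v ^ 3" by (simp only: dvd_minus_iff)
      moreover have "coprime u (v ^ 3)" using that(1) by simp
      ultimately show "is_unit t" using t(1) coprime_common_divisor by blast
    qed
    have cxz: "coprime x z" using copI[OF cop less.prems] .
    have cyz: "coprime y z" using copI[of y x z] cop less.prems by (simp add: coprime_commute add.commute)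
    have nz3: "x \<noteq> 0" "y \<noteq> 0" "z \<noteq> 0" using nz by auto
    have "even (x ^ 3 + y ^ 3 + z ^ 3)" using less.prems by simp
    then have "even x \<or> even y \<or> even z" by auto
    moreover have "\<not> (even u \<and> even v)" if "coprime u v" for u v :: int
      using that by (metis coprime_common_divisor odd_one)
    ultimately consider "odd x" "odd y" | "odd x" "odd z" | "odd y" "odd z"
      using cop cxz cyz by blast
    then show False
    proof cases
      case 1
      from less.prems nz3(3) cop 1 obtain X Y Z where XYZ: "X ^ 3 + Y ^ 3 + Z ^ 3 = 0" "X * Y * Z \<noteq> 0" "\<bar>X * Y * Z\<bar> < \<bar>z\<bar>"
        by (rule cube_descent)
      moreover have "\<bar>z\<bar> \<le> \<bar>x * y * z\<bar>" by (rule le[of z "x * y"]) simp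
      ultimately show False using IH by fastforce
    next
      case 2
      have "x ^ 3 + z ^ 3 + y ^ 3 = 0" using less.prems by simp
      from this nz3(2) cxz 2 obtain X Y Z where XYZ: "X ^ 3 + Y ^ 3 + Z ^ 3 = 0" "X * Y * Z \<noteq> 0" "\<bar>X * Y * Z\<bar> < \<bar>y\<bar>"
        by (rule cube_descent)
      moreover have "\<bar>y\<bar> \<le> \<bar>x * y * z\<bar>" by (rule le[of y "x * z"]) simp
      ultimately show False using IH by fastforce
    next
      case 3
      have "y ^ 3 + z ^ 3 + x ^ 3 = 0" using less.prems by simp
      from this nz3(1) cyz 3 obtain X Y Z where XYZ: "X ^ 3 + Y ^ 3 + Z ^ 3 = 0" "X * Y * Z \<noteq> 0" "\<bar>X * Y * Z\<bar> < \<bar>x\<bar>"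
        by (rule cube_descent)
      moreover have "\<bar>x\<bar> \<le> \<bar>x * y * z\<bar>" by (rule le[of x "y * z"]) simp
      ultimately show False using IH by fastforce
    qed
  qed
qed

section \<open>The Diophantine systems of degrees three and two\<close>

text \<open>Writing \<open>x + 1 = 3 * h\<close>, the coprime numbers \<open>h\<close> and \<open>3 * h\<^sup>2 - 3 * h + 1\<close> have a product that is a cube,
  so both are cubes. As \<open>3 * h\<^sup>2 - 3 * h + 1 = h\<^sup>3 - (h - 1)\<^sup>3\<close>, this is Fermat's equation.\<close>

lemma cube_plus_one_eq_nine_cubes:
  fixes x w :: int
  assumes eq: "x ^ 3 + 1 = 9 * w ^ 3"
  shows "x = -1 \<or> x = 2"
proof -
  have "(x + 1) ^ 3 = 3 * (3 * w ^ 3 + x ^ 2 + x)"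
    using eq by (simp add: power2_eq_square power3_eq_cube algebra_simps)
  then have "3 dvd (x + 1) ^ 3" by simp
  then have "3 dvd x + 1" using prime_dvd_power[of "3 :: int" "x + 1" 3] by simp
  then obtain h where "x + 1 = 3 * h" by (elim dvdE)
  then have h: "x = 3 * h - 1" by simp
  have prod: "h * (3 * h ^ 2 - 3 * h + 1) = w ^ 3"
  proof -
    have "9 * (h * (3 * h ^ 2 - 3 * h + 1)) = x ^ 3 + 1"
      by (simp add: h power2_eq_square power3_eq_cube algebra_simps)
    with eq show ?thesis by simp
  qed
  have "coprime h (3 * h ^ 2 - 3 * h + 1)"
  proof (rule coprimeI)
    fix t assume t: "t dvd h" "t dvd 3 * h ^ 2 - 3 * h + 1"
    have "1 = (3 * h ^ 2 - 3 * h + 1) - h * (3 * h - 3)" by (simp add: power2_eq_square algebra_simps)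
    with t show "is_unit t" by (metis dvd_diff dvd_mult2)
  qed
  with prod obtain m n where m: "h = m ^ 3" and n: "3 * h ^ 2 - 3 * h + 1 = n ^ 3"
    using coprime_mult_cube by blast
  have "n ^ 3 + (h - 1) ^ 3 + (- (m ^ 3)) ^ 3 = 0"
    unfolding m[symmetric] n[symmetric] by (simp add: power2_eq_square power3_eq_cube algebra_simps)
  then have "n * (h - 1) * (- (m ^ 3)) = 0" by (rule sum_of_three_cubes_eq_0)
  then have "n = 0 \<or> h = 1 \<or> m = 0" by auto
  moreover have "n \<noteq> 0"
  proof
    assume "n = 0"
    then have "3 * (h - h ^ 2) = 1" using n by simp
    then show False by presburger
  qed
  ultimately show ?thesis using m h by auto
qed

lemma cubic_thue_with_cube_arguments:
  fixes \<alpha> \<beta> \<kappa> P Q :: int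
  assumes \<kappa>: "\<kappa> = 1 \<or> \<kappa> = -1" and P: "P = \<alpha> ^ 3" and Q: "Q = \<beta> ^ 3"
    and eq: "9 * P ^ 2 * Q = (P + Q) ^ 3 + \<kappa>"
  shows "P = 0 \<or> Q = 0 \<or> P = Q"
proof -
  have cube: "P ^ 2 * Q = (\<alpha> ^ 2 * \<beta>) ^ 3" by (simp add: P Q power_mult_distrib flip: power_mult)
  have "(\<kappa> * (P + Q)) ^ 3 + 1 = 9 * (\<kappa> * (\<alpha> ^ 2 * \<beta>)) ^ 3"
    using \<kappa> eq cube by (auto simp: power_mult_distrib)
  then have "\<kappa> * (P + Q) = -1 \<or> \<kappa> * (P + Q) = 2" by (rule cube_plus_one_eq_nine_cubes)
  then show ?thesis
  proof
    assume "\<kappa> * (P + Q) = -1"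
    then have "P + Q = - \<kappa>" using \<kappa> by auto
    then have "9 * P ^ 2 * Q = 0" using eq \<kappa> by auto
    then have "P = 0 \<or> Q = 0" by simp
    then show ?thesis by blast
  next
    assume "\<kappa> * (P + Q) = 2"
    then have PQ: "P + Q = 2 * \<kappa>" using \<kappa> by auto
    then have "9 * (P * P * Q) = 9 * \<kappa>" using eq \<kappa> by (auto simp: power2_eq_square)
    then have "P * P * Q = \<kappa>" by simp
    then have "P dvd \<kappa>" "Q dvd \<kappa>" by (metis dvd_triv_left dvd_mult2, metis dvd_triv_right)
    then have "\<bar>P\<bar> = 1" "\<bar>Q\<bar> = 1" using \<kappa> by auto
    with PQ \<kappa> show ?thesis by auto
  qed
qed

text \<open>The unknowns \<open>3 * U\<close>, \<open>3 * V\<close>, \<open>y\<close> are the lower coefficients of a monic cubic \<open>F\<close> for which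
  \<open>F(x) * F(\<omega> * x) * F(\<omega>\<^sup>2 * x)\<close> is the polynomial of the word \<open>[t - t\<^sup>3, t]\<close> with \<open>t = y\<^sup>3\<close>, where \<open>\<omega>\<close> is a
  primitive third root of unity.

  The product \<open>D = 9 * U * V\<close> satisfies an equation in \<open>D\<close> and \<open>y\<close> alone. Removing the forced factors
  \<open>y\<close> and \<open>3\<close> leaves a plane cubic in \<open>H\<close> and \<open>l\<close>, where \<open>y\<^sup>2 = 1 + 9 * l\<close>, with a node at the origin. It
  is parametrised by the ratio \<open>n : m\<close> of \<open>H\<close> to \<open>l\<close>, and integrality forces the denominator \<open>\<kappa>\<close> of the
  parametrisation to be \<open>1\<close> or \<open>-1\<close>. Now \<open>U\<^sup>3\<close> is the product of \<open>y\<close>, \<open>P\<^sup>2\<close> and \<open>Q\<close> up to sign, with \<open>P = n + m\<close>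
  and \<open>Q = n + 2 * m\<close>. These are coprime, so \<open>P\<close> and \<open>Q\<close> are cubes, and the equation for \<open>\<kappa>\<close> becomes
  \<open>9 * P\<^sup>2 * Q = (P + Q)\<^sup>3 + \<kappa>\<close>.\<close>

lemma cubic_norm_system:
  fixes U V y :: int
  assumes e1: "9 * U ^ 3 - 9 * U * V = y ^ 3 - y"
    and e2: "9 * V ^ 3 - 9 * U * V * y = y ^ 6 - y ^ 2"
  shows "y = 0 \<or> y ^ 2 = 1"
proof (rule ccontr)
  assume neg: "\<not> ?thesis"
  then have y0: "y \<noteq> 0" and y1: "y ^ 2 \<noteq> 1" by auto
  define D where "D = 9 * U * V"
  have U3: "9 * U ^ 3 = y ^ 3 - y + D" using e1 by (simp add: D_def)
  have V3: "9 * V ^ 3 = y * (y ^ 5 - y + D)"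
    using e2 by (simp add: D_def power_numeral_reduce algebra_simps)
  have "D ^ 3 = 9 * (9 * U ^ 3) * (9 * V ^ 3)"
    by (simp add: D_def power_mult_distrib)
  then have D3: "D ^ 3 = 9 * y * (y ^ 3 - y + D) * (y ^ 5 - y + D)"
    unfolding U3 V3 by (simp add: algebra_simps)
  have "y dvd D"
  proof -
    define g where "g = gcd y D"
    have g0: "g \<noteq> 0" using y0 by (simp add: g_def)
    obtain y' D' where yD: "y = g * y'" "D = g * D'" "coprime y' D'"
      unfolding g_def using gcd_coprime_exists[of y D] y0 by (metis gcd_eq_0_iff mult.commute)
    have "g ^ 3 * D' ^ 3 = g ^ 3 * (y' * (9 * (y ^ 2 * y' - y' + D') * (y ^ 4 * y' - y' + D')))"
    proof -
      have "g ^ 3 * D' ^ 3 = D ^ 3" by (simp add: yD(2) power_mult_distrib)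
      also have "\<dots> = 9 * (g * y') * (y ^ 2 * (g * y') - g * y' + g * D') * (y ^ 4 * (g * y') - g * y' + g * D')"
      proof -
        have "y ^ 3 = y ^ 2 * y" "y ^ 5 = y ^ 4 * y" by (simp_all add: power_numeral_reduce)
        then show ?thesis unfolding D3 yD(1,2)[symmetric] by simp
      qed
      also have "\<dots> = g ^ 3 * (y' * (9 * (y ^ 2 * y' - y' + D') * (y ^ 4 * y' - y' + D')))"
        by (simp add: power3_eq_cube algebra_simps)
      finally show ?thesis .
    qed
    then have "D' ^ 3 = y' * (9 * (y ^ 2 * y' - y' + D') * (y ^ 4 * y' - y' + D'))" using g0 by simp
    then have "y' dvd D' ^ 3" by (metis dvd_triv_left)
    moreover have "coprime y' (D' ^ 3)" using yD(3) by simp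
    ultimately have "is_unit y'" using coprime_absorb_left by blast
    then show ?thesis unfolding yD(1,2) by (simp add: mult_dvd_mono unit_imp_dvd)
  qed
  then obtain E where E: "D = y * E" by (elim dvdE)
  define x where "x = y ^ 2 - 1"
  have yx: "y ^ 2 = x + 1" by (simp add: x_def)
  have E3: "E ^ 3 = 9 * (E + x) * (E + x * (x + 2))"
  proof -
    have "y ^ 3 * E ^ 3 = (y * E) ^ 3" by (simp add: power_mult_distrib)
    also have "\<dots> = 9 * y * (y ^ 3 - y + y * E) * (y ^ 5 - y + y * E)"
      using D3 unfolding E .
    also have "\<dots> = y ^ 3 * (9 * (E + (y ^ 2 - 1)) * (E + (y ^ 2 - 1) * (y ^ 2 + 1)))"
      by (simp add: power_numeral_reduce algebra_simps)
    also have "y ^ 2 + 1 = x + 2" by (simp add: x_def)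
    finally show ?thesis using y0 by (simp add: x_def)
  qed
  have p3: "prime (3 :: int)" by simp
  have "3 dvd E ^ 3" unfolding E3 by simp
  then have "3 dvd E" using p3 prime_dvd_power by blast
  then obtain F where F: "E = 3 * F" by (elim dvdE)
  have "9 * (3 * F ^ 3) = 9 * ((3 * F + x) * (3 * F + x * (x + 2)))"
    using E3 by (simp add: F power_mult_distrib algebra_simps)
  then have F3: "3 * F ^ 3 = (3 * F + x) * (3 * F + x * (x + 2))" by simp
  have "3 dvd (3 * F + x) * (3 * F + x * (x + 2))" unfolding F3[symmetric] by simp
  then have "3 dvd x \<or> 3 dvd x * (x + 2)" using p3 by (auto simp: prime_dvd_mult_iff dvd_add_right_iff)
  moreover have "\<not> 3 dvd x + 2"
  proof
    assume "3 dvd x + 2"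
    then have dv: "3 dvd y ^ 2 + 1" by (simp add: x_def add.commute)
    define q r where "q = y div 3" and "r = y mod 3"
    have y: "y = 3 * q + r" by (simp add: q_def r_def)
    have "y ^ 2 + 1 = 3 * (3 * q ^ 2 + 2 * q * r) + (r ^ 2 + 1)"
      by (simp add: y power2_eq_square algebra_simps)
    with dv have "3 dvd r ^ 2 + 1" by (metis dvd_add_right_iff dvd_triv_left)
    moreover have "r = 0 \<or> r = 1 \<or> r = 2" unfolding r_def by presburger
    ultimately show False by auto
  qed
  ultimately have "3 dvd x" using p3 by (auto simp: prime_dvd_mult_iff)
  then obtain k where k: "x = 3 * k" by (elim dvdE)
  have "3 * F ^ 3 = 3 * (3 * (F + k) * (F + k * (3 * k + 2)))"
    using F3 by (simp add: k algebra_simps)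
  then have Fk: "F ^ 3 = 3 * (F + k) * (F + k * (3 * k + 2))" by simp
  have "3 dvd F ^ 3" unfolding Fk by simp
  then have "3 dvd F" using p3 prime_dvd_power by blast
  then obtain H where H: "F = 3 * H" by (elim dvdE)
  have "3 * (9 * H ^ 3) = 3 * ((3 * H + k) * (3 * H + k * (3 * k + 2)))"
    using Fk by (simp add: H power_mult_distrib algebra_simps)
  then have Hk: "9 * H ^ 3 = (3 * H + k) * (3 * H + k * (3 * k + 2))" by simp
  have "9 * H ^ 3 = 3 * (3 * H ^ 3)" by simp
  then have "3 dvd (3 * H + k) * (3 * H + k * (3 * k + 2))" unfolding Hk[symmetric] by (metis dvd_triv_left)
  then have "3 dvd k \<or> 3 dvd 3 * k + 2" using p3 by (auto simp: prime_dvd_mult_iff dvd_add_right_iff)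
  then have "3 dvd k" by presburger
  then obtain l where l: "k = 3 * l" by (elim dvdE)
  have "9 * H ^ 3 = 9 * ((H + l) * (H + l * (9 * l + 2)))"
    using Hk by (simp add: l algebra_simps)
  then have Hl: "H ^ 3 = (H + l) * (H + l * (9 * l + 2))" by simp
  have yl: "y ^ 2 = 1 + 9 * l" using yx k l by simp
  have l0: "l \<noteq> 0" using yl y1 by auto
  have U3': "U ^ 3 = y * (H + l)"
  proof -
    have "9 * U ^ 3 = y * (y ^ 2 - 1) + D" unfolding U3 by (simp add: power_numeral_reduce algebra_simps)
    also have "\<dots> = 9 * (y * (H + l))" by (simp add: yl E F H algebra_simps)
    finally show ?thesis by simp
  qed
  define g where "g = gcd H l"
  have g0: "g \<noteq> 0" using l0 by (simp add: g_def)
  obtain n m where nm: "H = g * n" "l = g * m" "coprime n m"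
    unfolding g_def using gcd_coprime_exists[of H l] l0 by (metis gcd_eq_0_iff mult.commute)
  define P Q where "P = n + m" and "Q = n + 2 * m"
  define \<kappa> where "\<kappa> = n ^ 3 - 9 * m ^ 2 * P"
  have gk: "g * \<kappa> = P * Q"
  proof -
    have "g ^ 2 * (g * n ^ 3) = g ^ 2 * (P * (Q + 9 * g * m ^ 2))"
      using Hl by (simp add: nm P_def Q_def power_mult_distrib power2_eq_square power3_eq_cube algebra_simps)
    then have "g * n ^ 3 = P * (Q + 9 * g * m ^ 2)" using g0 by simp
    then show ?thesis by (simp add: \<kappa>_def algebra_simps)
  qed
  have cop_nP: "coprime n P" and cop_mP: "coprime m P" and cop_mQ: "coprime m Q"
  proof -
    have "is_unit t" if "t dvd n" "t dvd P" for t
    proof -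
      have "t dvd P - n" using that by simp
      then have "t dvd m" by (simp add: P_def)
      with nm(3) that(1) show ?thesis by (rule coprime_common_divisor)
    qed
    then show "coprime n P" by (rule coprimeI)
    have "is_unit t" if "t dvd m" "t dvd P" for t
    proof -
      have "t dvd P - m" using that by simp
      then have "t dvd n" by (simp add: P_def)
      with nm(3) show ?thesis using that(1) by (rule coprime_common_divisor)
    qed
    then show "coprime m P" by (rule coprimeI)
    have "is_unit t" if "t dvd m" "t dvd Q" for t
    proof -
      have "t dvd Q - 2 * m" using that by simp
      then have "t dvd n" by (simp add: Q_def)
      with nm(3) show ?thesis using that(1) by (rule coprime_common_divisor)
    qed
    then show "coprime m Q" by (rule coprimeI)
  qed
  have "coprime \<kappa> P"
  proof (rule coprimeI)
    fix t assume t: "t dvd \<kappa>" "t dvd P"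
    then have "t dvd \<kappa> + 9 * m ^ 2 * P" by simp
    then have "t dvd n ^ 3" by (simp add: \<kappa>_def)
    moreover have "coprime (n ^ 3) P" using cop_nP by simp
    ultimately show "is_unit t" using t(2) coprime_common_divisor by blast
  qed
  moreover have "coprime \<kappa> Q"
  proof (rule coprimeI)
    fix t assume t: "t dvd \<kappa>" "t dvd Q"
    \<comment> \<open>Division of \<open>\<kappa>\<close> by \<open>Q\<close> as polynomials in \<open>n\<close>; the remainder is its value at \<open>n = - 2 * m\<close>.\<close>
    have "m ^ 3 = \<kappa> - Q * (n ^ 2 - 2 * m * n - 5 * m ^ 2)"
      by (simp add: \<kappa>_def P_def Q_def power2_eq_square power3_eq_cube algebra_simps)
    then have "t dvd m ^ 3" using t by simp
    moreover have "coprime (m ^ 3) Q" using cop_mQ by simp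
    ultimately show "is_unit t" using t(2) coprime_common_divisor by blast
  qed
  ultimately have "coprime \<kappa> (P * Q)" by simp
  moreover have "\<kappa> dvd P * Q" unfolding gk[symmetric] by simp
  ultimately have "is_unit \<kappa>" using coprime_absorb_left by blast
  then have \<kappa>: "\<kappa> = 1 \<or> \<kappa> = -1" by auto
  then have \<kappa>2: "\<kappa> * \<kappa> = 1" by auto
  have g: "g = \<kappa> * P * Q" using gk \<kappa>2 by (metis mult.assoc mult.commute mult_1)
  have U3'': "\<kappa> * y * P ^ 2 * Q = U ^ 3"
    unfolding U3' by (simp add: nm g power2_eq_square P_def algebra_simps)
  have cop_y: "coprime y t" if "t dvd g" for t
  proof (rule coprimeI)
    fix u assume u: "u dvd y" "u dvd t"
    have "1 = y ^ 2 - 9 * g * m" using yl by (simp add: nm(2))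
    moreover have "u dvd y ^ 2" using u(1) by (simp add: power2_eq_square)
    moreover have "u dvd 9 * g * m" using u(2) that by (meson dvd_mult dvd_mult2 dvd_trans)
    ultimately show "is_unit u" by (metis dvd_diff)
  qed
  have yP: "coprime y P" and yQ: "coprime y Q" by (rule cop_y, simp add: g)+
  have PQ: "coprime P Q"
  proof (rule coprimeI)
    fix t assume t: "t dvd P" "t dvd Q"
    have "m = Q - P" by (simp add: P_def Q_def)
    then have "t dvd m" using t by simp
    from coprime_common_divisor[OF cop_mP this t(1)] show "is_unit t" .
  qed
  have P0: "P \<noteq> 0" and Q0: "Q \<noteq> 0" using g g0 by auto
  have unitc: "coprime \<kappa> t" for t using \<open>is_unit \<kappa>\<close> by (rule is_unit_left_imp_coprime)
  obtain \<beta> where \<beta>: "Q = \<beta> ^ 3"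
  proof -
    have "Q * (\<kappa> * y * P ^ 2) = U ^ 3" using U3'' by (simp add: mult.commute)
    moreover have "coprime Q (\<kappa> * y * P ^ 2)" using unitc yQ PQ by (simp add: coprime_commute)
    ultimately show thesis using coprime_mult_cube that by blast
  qed
  obtain \<alpha> where \<alpha>: "P = \<alpha> ^ 3"
  proof -
    have "P ^ 2 * (\<kappa> * y * Q) = U ^ 3" using U3'' by (simp add: algebra_simps)
    moreover have "coprime (P ^ 2) (\<kappa> * y * Q)" using unitc yP PQ by (simp add: coprime_commute)
    ultimately obtain \<gamma> where \<gamma>: "P ^ 2 = \<gamma> ^ 3" using coprime_mult_cube by blast
    have "P ^ 3 = \<gamma> ^ 3 * P" using \<gamma> by (simp add: power3_eq_cube power2_eq_square)
    then have "\<gamma> ^ 3 dvd P ^ 3" by simp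
    then have "\<gamma> dvd P" by simp
    then obtain \<delta> where "P = \<gamma> * \<delta>" by (elim dvdE)
    with \<open>P ^ 3 = \<gamma> ^ 3 * P\<close> have "\<gamma> ^ 3 * \<delta> ^ 3 = \<gamma> ^ 3 * P" by (simp add: power_mult_distrib)
    moreover have "\<gamma> \<noteq> 0" using P0 \<gamma> by auto
    ultimately have "P = \<delta> ^ 3" by simp
    then show thesis by (rule that)
  qed
  have "9 * P ^ 2 * Q = (P + Q) ^ 3 + \<kappa>"
    by (simp add: \<kappa>_def P_def Q_def power2_eq_square power3_eq_cube algebra_simps)
  from cubic_thue_with_cube_arguments[OF \<kappa> \<alpha> \<beta> this] P0 Q0 have "P = Q" by simp
  then have "m = 0" by (simp add: P_def Q_def)
  with l0 nm show False by simp
qed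

text \<open>The unknowns are the coefficients of a quartic \<open>x\<^sup>4 + 2 * P * x\<^sup>3 + \<dots> + 2 * R * x + z\<close> whose product with
  its reflection in \<open>x\<close> is the polynomial of the word \<open>[a, a, - t]\<close> with \<open>a = t - t\<^sup>2\<close>.

  Eliminating \<open>R\<close> and completing the square in \<open>Z = P\<^sup>2\<close> shows that \<open>8 * z * (z + 1)\<close> is a square, say
  \<open>z\<^sup>2 + z = 2 * m\<^sup>2\<close>, and the remaining quadratic equation for \<open>Z\<close> has discriminant
  \<open>(z\<^sup>2 + m)\<^sup>2 - (z\<^sup>2 - z) / 2\<close> up to a square factor. For \<open>\<bar>z\<bar> \<ge> 2\<close> this is smaller than \<open>(z\<^sup>2 + m)\<^sup>2\<close> by
  too little to be a square; only \<open>z = -2\<close> escapes the estimate and is checked directly.\<close>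

lemma quartic_norm_system:
  fixes P R t y z :: int
  assumes t: "t = y ^ 2" and z: "z = y \<or> z = - y"
    and e1: "2 * P ^ 4 - 4 * P ^ 2 * t + z - 4 * P * R = t"
    and e2: "R ^ 2 = (P ^ 2 - t) * z + t ^ 2"
  shows "\<bar>y\<bar> \<le> 1"
proof (rule ccontr)
  assume "\<not> ?thesis"
  then have z2: "\<bar>z\<bar> \<ge> 2" using z by auto
  have tz: "t = z ^ 2" using t z by auto
  define Z W where "Z = P ^ 2" and "W = 2 * Z ^ 2 - 4 * Z * z ^ 2 + z ^ 2 - z"
  have PR: "4 * P * R = 2 * Z ^ 2 - 4 * Z * z ^ 2 + z - z ^ 2"
    using e1 by (simp add: Z_def tz flip: power_mult)
  have RR: "R ^ 2 = (Z - z ^ 2) * z + z ^ 4"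
    using e2 by (simp add: Z_def tz flip: power_mult)
  have "16 * Z * R ^ 2 = (4 * P * R) ^ 2" by (simp add: Z_def power_mult_distrib)
  then have sq: "(2 * Z ^ 2 - 4 * Z * z ^ 2 + z - z ^ 2) ^ 2 = 16 * Z * ((Z - z ^ 2) * z + z ^ 4)"
    unfolding PR RR by simp
  have "W ^ 2 = (2 * Z ^ 2 - 4 * Z * z ^ 2 + z - z ^ 2) ^ 2 + 4 * (2 * Z ^ 2 - 4 * Z * z ^ 2) * (z ^ 2 - z)"
    by (simp add: W_def power2_eq_square algebra_simps)
  also have "\<dots> = Z ^ 2 * (8 * (z ^ 2 + z))"
    unfolding sq by (simp add: power_numeral_reduce algebra_simps)
  finally have W2: "W ^ 2 = Z ^ 2 * (8 * (z ^ 2 + z))" .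
  have Z0: "Z \<noteq> 0"
  proof
    assume "Z = 0"
    with W2 have "W = 0" by simp
    then have "z * (z - 1) = 0" using \<open>Z = 0\<close> by (simp add: W_def power2_eq_square algebra_simps)
    with z2 show False by auto
  qed
  have "Z ^ 2 dvd W ^ 2" unfolding W2 by simp
  then have "Z dvd W" by simp
  then obtain v where v: "W = Z * v" by (elim dvdE)
  have "Z ^ 2 * v ^ 2 = Z ^ 2 * (8 * (z ^ 2 + z))" using W2 v by (simp add: power_mult_distrib)
  then have v2: "v ^ 2 = 8 * (z ^ 2 + z)" using Z0 by simp
  have "even (z ^ 2 + z)" by simp
  then obtain h where h: "z ^ 2 + z = 2 * h" by (elim evenE)
  have "4 ^ 2 dvd v ^ 2" unfolding v2 h by simp
  then have "4 dvd v" by (simp only: pow_divides_pow_iff zero_less_numeral)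
  then obtain m where m: "v = 4 * m" by (elim dvdE)
  have m2: "2 * m ^ 2 = z ^ 2 + z" using v2 m by (simp add: power_mult_distrib)
  define n where "n = Z - (z ^ 2 + m)"
  have "2 * Z ^ 2 - 4 * Z * z ^ 2 + z ^ 2 - z = Z * (4 * m)" using v by (simp add: W_def m)
  then have n2: "2 * n ^ 2 = 2 * (z ^ 2 + m) ^ 2 - (z ^ 2 - z)"
    by (simp add: n_def power2_eq_square algebra_simps)
  have zz: "\<bar>z\<bar> * 2 \<le> z ^ 2"
  proof -
    have "\<bar>z\<bar> * 2 \<le> \<bar>z\<bar> * \<bar>z\<bar>" using z2 by (intro mult_left_mono) auto
    then show ?thesis by (simp add: power2_eq_square)
  qed
  have "z \<le> \<bar>z\<bar>" by simp
  then have "m ^ 2 \<le> z ^ 2" using m2 zz by linarith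
  then have mz: "\<bar>m\<bar> \<le> \<bar>z\<bar>" by (simp add: abs_le_square_iff)
  have pos: "z ^ 2 + m > 0" using mz zz z2 by linarith
  have "n ^ 2 < (z ^ 2 + m) ^ 2" using n2 zz z2 by linarith
  then have "\<bar>n\<bar> < \<bar>z ^ 2 + m\<bar>" by (metis abs_le_square_iff not_le)
  from power_gap[OF this, of 2] pos have "2 * (z ^ 2 + m) - 1 \<le> (z ^ 2 + m) ^ 2 - n ^ 2" by simp
  then have "4 * (z ^ 2 + m) - 2 \<le> z ^ 2 - z" using n2 by linarith
  then have up: "3 * z ^ 2 + z \<le> 2 + 4 * (- m)" by simp
  have "- m \<le> \<bar>z\<bar>" using mz by (rule abs_le_D2)
  then have "4 * (- m) \<le> 4 * \<bar>z\<bar>" by (rule mult_left_mono) simp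
  with up have ub: "3 * z ^ 2 + z \<le> 2 + 4 * \<bar>z\<bar>" by (rule order_trans[OF _ add_left_mono])
  consider "z \<ge> 2" | "z = -2" | "z \<le> -3" using z2 by linarith
  then show False
  proof cases
    case 1
    with ub zz show False by linarith
  next
    case 2
    with m2 have "m ^ 2 = 1" by simp
    then have "m = 1 \<or> m = -1" by (simp add: power2_eq_1_iff)
    then have "n ^ 2 = 22 \<or> n ^ 2 = 6" using n2 2 by auto
    moreover have "n ^ 2 \<noteq> 22 \<and> n ^ 2 \<noteq> 6"
    proof -
      have "w ^ 2 \<noteq> 22 \<and> w ^ 2 \<noteq> 6" if "w \<ge> 0" for w :: int
      proof -
        have "w = 0 \<or> w = 1 \<or> w = 2 \<or> w = 3 \<or> w = 4 \<or> w \<ge> 5" using that by linarith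
        moreover have "w ^ 2 \<ge> 5 ^ 2" if "w \<ge> 5" using that by (intro power_mono) auto
        ultimately show ?thesis by auto
      qed
      from this[of "\<bar>n\<bar>"] show ?thesis by simp
    qed
    ultimately show False by blast
  next
    case 3
    have "\<bar>z\<bar> * 3 \<le> \<bar>z\<bar> * \<bar>z\<bar>" using 3 by (intro mult_left_mono) auto
    then have "\<bar>z\<bar> * 3 \<le> z ^ 2" by (simp add: power2_eq_square)
    with ub 3 show False by linarith
  qed
qed

section \<open>Two irreducible words beyond the norm test\<close>

abbreviation rpoly :: "int poly \<Rightarrow> rat poly" where
  "rpoly \<equiv> map_poly rat_of_int"

lemma rpoly_mult: "rpoly (p * q) = rpoly p * rpoly q"
  by (rule poly_eqI) (simp add: coeff_map_poly coeff_mult)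

lemma rpoly_smult: "rpoly (smult c p) = smult (of_int c) (rpoly p)"
  by (rule poly_eqI) (simp add: coeff_map_poly)

lemma rpoly_eq_iff: "rpoly p = rpoly q \<longleftrightarrow> p = q"
  by (auto simp: poly_eq_iff coeff_map_poly)

lemma clear_denominators:
  obtains c p where "c > 0" "smult (rat_of_int c) P = rpoly p"
proof (induction P arbitrary: thesis)
  case 0
  show ?case by (rule 0[of 1 0]) auto
next
  case (pCons a P)
  obtain c p where c: "c > 0" "smult (rat_of_int c) P = rpoly p" using pCons.IH by blast
  obtain n k where "quotient_of a = (n, k)" by force
  then have k: "k > 0" "a = of_int n / of_int k"
    using quotient_of_denom_pos quotient_of_div by auto
  have "smult (rat_of_int (k * c)) (pCons a P) = rpoly (pCons (c * n) (smult k p))"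
  proof -
    have "smult (rat_of_int (k * c)) P = smult (of_int k) (rpoly p)" by (simp flip: c(2))
    moreover have "rat_of_int (k * c) * a = of_int (c * n)" using k by simp
    ultimately show ?thesis by (simp add: map_poly_pCons rpoly_smult)
  qed
  moreover have "k * c > 0" using c k by simp
  ultimately show ?case using pCons.prems by blast
qed

lemma monic_int_content:
  fixes f :: "int poly"
  assumes "lead_coeff f = 1"
  shows "content f = 1"
proof -
  have "content f dvd 1" using content_dvd_coeff[of f "degree f"] assms by simp
  then show ?thesis by (metis is_unit_content_iff)
qed

text \<open>Gauss's lemma. The contents of the cleared polynomials \<open>c P\<close> and \<open>e Q\<close> multiply to \<open>c * e\<close>, but each
  content divides the leading coefficient \<open>c\<close> or \<open>e\<close>, so \<open>c\<close> divides all coefficients of \<open>c P\<close>.\<close>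

lemma monic_rational_factor_integral:
  assumes F: "lead_coeff F = 1" and eq: "rpoly F = P * Q" and P: "lead_coeff P = 1"
  obtains p where "P = rpoly p"
proof -
  have "lead_coeff (rpoly F) = 1" using F by (simp add: coeff_map_poly degree_map_poly)
  then have Q: "lead_coeff Q = 1" unfolding eq lead_coeff_mult P by simp
  obtain c p where c: "c > 0" "smult (rat_of_int c) P = rpoly p" by (rule clear_denominators)
  obtain e q where e: "e > 0" "smult (rat_of_int e) Q = rpoly q" by (rule clear_denominators)
  have "rpoly (p * q) = rpoly (smult (c * e) F)"
    by (simp add: rpoly_mult rpoly_smult eq mult.commute flip: c(2) e(2))
  then have pq: "p * q = smult (c * e) F" by (simp only: rpoly_eq_iff)
  have lc: "lead_coeff p = c"
  proof -
    have "rat_of_int (lead_coeff p) = lead_coeff (rpoly p)" by (simp add: coeff_map_poly degree_map_poly)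
    also have "\<dots> = of_int c" unfolding c(2)[symmetric] using P by simp
    finally show ?thesis by simp
  qed
  have le: "lead_coeff q = e"
  proof -
    have "rat_of_int (lead_coeff q) = lead_coeff (rpoly q)" by (simp add: coeff_map_poly degree_map_poly)
    also have "\<dots> = of_int e" unfolding e(2)[symmetric] using Q by simp
    finally show ?thesis by simp
  qed
  have "content p dvd c" "content q dvd e"
    using content_dvd_coeff[of p "degree p"] content_dvd_coeff[of q "degree q"] lc le by auto
  then obtain k k' where k: "c = content p * k" and k': "e = content q * k'" by (auto elim!: dvdE)
  have "content p * content q = content (smult (c * e) F)" by (simp add: content_mult flip: pq)
  also have "\<dots> = c * e" using c e monic_int_content[OF F] by (simp add: normalize_mult)
  finally have "content p * content q = content p * content q * (k * k')" using k k' by simp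
  moreover have "content p * content q \<noteq> 0" using k k' c e by auto
  ultimately have "k * k' = 1" by simp
  then have "is_unit k" by (metis dvd_triv_left)
  then have "c dvd content p" unfolding k by (simp add: mult_unit_dvd_iff)
  then have "[:c:] dvd p" by (simp add: const_poly_dvd_iff_dvd_content)
  then obtain r where r: "p = smult c r" by (auto elim!: dvdE)
  have "smult (rat_of_int c) P = smult (rat_of_int c) (rpoly r)" using c(2) r by (simp add: rpoly_smult)
  then have "P = rpoly r" using c(1) by (metis less_irrefl of_int_0_eq_iff smult_cancel)
  then show thesis by (rule that)
qed

lemma reducible_small_prime_factor:
  fixes H :: "rat poly"
  assumes irrH: "irreducible H" and monH: "lead_coeff H = 1" and p: "p = 2 \<or> p = 3"
    and red: "\<not> irreducible (pcompose H (monom 1 p))"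
  obtains P where "irreducible P" "lead_coeff P = 1" "P dvd pcompose H (monom 1 p)" "degree P = degree H"
proof -
  have p0: "p > 0" using p by auto
  obtain P m where P: "irreducible P" "lead_coeff P = 1" "P dvd pcompose H (monom 1 p)"
    and m: "degree P = m * degree H" "m > 0" "2 * m \<le> p"
    using reducible_pcompose_power_factor[OF irrH monH p0 red] by metis
  from m(2,3) p have "m = 1" by auto
  with P m that show thesis by simp
qed

text \<open>For \<open>p = 2\<close> and \<open>p = 3\<close> the product of \<open>P(\<zeta> * x)\<close> over the \<open>p\<close>-th roots of unity \<open>\<zeta>\<close> is \<open>R(x ^ p)\<close> with an
  explicit \<open>R\<close>. The \<open>p\<close>-th power of a root of \<open>P\<close> is a common root of \<open>R\<close> and \<open>H\<close>, so
  comparing coefficients of \<open>R\<close> and \<open>H\<close> describes all possible factors.\<close>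

lemma norm_polynomial_unique:
  fixes H P R :: "rat poly"
  assumes irrH: "irreducible H" and monH: "lead_coeff H = 1" and p: "p > 0"
    and P: "irreducible P" "P dvd pcompose H (monom 1 p)"
    and R: "lead_coeff R = 1" "degree R = degree H" "P dvd pcompose R (monom 1 p)"
  shows "R = H"
proof -
  have "\<not> constant (poly (cpoly P))"
    using irreducible_degree_pos[OF P(1)] by (simp add: constant_degree)
  then obtain z where "poly (cpoly P) z = 0" using fundamental_theorem_of_algebra by blast
  then have z: "z \<in> croots P" by simp
  have "H dvd R"
    by (rule irreducible_dvd_if_common_root[OF irrH
          croots_factor_pcompose_power[OF P(2) z] croots_factor_pcompose_power[OF R(3) z]])
  then obtain S where S: "R = H * S" by (elim dvdE)
  have "R \<noteq> 0" using R(1) by auto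
  then have "H \<noteq> 0" "S \<noteq> 0" using S by auto
  then have "degree R = degree H + degree S" using S by (simp add: degree_mult_eq)
  then have "degree S = 0" using R(2) by simp
  then obtain c where "S = [:c:]" by (rule degree_eq_zeroE)
  moreover have "lead_coeff S = 1" using R(1) monH unfolding S lead_coeff_mult by simp
  ultimately have "S = 1" by (simp add: one_pCons)
  with S show ?thesis by simp
qed

lemma poly_eq_sum_degree_3: "degree (p :: 'a :: zero poly) = 3 \<Longrightarrow> p = [:coeff p 0, coeff p 1, coeff p 2, coeff p 3:]"
  by (rule poly_eqI) (auto simp: coeff_pCons numeral_eq_Suc coeff_eq_0 split: nat.split)

lemma poly_eq_sum_degree_4: "degree (p :: 'a :: zero poly) = 4 \<Longrightarrow> p = [:coeff p 0, coeff p 1, coeff p 2, coeff p 3, coeff p 4:]"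
  by (rule poly_eqI) (auto simp: coeff_pCons numeral_eq_Suc coeff_eq_0 split: nat.split)

text \<open>The identity \<open>A\<^sup>3 + B\<^sup>3 + C\<^sup>3 - 3 * A * B * C = (A + B + C) * (A\<^sup>2 + B\<^sup>2 + C\<^sup>2 - A * B - B * C - C * A)\<close> with
  \<open>A = x\<^sup>3 + w\<close>, \<open>B = u * x\<^sup>2\<close>, \<open>C = v * x\<close>.\<close>

lemma dvd_pcompose_cube:
  fixes u v w :: "'a :: comm_ring_1"
  shows "[:w, v, u, 1:] dvd
    pcompose [:w ^ 3, v ^ 3 - 3 * u * v * w + 3 * w ^ 2, u ^ 3 - 3 * u * v + 3 * w, 1:] (monom 1 3)"
proof -
  have "pcompose [:w ^ 3, v ^ 3 - 3 * u * v * w + 3 * w ^ 2, u ^ 3 - 3 * u * v + 3 * w, 1:] (monom 1 3)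
     = [:w, v, u, 1:] * [:w ^ 2, - (v * w), v ^ 2 - u * w, 2 * w - u * v, u ^ 2 - v, - u, 1:]"
    by (simp add: pcompose_pCons monom_Suc monom_0 numeral_eq_Suc power2_eq_square algebra_simps)
  then show ?thesis by (metis dvd_triv_left)
qed

lemma dvd_pcompose_square:
  fixes p q r s :: "'a :: comm_ring_1"
  shows "[:s, r, q, p, 1:] dvd
    pcompose [:s ^ 2, 2 * q * s - r ^ 2, q ^ 2 + 2 * s - 2 * p * r, 2 * q - p ^ 2, 1:] (monom 1 2)"
proof -
  have "pcompose [:s ^ 2, 2 * q * s - r ^ 2, q ^ 2 + 2 * s - 2 * p * r, 2 * q - p ^ 2, 1:] (monom 1 2)
     = [:s, r, q, p, 1:] * [:s, - r, q, - p, 1:]"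
    by (simp add: pcompose_pCons monom_Suc monom_0 numeral_eq_Suc algebra_simps)
  then show ?thesis by (metis dvd_triv_left)
qed

text \<open>The norm test does not apply: the value of the word at \<open>0\<close> is the fixed point \<open>t\<close>, a cube. A
  factorisation would make a cubic \<open>P\<close> a factor, and comparing the coefficients of its norm
  polynomial with those of \<open>(x + t)\<^sup>3 + t - t\<^sup>3\<close> gives \<open>cubic_norm_system\<close>.\<close>

lemma irreducible_cubic_word:
  fixes y t a :: int
  assumes t: "t = y ^ 3" and a: "a = t - t ^ 3" and irr: "irreducible (word_poly 3 [a])"
  shows "irreducible (word_poly 3 [a, t])"
proof (rule ccontr)
  assume red: "\<not> irreducible (word_poly 3 [a, t])"
  define H0 :: "int poly" where "H0 = [:t, 3 * t ^ 2, 3 * t, 1:]"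
  define H where "H = rpoly H0"
  have Heq: "H = pcompose (word_poly 3 [a]) [:of_int t, 1:]"
    by (simp add: H_def H0_def unicritical_poly_def a map_poly_pCons pcompose_pCons pcompose_add
        monom_Suc monom_0 numeral_eq_Suc algebra_simps)
  have irrH: "irreducible H" unfolding Heq by (rule irreducible_shift[OF irr])
  have monH: "lead_coeff H = 1" and degH: "degree H = 3" by (simp_all add: H_def H0_def map_poly_pCons)
  have "word_poly 3 [a, t] = pcompose H (monom 1 3)"
    using word_poly_snoc[of 3 "[a]" t] Heq by simp
  with red have redH: "\<not> irreducible (pcompose H (monom 1 3))" by simp
  obtain P where P: "irreducible P" "lead_coeff P = 1" "P dvd pcompose H (monom 1 3)" "degree P = degree H"
    by (rule reducible_small_prime_factor[OF irrH monH _ redH]) auto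
  obtain S where S: "pcompose H (monom 1 3) = P * S" using P(3) by (elim dvdE)
  have "pcompose H (monom 1 3) = rpoly (pcompose H0 (monom 1 3))"
    by (simp add: H_def H0_def map_poly_pCons pcompose_pCons monom_Suc monom_0 numeral_eq_Suc)
  then have eq: "rpoly (pcompose H0 (monom 1 3)) = P * S" using S by simp
  have "lead_coeff (pcompose H0 (monom 1 3)) = 1"
    by (simp add: H0_def pcompose_pCons monom_Suc monom_0 numeral_eq_Suc)
  then obtain P0 where P0: "P = rpoly P0" using monic_rational_factor_integral[OF _ eq P(2)] by blast
  have deg0: "degree P0 = 3" using P(4) degH by (simp add: P0 degree_map_poly)
  have "coeff P0 3 = 1" using P(2) deg0 by (simp add: P0 coeff_map_poly degree_map_poly)
  then obtain u v w where uvw: "P0 = [:w, v, u, 1:]"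
    using poly_eq_sum_degree_3[OF deg0] by metis
  define R where "R = rpoly [:w ^ 3, v ^ 3 - 3 * u * v * w + 3 * w ^ 2, u ^ 3 - 3 * u * v + 3 * w, 1:]"
  have "R = H"
  proof (rule norm_polynomial_unique[OF irrH monH _ P(1) P(3)])
    show "lead_coeff R = 1" "degree R = degree H" by (simp_all add: R_def degH map_poly_pCons)
    show "P dvd pcompose R (monom 1 3)"
      using dvd_pcompose_cube[of "rat_of_int w" "of_int v" "of_int u"]
      by (simp add: R_def P0 uvw map_poly_pCons)
  qed simp
  then have "[:w ^ 3, v ^ 3 - 3 * u * v * w + 3 * w ^ 2, u ^ 3 - 3 * u * v + 3 * w, 1:] = H0"
    by (simp only: R_def H_def rpoly_eq_iff)
  then have c0: "w ^ 3 = y ^ 3" and c1: "v ^ 3 - 3 * u * v * w + 3 * w ^ 2 = 3 * t ^ 2"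
    and c2: "u ^ 3 - 3 * u * v + 3 * w = 3 * t" by (simp_all add: H0_def t)
  have w: "w = y" using c0 by (simp only: cube_eq_iff_int)
  have "u ^ 3 = 3 * (t + u * v - w)" using c2 by simp
  then have "3 dvd u ^ 3" by (metis dvd_triv_left)
  then have "3 dvd u" using prime_dvd_power[of "3 :: int" u 3] by simp
  then obtain U where U: "u = 3 * U" by (elim dvdE)
  have "v ^ 3 = 3 * (t ^ 2 + u * v * w - w ^ 2)" using c1 by simp
  then have "3 dvd v ^ 3" by (metis dvd_triv_left)
  then have "3 dvd v" using prime_dvd_power[of "3 :: int" v 3] by simp
  then obtain V where V: "v = 3 * V" by (elim dvdE)
  have t2: "t ^ 2 = y ^ 6" by (simp add: t flip: power_mult)
  have "9 * U ^ 3 - 9 * U * V = y ^ 3 - y"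
    using c2 by (simp add: U V w t power_mult_distrib)
  moreover have "9 * V ^ 3 - 9 * U * V * y = y ^ 6 - y ^ 2"
    using c1 by (simp add: U V w t2 power_mult_distrib)
  ultimately have "y = 0 \<or> y ^ 2 = 1" by (rule cubic_norm_system)
  then have "a = 0"
  proof
    assume "y ^ 2 = 1"
    then have "y = 1 \<or> y = -1" by (simp add: power2_eq_1_iff)
    then show "a = 0" by (auto simp: a t)
  qed (simp add: a t)
  with irreducible_letter_no_root[OF _ irr, of 0] show False by simp
qed

text \<open>As in the cubic case the value at \<open>0\<close> is the square \<open>t\<close>, and coefficients are compared instead.\<close>

lemma irreducible_quadratic_word:
  fixes y t a :: int
  assumes t: "t = y ^ 2" and a: "a = t - t ^ 2" and irr: "irreducible (word_poly 2 [a])"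
  shows "irreducible (word_poly 2 [a, a, - t])"
proof (rule ccontr)
  assume red: "\<not> irreducible (word_poly 2 [a, a, - t])"
  have irr2: "irreducible (word_poly 2 [a, a])"
    using irreducible_iterates[OF _ irr, of 1] by (simp add: numeral_eq_Suc del: word_poly_simps)
  define H0 :: "int poly" where "H0 = [:t, - 4 * t ^ 2, 4 * t ^ 2 + 2 * t, - 4 * t, 1:]"
  define H where "H = rpoly H0"
  have Heq: "H = pcompose (word_poly 2 [a, a]) [:of_int (- t), 1:]"
    by (simp add: H_def H0_def unicritical_poly_def a map_poly_pCons pcompose_pCons pcompose_add
        monom_Suc monom_0 numeral_eq_Suc algebra_simps)
  have irrH: "irreducible H" unfolding Heq by (rule irreducible_shift[OF irr2])
  have monH: "lead_coeff H = 1" and degH: "degree H = 4" by (simp_all add: H_def H0_def map_poly_pCons)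
  have "word_poly 2 [a, a, - t] = pcompose H (monom 1 2)"
    using word_poly_snoc[of 2 "[a, a]" "- t"] Heq by simp
  with red have redH: "\<not> irreducible (pcompose H (monom 1 2))" by simp
  obtain P where P: "irreducible P" "lead_coeff P = 1" "P dvd pcompose H (monom 1 2)" "degree P = degree H"
    by (rule reducible_small_prime_factor[OF irrH monH _ redH]) auto
  obtain S where S: "pcompose H (monom 1 2) = P * S" using P(3) by (elim dvdE)
  have "pcompose H (monom 1 2) = rpoly (pcompose H0 (monom 1 2))"
    by (simp add: H_def H0_def map_poly_pCons pcompose_pCons monom_Suc monom_0 numeral_eq_Suc)
  then have eq: "rpoly (pcompose H0 (monom 1 2)) = P * S" using S by simp
  have "lead_coeff (pcompose H0 (monom 1 2)) = 1"
    by (simp add: H0_def pcompose_pCons monom_Suc monom_0 numeral_eq_Suc)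
  then obtain P0 where P0: "P = rpoly P0" using monic_rational_factor_integral[OF _ eq P(2)] by blast
  have deg0: "degree P0 = 4" using P(4) degH by (simp add: P0 degree_map_poly)
  have "coeff P0 4 = 1" using P(2) deg0 by (simp add: P0 coeff_map_poly degree_map_poly)
  then obtain p q r s where pqrs: "P0 = [:s, r, q, p, 1:]"
    using poly_eq_sum_degree_4[OF deg0] by metis
  define R where "R = rpoly [:s ^ 2, 2 * q * s - r ^ 2, q ^ 2 + 2 * s - 2 * p * r, 2 * q - p ^ 2, 1:]"
  have "R = H"
  proof (rule norm_polynomial_unique[OF irrH monH _ P(1) P(3)])
    show "lead_coeff R = 1" "degree R = degree H" by (simp_all add: R_def degH map_poly_pCons)
    show "P dvd pcompose R (monom 1 2)"
      using dvd_pcompose_square[of "rat_of_int s" "of_int r" "of_int q" "of_int p"]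
      by (simp add: R_def P0 pqrs map_poly_pCons)
  qed simp
  then have "[:s ^ 2, 2 * q * s - r ^ 2, q ^ 2 + 2 * s - 2 * p * r, 2 * q - p ^ 2, 1:] = H0"
    by (simp only: R_def H_def rpoly_eq_iff)
  then have c0: "s ^ 2 = y ^ 2" and c1: "2 * q * s - r ^ 2 = - 4 * t ^ 2"
    and c2: "q ^ 2 + 2 * s - 2 * p * r = 4 * t ^ 2 + 2 * t" and c3: "2 * q - p ^ 2 = - 4 * t"
    by (simp_all add: H0_def t)
  have s: "s = y \<or> s = - y" using c0 by (simp add: power2_eq_iff)
  have "p ^ 2 = 2 * (q + 2 * t)" using c3 by simp
  then have "even (p ^ 2)" by simp
  then have "even p" by simp
  then obtain P1 where p: "p = 2 * P1" by (elim evenE)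
  have q: "q = 2 * P1 ^ 2 - 2 * t" using c3 by (simp add: p power_mult_distrib)
  have "r ^ 2 = 2 * (q * s + 2 * t ^ 2)" using c1 by simp
  then have "even (r ^ 2)" by simp
  then have "even r" by simp
  then obtain R1 where r: "r = 2 * R1" by (elim evenE)
  have e2: "R1 ^ 2 = (P1 ^ 2 - t) * s + t ^ 2"
  proof -
    have "4 * R1 ^ 2 = 4 * ((P1 ^ 2 - t) * s + t ^ 2)"
      using c1 by (simp add: r q power_mult_distrib algebra_simps)
    then show ?thesis by simp
  qed
  have e1: "2 * P1 ^ 4 - 4 * P1 ^ 2 * t + s - 4 * P1 * R1 = t"
  proof -
    have "2 * (2 * P1 ^ 4 - 4 * P1 ^ 2 * t + s - 4 * P1 * R1) = 2 * t"
      using c2 by (simp add: p q r power_numeral_reduce algebra_simps)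
    then show ?thesis by simp
  qed
  have "\<bar>y\<bar> \<le> 1" by (rule quartic_norm_system[OF t s e1 e2])
  then have "y = 0 \<or> y = 1 \<or> y = -1" by linarith
  then have "a = 0" by (auto simp: a t)
  with irreducible_letter_no_root[OF _ irr, of 0] show False by simp
qed

section \<open>Avoiding powers by a run of one letter\<close>

lemma power_value_imp_periodic:
  assumes d: "d \<ge> 2" and a: "a \<noteq> 0"
  shows "\<exists>K. \<forall>k\<ge>K. \<forall>z. divisor_power d ((ucrit d a ^^ Suc k) z) \<longrightarrow> periodic (ucrit d a) ((ucrit d a ^^ k) z)"
proof -
  obtain K where K: "\<And>k x. k \<ge> K \<Longrightarrow> \<bar>(ucrit d a ^^ k) x\<bar> \<le> \<bar>a\<bar> \<Longrightarrow> periodic (ucrit d a) ((ucrit d a ^^ k) x)"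
    using bounded_iterate_eventually_periodic[OF d, of a "\<bar>a\<bar>"] by blast
  have "\<bar>(ucrit d a ^^ k) z\<bar> \<le> \<bar>a\<bar>" if "divisor_power d ((ucrit d a ^^ Suc k) z)" for k z
    using divisor_power_value_bound[OF a, of d "(ucrit d a ^^ k) z"] that d by simp
  then show ?thesis using K by blast
qed

text \<open>The set \<open>T\<close> contains every integer from which \<open>Suc k\<close> steps of \<open>a\<close> lead to a power. A long run of \<open>b\<close> ends
  in \<open>T\<close> only at a point that is periodic for \<open>b\<close>; the condition on the orbit of \<open>0\<close> keeps the initial
  segments of the run irreducible too.\<close>

lemma positive_proportion_avoiding:
  assumes d: "d \<ge> 2" and fin: "finite C" and a: "a \<in> C" "irreducible (word_poly d [a])" and b: "b \<in> C"
    and T: "finite T" "\<And>z. divisor_power d ((ucrit d a ^^ Suc k) z) \<Longrightarrow> z \<in> T"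
    and per: "\<And>x. x \<in> T \<Longrightarrow> \<not> periodic (ucrit d b) x"
    and orbit: "\<And>i. i \<ge> 1 \<Longrightarrow> (ucrit d b ^^ i) 0 \<notin> T"
  shows "positive_proportion_irreducible (comp_semigroup (unicritical_poly d ` C))"
proof -
  have "\<exists>R. \<forall>x\<in>T. \<bar>x\<bar> \<le> R"
    by (rule exI[of _ "Max (abs ` T)"]) (simp add: T(1))
  then obtain R where R: "\<And>x. x \<in> T \<Longrightarrow> \<bar>x\<bar> \<le> R" by blast
  obtain m where m: "\<And>x. \<bar>(ucrit d b ^^ m) x\<bar> \<le> R \<Longrightarrow> periodic (ucrit d b) ((ucrit d b ^^ m) x)"
    using bounded_iterate_eventually_periodic[OF d, of b R] by blast
  show ?thesis
  proof (rule positive_proportion_by_repeated_letter[OF d fin, of "replicate (Suc k) a" b m])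
    show "irreducible (word_poly d (replicate (Suc k) a))" by (rule irreducible_iterates[OF d a(2)])
    show "\<not> divisor_power d (word_val d (replicate (Suc k) a) ((ucrit d b ^^ i) 0))" if "1 \<le> i" for i
      using T(2)[of "(ucrit d b ^^ i) 0"] orbit[OF that] unfolding word_val_replicate by blast
    show "\<not> divisor_power d (word_val d (replicate (Suc k) a) ((ucrit d b ^^ m) x))" for x
      using T(2)[of "(ucrit d b ^^ m) x"] R m per unfolding word_val_replicate by blast
  qed (use a b in auto)
qed

section \<open>Degree at least three\<close>

lemma power_eq_imp_abs_eq:
  fixes x y :: int
  assumes "x ^ d = y ^ d" and "d > 0"
  shows "\<bar>x\<bar> = \<bar>y\<bar>"
proof -
  have "\<bar>x\<bar> ^ d = \<bar>y\<bar> ^ d" using assms(1) by (simp flip: power_abs)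
  then show ?thesis using assms(2) by (simp add: power_eq_iff_eq_base)
qed

lemma fixed_point_unique:
  assumes d: "d \<ge> 3" and a: "a \<noteq> 0" and fixt: "ucrit d a t = t" and fixu: "ucrit d a u = u"
  shows "u = t"
proof -
  have at: "a = t - t ^ d" and au: "a = u - u ^ d" using fixt fixu by (auto simp: ucrit_def)
  have diff: "t ^ d - u ^ d = t - u" using at au by linarith
  have no_gap: False if "\<bar>x\<bar> < \<bar>y\<bar>" "\<bar>y ^ d - x ^ d\<bar> = \<bar>y - x\<bar>" "a = y - y ^ d" "a = x - x ^ d" for x y
  proof -
    have "\<bar>y\<bar> * (2 * \<bar>y\<bar> - 1) \<le> \<bar>y - x\<bar>"
      using gap_ge_3[OF that(1) d] abs_power_diff_ge[of y d x] that(2) by linarith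
    also have "\<dots> \<le> \<bar>y\<bar> + \<bar>x\<bar>" by (rule abs_triangle_ineq4)
    also have "\<dots> \<le> 1 * (2 * \<bar>y\<bar> - 1)" using that(1) by simp
    finally have le: "\<bar>y\<bar> * (2 * \<bar>y\<bar> - 1) \<le> 1 * (2 * \<bar>y\<bar> - 1)" .
    have "2 * \<bar>y\<bar> - 1 > 0" using that(1) abs_ge_zero[of x] by linarith
    with le have "\<bar>y\<bar> \<le> 1" by (simp only: mult_le_cancel_right_pos)
    then have "x = 0" using that(1) by linarith
    with that(4) a d show False by simp
  qed
  consider "\<bar>u\<bar> < \<bar>t\<bar>" | "\<bar>t\<bar> < \<bar>u\<bar>" | "\<bar>u\<bar> = \<bar>t\<bar>" by linarith
  then show ?thesis
  proof cases
    case 1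
    then show ?thesis using no_gap[of u t] diff at au by auto
  next
    case 2
    have "u ^ d - t ^ d = u - t" using diff by linarith
    then have "\<bar>u ^ d - t ^ d\<bar> = \<bar>u - t\<bar>" by (simp only:)
    from no_gap[OF 2 this au at] show ?thesis ..
  next
    case 3
    show ?thesis
    proof (cases "u = t")
      case False
      with 3 have u: "u = - t" by linarith
      have "t \<noteq> 0" using a at d by auto
      show ?thesis
      proof (cases "even d")
        case True
        then show ?thesis using diff u by simp
      next
        case False
        then have "t ^ d = t" using diff u by simp
        then show ?thesis using a at by simp
      qed
    qed
  qed
qed

text \<open>The preimages of \<open>t\<close> are \<open>t\<close> and, for even \<open>d\<close>, \<open>- t\<close>. The latter has no preimage, as \<open>t ^ d - 2 * t\<close> lies
  too close to \<open>t ^ d\<close> to be a \<open>d\<close>-th power.\<close>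

lemma backward_orbit_fixed_point:
  assumes d: "d \<ge> 3" and a: "a \<noteq> 0" and fixt: "ucrit d a t = t" and z: "(ucrit d a ^^ k) z = t"
  shows "z = t \<or> (even d \<and> z = - t)"
  using z
proof (induction k arbitrary: z)
  case (Suc k)
  have at: "a = t - t ^ d" using fixt by (auto simp: ucrit_def)
  have t0: "t \<noteq> 0" using a at d by auto
  have "(ucrit d a ^^ k) (ucrit d a z) = t" using Suc.prems by (simp add: funpow_swap1)
  from Suc.IH[OF this] show ?case
  proof
    assume "ucrit d a z = t"
    then have eq: "z ^ d = t ^ d" by (simp add: ucrit_def at)
    then have "\<bar>z\<bar> = \<bar>t\<bar>" using d by (intro power_eq_imp_abs_eq) auto
    then have "z = t \<or> z = - t" by linarith
    moreover have "even d" if "z = - t"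
    proof (rule ccontr)
      assume "odd d"
      with eq that have "t ^ d = 0" by simp
      with t0 show False by simp
    qed
    ultimately show ?thesis by blast
  next
    assume *: "even d \<and> ucrit d a z = - t"
    then have eq: "\<bar>z\<bar> ^ d = \<bar>t\<bar> ^ d - 2 * t" by (auto simp: ucrit_def at power_even_abs)
    have t1: "t \<noteq> 1" using a at by auto
    consider "\<bar>z\<bar> < \<bar>t\<bar>" | "\<bar>t\<bar> < \<bar>z\<bar>" | "\<bar>z\<bar> = \<bar>t\<bar>" by linarith
    then have False
    proof cases
      case 1
      have "\<bar>t\<bar> * (2 * \<bar>t\<bar> - 1) \<le> 2 * t" using gap_ge_3[OF 1 d] eq by simp
      moreover have "\<bar>t\<bar> * (2 * \<bar>t\<bar> - 1) \<ge> \<bar>t\<bar> * 1" using t0 by (intro mult_left_mono) linarith+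
      ultimately have pos: "t > 0" using t0 by linarith
      then have "t * (2 * t - 1) \<le> t * 2" using \<open>\<bar>t\<bar> * (2 * \<bar>t\<bar> - 1) \<le> 2 * t\<close> by simp
      then have "2 * t - 1 \<le> 2" using pos by (simp only: mult_le_cancel_left_pos)
      then show False using pos t1 by linarith
    next
      case 2
      have z1: "\<bar>z\<bar> \<ge> 1" using 2 abs_ge_zero[of t] by linarith
      have "1 * (2 * \<bar>z\<bar> - 1) \<le> \<bar>z\<bar> * (2 * \<bar>z\<bar> - 1)" using z1 by (intro mult_right_mono) simp_all
      also have "\<dots> \<le> - 2 * t" using gap_ge_3[OF 2 d] eq by simp
      finally have "2 * \<bar>z\<bar> - 1 \<le> - 2 * t" by simp
      with 2 show False by linarith
    next
      case 3
      with eq t0 show False by simp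
    qed
    then show ?thesis ..
  qed
qed simp

definition exceptional_constants :: "nat \<Rightarrow> int \<Rightarrow> nat \<Rightarrow> int set" where
  "exceptional_constants d y p =
     (if even d then {y ^ p - y ^ (p * d), y ^ p, - (y ^ p), - (y ^ p) - y ^ (p * d)}
      else {y ^ p - y ^ (p * d), y ^ p})"

text \<open>If some run of \<open>a\<close> ends in a power, the last point but one is a fixed point \<open>t\<close>, which is thus itself
  a power \<open>y ^ p\<close>. A letter \<open>b\<close> outside the exceptional set neither fixes \<open>t\<close> or \<open>- t\<close> nor equals one of
  them, which for odd \<open>d\<close> is only required of \<open>t\<close>. By \<open>critical_orbit_power\<close> the orbit of \<open>0\<close> under \<open>b\<close>
  then misses the powers \<open>t\<close> and \<open>- t\<close> as well.\<close>

lemma positive_proportion_or_exceptional: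
  assumes d: "d \<ge> 3" and fin: "finite C" and aC: "a \<in> C" and irr: "irreducible (word_poly d [a])"
    and npos: "\<not> positive_proportion_irreducible (comp_semigroup (unicritical_poly d ` C))"
  obtains y p where "prime p" "p dvd d" "a = y ^ p - y ^ (p * d)" "C \<subseteq> exceptional_constants d y p"
proof -
  have d2: "d \<ge> 2" and d0: "d > 0" using d by simp_all
  note noroot = irreducible_letter_no_root[OF d2 irr]
  have a0: "a \<noteq> 0" using noroot[of 0] d by (simp add: power_0_left)
  have am1: "a \<noteq> -1" using noroot[of 1] by auto
  obtain k where k: "\<And>z. divisor_power d ((ucrit d a ^^ Suc k) z) \<Longrightarrow> periodic (ucrit d a) ((ucrit d a ^^ k) z)"
    using power_value_imp_periodic[OF d2 a0] by blast
  have fixed: "ucrit d a ((ucrit d a ^^ k) z) = (ucrit d a ^^ k) z"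
    if "divisor_power d ((ucrit d a ^^ Suc k) z)" for z
    using periodic_degree_ge_3[OF d k[OF that]] am1 by blast
  have "\<exists>z. divisor_power d ((ucrit d a ^^ Suc k) z)"
  proof (rule ccontr)
    assume "\<not> ?thesis"
    then have "positive_proportion_irreducible (comp_semigroup (unicritical_poly d ` C))"
      by (intro positive_proportion_avoiding[OF d2 fin aC irr aC, of "{}" k]) auto
    with npos show False by contradiction
  qed
  then obtain z where z: "divisor_power d ((ucrit d a ^^ Suc k) z)" ..
  define t where "t = (ucrit d a ^^ k) z"
  have fixt: "ucrit d a t = t" using fixed[OF z] by (simp add: t_def)
  have "divisor_power d t" using z fixt by (simp add: t_def)
  then obtain p y where p: "prime p" "p dvd d" and ty: "t = y ^ p" by (auto simp: divisor_power_def)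
  have td: "t ^ d = y ^ (p * d)" by (simp add: ty power_mult)
  have at: "a = t - t ^ d" using fixt by (auto simp: ucrit_def)
  have t0: "t \<noteq> 0" using a0 at d by auto
  define T where "T = (if even d then {t, - t} else {t})"
  have T: "w \<in> T" if w: "divisor_power d ((ucrit d a ^^ Suc k) w)" for w
  proof -
    have "(ucrit d a ^^ k) w = t" by (rule fixed_point_unique[OF d a0 fixt fixed[OF w]])
    from backward_orbit_fixed_point[OF d a0 fixt this] show ?thesis by (auto simp: T_def)
  qed
  have "C \<subseteq> exceptional_constants d y p"
  proof (rule ccontr)
    assume "\<not> ?thesis"
    then obtain b where bC: "b \<in> C" and b: "b \<notin> exceptional_constants d y p" by blast
    have b': "b \<noteq> t - t ^ d" "b \<noteq> t" "even d \<Longrightarrow> b \<noteq> - t" "even d \<Longrightarrow> b \<noteq> - t - t ^ d"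
      using b unfolding exceptional_constants_def td ty[symmetric] by (auto split: if_splits)
    have "positive_proportion_irreducible (comp_semigroup (unicritical_poly d ` C))"
    proof (rule positive_proportion_avoiding[OF d2 fin aC irr bC _ T])
      fix x assume x: "x \<in> T"
      show "\<not> periodic (ucrit d b) x"
      proof
        assume "periodic (ucrit d b) x"
        from periodic_degree_ge_3[OF d this] show False
        proof
          assume "ucrit d b x = x"
          then have "b = x - x ^ d" by (auto simp: ucrit_def)
          with x b' show False by (auto simp: T_def split: if_splits)
        next
          assume "b = -1 \<and> even d \<and> x \<in> {0, -1}"
          with x b' t0 show False by (auto simp: T_def split: if_splits)
        qed
      qed
    next
      fix i :: nat assume i: "i \<ge> 1"
      show "(ucrit d b ^^ i) 0 \<notin> T"
      proof
        assume mem: "(ucrit d b ^^ i) 0 \<in> T"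
        then have "\<bar>(ucrit d b ^^ i) 0\<bar> = \<bar>t\<bar>" by (auto simp: T_def split: if_splits)
        then have "\<bar>(ucrit d b ^^ i) 0\<bar> = \<bar>y\<bar> ^ p" by (simp add: ty power_abs)
        from critical_orbit_power[OF d2 i p this] mem have "0 \<in> T \<or> b \<in> T" by auto
        with t0 b' show False by (auto simp: T_def split: if_splits)
      qed
    qed (simp add: T_def)
    with npos show False by contradiction
  qed
  with p at td ty show thesis by (intro that[of p y]) simp_all
qed

text \<open>A cube forces \<open>\<bar>x\<^sup>3 + t\<bar> \<le> \<bar>a\<bar>\<close> for \<open>x = f\<^sub>a(w)\<close>, so \<open>\<bar>x\<bar> \<le> \<bar>t\<bar>\<close>. Then \<open>w\<^sup>3\<close> is within \<open>2 * \<bar>t\<bar>\<close> of \<open>t\<^sup>3\<close>, whence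
  \<open>w = t\<close> and \<open>x = t\<close>, for which \<open>t\<^sup>3 + t\<close> is too large.\<close>

lemma cubic_word_no_power:
  assumes a: "a = t - t ^ 3" "a \<noteq> 0"
  shows "\<not> divisor_power 3 (ucrit 3 a (ucrit 3 t (ucrit 3 a w)))"
proof
  assume "divisor_power 3 (ucrit 3 a (ucrit 3 t (ucrit 3 a w)))"
  then have bd: "\<bar>ucrit 3 t (ucrit 3 a w)\<bar> \<le> \<bar>a\<bar>"
    by (rule divisor_power_value_bound[OF a(2) zero_less_numeral])
  define x where "x = ucrit 3 a w"
  have t2: "\<bar>t\<bar> \<ge> 2"
  proof (rule ccontr)
    assume "\<not> ?thesis"
    then have "t = 0 \<or> t = 1 \<or> t = -1" by linarith
    with a show False by auto
  qed
  have "\<bar>t\<bar> ^ 1 \<le> \<bar>t\<bar> ^ 3" using t2 by (intro power_increasing) simp_all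
  then have absa: "\<bar>a\<bar> = \<bar>t\<bar> ^ 3 - \<bar>t\<bar>" and abst: "\<bar>t ^ 3 + t\<bar> = \<bar>t\<bar> ^ 3 + \<bar>t\<bar>"
    by (cases "t \<ge> 0"; simp add: a(1) abs_if)+
  have "\<bar>x ^ 3 + t\<bar> \<le> \<bar>t\<bar> ^ 3 - \<bar>t\<bar>" using bd absa by (simp add: x_def ucrit_def)
  then have "\<bar>x ^ 3\<bar> \<le> \<bar>t\<bar> ^ 3" by linarith
  then have "\<bar>x\<bar> ^ 3 \<le> \<bar>t\<bar> ^ 3" by (simp only: power_abs)
  then have xt: "\<bar>x\<bar> \<le> \<bar>t\<bar>" by (simp add: power_mono_iff)
  have "w ^ 3 - t ^ 3 = x - t" by (simp add: x_def ucrit_def a(1))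
  then have diff: "\<bar>w ^ 3 - t ^ 3\<bar> \<le> 2 * \<bar>t\<bar>" using xt by linarith
  have "w = t"
  proof (rule ccontr)
    assume wt: "w \<noteq> t"
    have big: "2 * \<bar>t\<bar> < \<bar>u\<bar> * (2 * \<bar>u\<bar> - 1)" if "\<bar>t\<bar> \<le> \<bar>u\<bar>" for u
    proof -
      have "\<bar>u\<bar> * 3 \<le> \<bar>u\<bar> * (2 * \<bar>u\<bar> - 1)" using that t2 by (intro mult_left_mono) linarith+
      then show ?thesis using that t2 by linarith
    qed
    consider "\<bar>w\<bar> < \<bar>t\<bar>" | "\<bar>t\<bar> < \<bar>w\<bar>" | "w = - t" using wt by linarith
    then show False
    proof cases
      case 1
      with gap_ge_3[OF 1, of 3] abs_power_diff_ge[of t 3 w] big[of t] diff show False by linarith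
    next
      case 2
      with gap_ge_3[OF 2, of 3] abs_power_diff_ge[of w 3 t] big[of w] diff show False by linarith
    next
      case 3
      then have "\<bar>w ^ 3 - t ^ 3\<bar> = 2 * \<bar>t\<bar> ^ 3" by (simp add: power_abs abs_mult)
      moreover have "\<bar>t\<bar> ^ 1 < \<bar>t\<bar> ^ 3" using t2 by (intro power_strict_increasing) simp_all
      ultimately show False using diff by simp
    qed
  qed
  then have "x = t" by (simp add: x_def ucrit_def a(1))
  then have "\<bar>t ^ 3 + t\<bar> \<le> \<bar>a\<bar>" using bd by (simp add: x_def[symmetric]) (simp add: ucrit_def)
  with abst absa t2 show False by linarith
qed

lemma positive_proportion_by_last_letter:
  assumes d: "d \<ge> 2" and fin: "finite C"
    and cs: "cs \<noteq> []" "set cs \<subseteq> C" "irreducible (word_poly d cs)" and b: "b \<in> C"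
    and np: "\<And>w. \<not> divisor_power d (word_val d cs (ucrit d b w))"
  shows "positive_proportion_irreducible (comp_semigroup (unicritical_poly d ` C))"
proof (rule positive_proportion_by_repeated_letter[OF d fin cs b, of 1])
  fix i :: nat assume "1 \<le> i"
  then obtain j where "i = Suc j" by (cases i) auto
  then show "\<not> divisor_power d (word_val d cs ((ucrit d b ^^ i) 0))" using np by simp
qed (use np in simp)

lemma positive_proportion_cubic:
  assumes fin: "finite C" and aC: "a \<in> C" and irr: "irreducible (word_poly 3 [a])"
  shows "positive_proportion_irreducible (comp_semigroup (unicritical_poly 3 ` C))"
proof (rule ccontr)
  assume npos: "\<not> ?thesis"
  obtain y p where p: "prime p" "p dvd 3" and a: "a = y ^ p - y ^ (p * 3)" and C: "C \<subseteq> exceptional_constants 3 y p"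
    using positive_proportion_or_exceptional[OF order.refl fin aC irr npos] by blast
  have "p = 3" using primes_dvd_imp_eq[OF p(1) _ p(2)] by simp
  define t where "t = y ^ 3"
  have a': "a = t - t ^ 3" using a by (simp add: \<open>p = 3\<close> t_def flip: power_mult)
  have a0: "a \<noteq> 0" using irreducible_letter_no_root[OF _ irr, of 0] by simp
  have C': "C \<subseteq> {a, t}" using C a by (simp add: exceptional_constants_def \<open>p = 3\<close> t_def)
  show False
  proof (cases "t \<in> C")
    case False
    with C' aC have "C = {a}" by auto
    with positive_proportion_single[OF _ irr] npos show False by simp
  next
    case True
    have "positive_proportion_irreducible (comp_semigroup (unicritical_poly 3 ` C))"
    proof (rule positive_proportion_by_last_letter[OF _ fin _ _ irreducible_cubic_word[OF t_def a' irr] aC])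
      show "\<not> divisor_power 3 (word_val 3 [a, t] (ucrit 3 a w))" for w
        using cubic_word_no_power[OF a' a0] by simp
    qed (use True aC in auto)
    with npos show False by contradiction
  qed
qed

section \<open>Degree two\<close>

lemma divisor_power_2: "divisor_power 2 x \<longleftrightarrow> (\<exists>z. x = z ^ 2)"
proof -
  have "p = 2" if "prime p" "p dvd 2" for p :: nat
    using primes_dvd_imp_eq[OF that(1) _ that(2)] by simp
  then show ?thesis unfolding divisor_power_def by (metis dvd_refl two_is_prime_nat)
qed

lemma no_square_between:
  fixes k m :: int
  assumes "k \<ge> 0" "k ^ 2 < m ^ 2" "m ^ 2 < (k + 1) ^ 2"
  shows False
proof -
  have "k ^ 2 < \<bar>m\<bar> ^ 2" "\<bar>m\<bar> ^ 2 < (k + 1) ^ 2" using assms by simp_all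
  then have "k < \<bar>m\<bar>" "\<bar>m\<bar> < k + 1"
    using power_less_imp_less_base[of k 2 "\<bar>m\<bar>"] power_less_imp_less_base[of "\<bar>m\<bar>" 2 "k + 1"] assms(1)
    by simp_all
  then show False by linarith
qed

lemma consecutive_squares:
  fixes x y :: int
  assumes "x ^ 2 = y ^ 2 + 1"
  shows "y = 0"
proof (rule ccontr)
  assume "y \<noteq> 0"
  have "(\<bar>y\<bar> + 1) ^ 2 = y ^ 2 + 2 * \<bar>y\<bar> + 1" by (simp add: power2_eq_square algebra_simps)
  moreover have "\<bar>y\<bar> \<ge> 1" using \<open>y \<noteq> 0\<close> by linarith
  ultimately show False
    using no_square_between[of "\<bar>y\<bar>" x] assms by simp
qed

lemma square_plus_self_not_square:
  fixes v m :: int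
  assumes "v \<ge> 1"
  shows "v ^ 2 + v \<noteq> m ^ 2" "v ^ 2 + v + 1 \<noteq> m ^ 2"
proof -
  have "(v + 1) ^ 2 = v ^ 2 + 2 * v + 1" by (simp add: power2_eq_square algebra_simps)
  then show "v ^ 2 + v \<noteq> m ^ 2" "v ^ 2 + v + 1 \<noteq> m ^ 2"
    using no_square_between[of v m] assms by auto
qed

lemma square_minus_self_plus_one_not_square:
  fixes v m :: int
  assumes "v \<ge> 2"
  shows "v ^ 2 - v + 1 \<noteq> m ^ 2"
proof -
  have "v ^ 2 - v + 1 = (v - 1) ^ 2 + (v - 1) + 1" by (simp add: power2_eq_square algebra_simps)
  then show ?thesis using square_plus_self_not_square(2)[of "v - 1" m] assms by simp
qed

lemma pronic_eq:
  fixes n v :: int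
  assumes "n ^ 2 - n = v ^ 2 + v" and "n \<ge> 1" "v \<ge> 1"
  shows "n = v + 1"
proof -
  have "(n + v) * (n - v - 1) = 0" using assms(1) by (simp add: power2_eq_square algebra_simps)
  with assms(2,3) show ?thesis by auto
qed

lemma pronic_ne:
  fixes n v :: int
  assumes "n \<ge> 1" "v \<ge> 1"
  shows "n ^ 2 + n + 1 \<noteq> v ^ 2 + v"
proof
  assume "n ^ 2 + n + 1 = v ^ 2 + v"
  then have "(v - n) * (v + n + 1) = 1" by (simp add: power2_eq_square algebra_simps)
  then have "v + n + 1 dvd 1" by (metis dvd_triv_right)
  with assms show False by auto
qed

text \<open>The constants \<open>a\<close> for which the square \<open>y\<^sup>2\<close> is a fixed point of \<open>x\<^sup>2 + a\<close>, or lies on a cycle of length two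
  together with \<open>- 1 - y\<^sup>2\<close>. The bounds on \<open>y\<close> remove constants for which \<open>x\<^sup>2 + a\<close> is reducible.\<close>

definition fixed_type :: "int \<Rightarrow> int \<Rightarrow> bool" where
  "fixed_type a y \<longleftrightarrow> \<bar>y\<bar> \<ge> 2 \<and> a = y ^ 2 - (y ^ 2) ^ 2"

definition cycle_type :: "int \<Rightarrow> int \<Rightarrow> bool" where
  "cycle_type a y \<longleftrightarrow> y \<noteq> 0 \<and> a = - ((y ^ 2) ^ 2 + y ^ 2 + 1)"

lemma reducible_quadratic_letter:
  assumes "\<not> irreducible (word_poly 2 [c])"
  obtains m where "c = - (m ^ 2)"
proof -
  have eq: "word_poly 2 [c] = pcompose [:of_int c, 1:] (monom 1 2)"
    by (simp add: unicritical_poly_def pcompose_pCons add.commute)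
  have irr: "irreducible [:rat_of_int c, 1:]" by (rule irreducible_linear_field_poly) simp
  have "\<exists>r. (-1) ^ degree [:rat_of_int c, 1:] * poly [:rat_of_int c, 1:] 0 = r ^ 2"
  proof (rule ccontr)
    assume "\<not> ?thesis"
    then have "irreducible (pcompose [:rat_of_int c, 1:] (monom 1 2))"
      by (intro irreducible_pcompose_prime_power[OF irr]) auto
    with assms eq show False by simp
  qed
  then obtain r where "rat_of_int (- c) = r ^ 2" by auto
  then obtain m where "- c = m ^ 2" using rat_root_of_int_is_int[of "- c" r 2] by auto
  then have "c = - (m ^ 2)" by simp
  then show thesis by (rule that)
qed

lemma quadratic_types:
  assumes fin: "finite C" and aC: "a \<in> C" and irr: "irreducible (word_poly 2 [a])"
    and npos: "\<not> positive_proportion_irreducible (comp_semigroup (unicritical_poly 2 ` C))"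
  shows "\<exists>y. fixed_type a y \<or> cycle_type a y"
proof -
  have d2: "(2 :: nat) \<ge> 2" by simp
  note noroot = irreducible_letter_no_root[OF d2 irr]
  have a0: "a \<noteq> 0" using noroot[of 0] by simp
  have am1: "a \<noteq> -1" using noroot[of 1] by simp
  obtain k where k: "\<And>z. divisor_power 2 ((ucrit 2 a ^^ Suc k) z) \<Longrightarrow> periodic (ucrit 2 a) ((ucrit 2 a ^^ k) z)"
    using power_value_imp_periodic[OF d2 a0] by blast
  have "\<exists>z. divisor_power 2 ((ucrit 2 a ^^ Suc k) z)"
  proof (rule ccontr)
    assume "\<not> ?thesis"
    then have "positive_proportion_irreducible (comp_semigroup (unicritical_poly 2 ` C))"
      by (intro positive_proportion_avoiding[OF d2 fin aC irr aC, of "{}" k]) auto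
    with npos show False by contradiction
  qed
  then obtain z where z: "divisor_power 2 ((ucrit 2 a ^^ Suc k) z)" ..
  define u where "u = (ucrit 2 a ^^ k) z"
  have per: "periodic (ucrit 2 a) u" using k[OF z] by (simp add: u_def)
  obtain y where y: "ucrit 2 a u = y ^ 2" using z by (auto simp: divisor_power_2 u_def)
  from periodic_degree_2[OF per] show ?thesis
  proof
    assume "ucrit 2 a u = u"
    then have "u = y ^ 2" "u ^ 2 + a = u" using y by (auto simp: ucrit_def)
    then have a: "a = y ^ 2 - (y ^ 2) ^ 2" by simp
    have "\<bar>y\<bar> \<ge> 2"
    proof (rule ccontr)
      assume "\<not> ?thesis"
      then have "y = 0 \<or> y = 1 \<or> y = -1" by linarith
      with a a0 show False by auto
    qed
    with a show ?thesis by (auto simp: fixed_type_def)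
  next
    assume "u + ucrit 2 a u = -1"
    then have u: "u = - 1 - y ^ 2" and "u ^ 2 + a = y ^ 2" using y by (auto simp: ucrit_def)
    then have "a = y ^ 2 - (- 1 - y ^ 2) ^ 2" by simp
    also have "\<dots> = - ((y ^ 2) ^ 2 + y ^ 2 + 1)" by (simp add: power2_eq_square algebra_simps)
    finally have a: "a = - ((y ^ 2) ^ 2 + y ^ 2 + 1)" .
    then have "y \<noteq> 0" using am1 by auto
    with a show ?thesis by (auto simp: cycle_type_def)
  qed
qed

text \<open>On the cycle \<open>{v, - 1 - v}\<close> the preimages alternate between \<open>{v, - v}\<close> and \<open>{v + 1, - (v + 1)}\<close>, because
  neither \<open>- v\<close> nor \<open>v + 1\<close> has a preimage: that would make \<open>v\<^sup>2 + 1\<close> or \<open>(v + 1)\<^sup>2 + 1\<close> a square.\<close>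

lemma cycle_type_backward:
  assumes v: "v \<ge> 1" and vs: "v = y ^ 2" and a: "a = - (v ^ 2 + v + 1)"
    and z: "(ucrit 2 a ^^ k) z = - 1 - v"
  shows "if even k then z = v + 1 \<or> z = - (v + 1) else z = v \<or> z = - v"
  using z
proof (induction k arbitrary: z)
  case 0
  then show ?case by auto
next
  case (Suc k)
  have step: "(ucrit 2 a ^^ k) (ucrit 2 a z) = - 1 - v" using Suc.prems by (simp add: funpow_swap1)
  have val: "z ^ 2 = ucrit 2 a z + (v ^ 2 + v + 1)" by (simp add: ucrit_def a)
  have sq1: "(v + 1) ^ 2 = v ^ 2 + 2 * v + 1" by (simp add: power2_eq_square algebra_simps)
  show ?case
  proof (cases "even k")
    case True
    then have "ucrit 2 a z = v + 1 \<or> ucrit 2 a z = - (v + 1)" using Suc.IH[OF step] by simp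
    then have "z ^ 2 = v ^ 2"
    proof
      assume "ucrit 2 a z = v + 1"
      then have "z ^ 2 = (v + 1) ^ 2 + 1" using val sq1 by simp
      then have "v + 1 = 0" by (rule consecutive_squares)
      with v show ?thesis by simp
    qed (use val in simp)
    with True show ?thesis by (simp add: power2_eq_iff)
  next
    case False
    then have "ucrit 2 a z = v \<or> ucrit 2 a z = - v" using Suc.IH[OF step] by simp
    then have "z ^ 2 = (v + 1) ^ 2"
    proof
      assume "ucrit 2 a z = - v"
      then have "z ^ 2 = v ^ 2 + 1" using val by simp
      then have "v = 0" by (rule consecutive_squares)
      with v show ?thesis by simp
    qed (use val sq1 in simp)
    then have "z = v + 1 \<or> z = - (v + 1)" by (simp only: power2_eq_iff)
    with False show ?thesis by simp
  qed
qed

text \<open>The parity of the run of \<open>a\<close> decides whether the second letter \<open>b\<close> has to avoid \<open>{v, - v}\<close> or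
  \<open>{v + 1, - (v + 1)}\<close>. Given the shape of \<open>b\<close>, the first set causes trouble only for \<open>b = - v\<close> and
  \<open>b = v - v\<^sup>2\<close>. For these two the second set contains no periodic point of \<open>b\<close>, and \<open>v\<close>
  divides the whole orbit of \<open>0\<close>, which therefore misses that set if \<open>v > 1\<close>; for \<open>v = 1\<close> the orbit stays
  in \<open>{0, -1}\<close>.\<close>

lemma positive_proportion_cycle_type:
  assumes fin: "finite C" and aC: "a \<in> C" and irr: "irreducible (word_poly 2 [a])" and ty: "cycle_type a y"
    and bC: "b \<in> C" "b \<noteq> a"
    and types: "(\<exists>m. b = - (m ^ 2)) \<or> (\<exists>y. fixed_type b y \<or> cycle_type b y)"
  shows "positive_proportion_irreducible (comp_semigroup (unicritical_poly 2 ` C))"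
proof -
  have d2: "(2 :: nat) \<ge> 2" by simp
  define v where "v = y ^ 2"
  have a: "a = - (v ^ 2 + v + 1)" and y0: "y \<noteq> 0" using ty by (auto simp: cycle_type_def v_def)
  have "v > 0" unfolding v_def using y0 by simp
  then have v: "v \<ge> 1" by linarith
  have v_cons: "n \<noteq> v + 1" if "n = w ^ 2" for n w
    using consecutive_squares[of w y] that y0 by (auto simp: v_def)
  have a0: "a \<noteq> 0" using a v zero_le_power2[of v] by linarith
  obtain K where K: "\<And>k z. k \<ge> K \<Longrightarrow> divisor_power 2 ((ucrit 2 a ^^ Suc k) z) \<Longrightarrow> periodic (ucrit 2 a) ((ucrit 2 a ^^ k) z)"
    using power_value_imp_periodic[OF d2 a0] by blast
  have hit: "(ucrit 2 a ^^ k) z = - 1 - v"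
    if kz: "k \<ge> K" "divisor_power 2 ((ucrit 2 a ^^ Suc k) z)" for k z
  proof -
    define w where "w = (ucrit 2 a ^^ k) z"
    obtain s where s: "ucrit 2 a w = s ^ 2" using kz(2) by (auto simp: divisor_power_2 w_def)
    have "periodic (ucrit 2 a) w" using K[OF kz] by (simp add: w_def)
    from periodic_degree_2[OF this] have "w = - 1 - v"
    proof
      assume "ucrit 2 a w = w"
      then have "w ^ 2 - w = v ^ 2 + v + 1" by (simp add: ucrit_def a)
      moreover have "even (w ^ 2 - w)" "even (v ^ 2 + v)" by simp_all
      ultimately show ?thesis by (metis even_plus_one_iff)
    next
      assume c: "w + ucrit 2 a w = - 1"
      then have "(w - v) * (w + v + 1) = 0" by (simp add: ucrit_def a power2_eq_square algebra_simps)
      then have "w = v \<or> w = - 1 - v" by auto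
      moreover have "w \<noteq> v"
      proof
        assume "w = v"
        then have "s ^ 2 = - 1 - v" using c s by simp
        with v zero_le_power2[of s] show False by linarith
      qed
      ultimately show ?thesis by blast
    qed
    then show ?thesis by (simp add: w_def)
  qed
  have types': "(\<exists>m. b = - (m ^ 2)) \<or> (\<exists>n w. n = w ^ 2 \<and> n \<ge> 1 \<and> (b = n - n ^ 2 \<or> b = - (n ^ 2 + n + 1)))"
  proof -
    from types consider m where "b = - (m ^ 2)" | w where "fixed_type b w \<or> cycle_type b w" by blast
    then show ?thesis
    proof cases
      case 2
      then have "w \<noteq> 0" by (auto simp: fixed_type_def cycle_type_def)
      then have "w ^ 2 > 0" by simp
      then have "w ^ 2 \<ge> 1" by linarith
      with 2 show ?thesis by (auto simp: fixed_type_def cycle_type_def)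
    qed blast
  qed
  have neg: "b \<le> 0"
    using types'
  proof (elim disjE exE conjE)
    fix n w assume n: "1 \<le> n" "b = n - n ^ 2"
    have "n * 1 \<le> n * n" using n(1) by (intro mult_left_mono) simp_all
    then show ?thesis using n by (simp add: power2_eq_square)
  next
    fix n w assume n: "1 \<le> n" "b = - (n ^ 2 + n + 1)"
    then show ?thesis using zero_le_power2[of n] by linarith
  qed simp
  have par: "even (n ^ 2 - n)" "even (n ^ 2 + n)" for n :: int by simp_all
  show ?thesis
  proof (cases "b = - v \<or> b = v - v ^ 2")
    case False
    define k where "k = 2 * K + 1"
    show ?thesis
    proof (rule positive_proportion_avoiding[OF d2 fin aC irr bC(1), of "{v, - v}" k])
      fix z assume "divisor_power 2 ((ucrit 2 a ^^ Suc k) z)"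
      then have "(ucrit 2 a ^^ k) z = - 1 - v" by (intro hit) (simp_all add: k_def)
      from cycle_type_backward[OF v v_def a this] show "z \<in> {v, - v}" by (simp add: k_def)
    next
      fix x assume x: "x \<in> {v, - v}"
      show "\<not> periodic (ucrit 2 b) x"
      proof
        assume "periodic (ucrit 2 b) x"
        from periodic_degree_2[OF this] show False
        proof
          assume "ucrit 2 b x = x"
          then have b1: "b = x - x ^ 2" by (simp add: ucrit_def)
          with x False have "b = - (v ^ 2 + v)" by auto
          from types' show False
          proof (elim disjE exE conjE)
            fix m assume "b = - (m ^ 2)"
            with \<open>b = - (v ^ 2 + v)\<close> square_plus_self_not_square(1)[OF v, of m] show False by simp
          next
            fix n w assume "n = w ^ 2" "1 \<le> n" "b = n - n ^ 2"
            with \<open>b = - (v ^ 2 + v)\<close> pronic_eq[of n v] v v_cons show False by simp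
          next
            fix n w assume "1 \<le> n" "b = - (n ^ 2 + n + 1)"
            with \<open>b = - (v ^ 2 + v)\<close> pronic_ne[of n v] v show False by simp
          qed
        next
          assume "x + ucrit 2 b x = - 1"
          then have b1: "b = - (x ^ 2 + x + 1)" by (simp add: ucrit_def)
          with x bC(2) a have bv: "b = - (v ^ 2 - v + 1)" by auto
          with False have "v \<noteq> 1" by auto
          with v have v2: "v \<ge> 2" by linarith
          from types' show False
          proof (elim disjE exE conjE)
            fix m assume "b = - (m ^ 2)"
            with bv square_minus_self_plus_one_not_square[OF v2, of m] show False by simp
          next
            fix n w assume "b = n - n ^ 2"
            with bv have "n ^ 2 - n = (v ^ 2 - v) + 1" by simp
            with par(1)[of n] par(1)[of v] show False by (metis even_plus_one_iff)
          next
            fix n w assume n: "n = w ^ 2" "1 \<le> n" "b = - (n ^ 2 + n + 1)"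
            with bv have "v ^ 2 - v = n ^ 2 + n" by simp
            then have "v = n + 1" using v n(2) by (rule pronic_eq)
            then have "y ^ 2 = w ^ 2 + 1" by (simp add: v_def n(1))
            then have "w = 0" by (rule consecutive_squares)
            with n show False by simp
          qed
        qed
      qed
    next
      fix i :: nat assume i: "i \<ge> 1"
      show "(ucrit 2 b ^^ i) 0 \<notin> {v, - v}"
      proof
        assume mem: "(ucrit 2 b ^^ i) 0 \<in> {v, - v}"
        then have "\<bar>(ucrit 2 b ^^ i) 0\<bar> = \<bar>y\<bar> ^ 2" using v by (auto simp: v_def)
        from critical_orbit_power[OF d2 i _ _ this] mem have "v = 0 \<or> b = v \<or> b = - v" by auto
        with v neg False show False by auto
      qed
    qed simp
  next
    case True
    define k where "k = 2 * K"
    show ?thesis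
    proof (rule positive_proportion_avoiding[OF d2 fin aC irr bC(1), of "{v + 1, - (v + 1)}" k])
      fix z assume "divisor_power 2 ((ucrit 2 a ^^ Suc k) z)"
      then have "(ucrit 2 a ^^ k) z = - 1 - v" by (intro hit) (simp_all add: k_def)
      from cycle_type_backward[OF v v_def a this] show "z \<in> {v + 1, - (v + 1)}" by (simp add: k_def)
    next
      fix x assume x: "x \<in> {v + 1, - (v + 1)}"
      have "x ^ 2 = (v + 1) ^ 2" using x by (simp only: power2_eq_iff insert_iff empty_iff simp_thms)
      also have "\<dots> = v ^ 2 + 2 * v + 1" by (simp add: power2_eq_square algebra_simps)
      finally have x2: "x ^ 2 = v ^ 2 + 2 * v + 1" .
      have xb: "x \<le> v + 1" "x \<ge> - (v + 1)" using x v by auto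
      have v2: "v ^ 2 \<ge> 1" using v by (simp add: one_le_power)
      show "\<not> periodic (ucrit 2 b) x"
      proof
        assume "periodic (ucrit 2 b) x"
        from periodic_degree_2[OF this] show False
        proof
          assume "ucrit 2 b x = x"
          then have "x = v ^ 2 + 2 * v + 1 + b" using x2 by (simp add: ucrit_def)
          with True xb v v2 show False by auto
        next
          assume "x + ucrit 2 b x = - 1"
          then have "x + v ^ 2 + 2 * v + 2 + b = 0" using x2 by (simp add: ucrit_def)
          with True xb v v2 show False by auto
        qed
      qed
    next
      fix i :: nat assume i: "i \<ge> 1"
      show "(ucrit 2 b ^^ i) 0 \<notin> {v + 1, - (v + 1)}"
      proof
        assume mem: "(ucrit 2 b ^^ i) 0 \<in> {v + 1, - (v + 1)}"
        have vb: "v dvd b" using True by (auto simp: power2_eq_square)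
        have "v dvd (ucrit 2 b ^^ j) 0" for j
          by (induction j) (auto simp: ucrit_def vb power2_eq_square)
        then have "v dvd (ucrit 2 b ^^ i) 0" .
        then have "v dvd v + 1 \<or> v dvd - (v + 1)" using mem by (metis insertE singletonD)
        then have "v dvd v + 1" by (simp only: dvd_minus_iff simp_thms)
        then have "v dvd 1" by simp
        then have v1: "v = 1" using v by simp
        then have b01: "b = 0 \<or> b = -1" using True by auto
        have "(ucrit 2 b ^^ j) 0 = 0 \<or> (ucrit 2 b ^^ j) 0 = -1" for j
        proof (induction j)
          case (Suc j)
          have "(ucrit 2 b ^^ Suc j) 0 = ((ucrit 2 b ^^ j) 0) ^ 2 + b" by (simp add: ucrit_def)
          with Suc b01 show ?case
          proof -
            have "(ucrit 2 0 ^^ j) 0 = 0" by (induction j) (simp_all add: ucrit_def)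
            with b01 Suc \<open>(ucrit 2 b ^^ Suc j) 0 = _\<close> show ?thesis by auto
          qed
        qed simp
        from this[of i] mem v1 show False by auto
      qed
    qed simp
  qed
qed

text \<open>A square forces the last argument of \<open>f\<^sub>a\<close> to be at most \<open>\<bar>a\<bar> = t\<^sup>2 - t\<close> in absolute value. But
  \<open>\<bar>f\<^sub>a(w)\<bar> \<ge> t - 1\<close>, since \<open>w\<^sup>2\<close> cannot lie strictly between \<open>(t - 1)\<^sup>2\<close> and \<open>t\<^sup>2\<close>, and from there the
  values grow beyond this bound for \<open>t \<ge> 4\<close>.\<close>

lemma quadratic_word_no_square:
  assumes t: "t \<ge> 4" and a: "a = t - t ^ 2"
  shows "\<not> divisor_power 2 (ucrit 2 a (ucrit 2 a (ucrit 2 (- t) (ucrit 2 a w))))"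
proof
  assume dp: "divisor_power 2 (ucrit 2 a (ucrit 2 a (ucrit 2 (- t) (ucrit 2 a w))))"
  have tt: "t * 4 \<le> t ^ 2" using t by (simp add: power2_eq_square)
  then have a0: "a \<noteq> 0" and absa: "\<bar>a\<bar> = t ^ 2 - t" using a t by linarith+
  define x where "x = ucrit 2 a w"
  define z where "z = ucrit 2 (- t) x"
  have bd: "\<bar>ucrit 2 a z\<bar> \<le> \<bar>a\<bar>"
    using divisor_power_value_bound[OF a0 zero_less_numeral dp] by (simp add: z_def x_def)
  have "t - 1 \<le> \<bar>x\<bar>"
  proof (rule ccontr)
    assume "\<not> ?thesis"
    then have xs: "x \<le> t - 2" "2 - t \<le> x" by linarith+
    have w: "w ^ 2 = x + t ^ 2 - t" by (simp add: x_def ucrit_def a)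
    have "(t - 1) ^ 2 = t ^ 2 - 2 * t + 1" by (simp add: power2_eq_square algebra_simps)
    then show False using no_square_between[of "t - 1" w] w xs t by auto
  qed
  then have "(t - 1) ^ 2 \<le> \<bar>x\<bar> ^ 2" using t by (intro power_mono) simp_all
  then have "t ^ 2 - 3 * t + 1 \<le> z" by (simp add: z_def ucrit_def power2_eq_square algebra_simps)
  moreover have "t + 1 \<le> t ^ 2 - 3 * t + 1" using tt by linarith
  ultimately have z1: "t ^ 2 - 3 * t + 1 \<le> z" and z2: "t + 1 \<le> z" by linarith+
  have "(t + 1) * (t ^ 2 - 3 * t + 1) \<le> z * z"
    using z1 z2 t tt by (intro mult_mono) linarith+
  then have "t ^ 3 - 2 * t ^ 2 - 2 * t + 1 \<le> z ^ 2"
    by (simp add: power2_eq_square power3_eq_cube algebra_simps)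
  moreover have "z ^ 2 + t - t ^ 2 \<le> t ^ 2 - t" using bd absa by (simp add: ucrit_def a)
  ultimately have le: "t ^ 3 - 4 * t ^ 2 + 1 \<le> 0" by linarith
  have "t ^ 3 - 4 * t ^ 2 = t ^ 2 * (t - 4)" by (simp add: power2_eq_square power3_eq_cube algebra_simps)
  moreover have "t ^ 2 * (t - 4) \<ge> 0" using t by (intro mult_nonneg_nonneg) simp_all
  ultimately show False using le by linarith
qed

lemma fixed_type_backward:
  assumes t: "t \<ge> 4" and a: "a = t - t ^ 2" and z: "(ucrit 2 a ^^ k) z = t"
  shows "z = t \<or> z = - t"
  using z
proof (induction k arbitrary: z)
  case (Suc k)
  have "(ucrit 2 a ^^ k) (ucrit 2 a z) = t" using Suc.prems by (simp add: funpow_swap1)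
  from Suc.IH[OF this] show ?case
  proof
    assume "ucrit 2 a z = t"
    then have "z ^ 2 = t ^ 2" by (simp add: ucrit_def a)
    then show ?thesis by (simp add: power2_eq_iff)
  next
    assume "ucrit 2 a z = - t"
    then have z2: "z ^ 2 = t ^ 2 - 2 * t" by (simp add: ucrit_def a)
    have "(t - 2) ^ 2 = t ^ 2 - 4 * t + 4" "(t - 2 + 1) ^ 2 = t ^ 2 - 2 * t + 1"
      by (simp_all add: power2_eq_square algebra_simps)
    with no_square_between[of "t - 2" z] z2 t have False by simp
    then show ?thesis ..
  qed
qed simp

text \<open>A second letter other than \<open>- t\<close> can be used as a run behind a run of \<open>a\<close>. The letter \<open>- t\<close> maps
  \<open>0\<close> to \<open>- t\<close> and produces the square \<open>t\<close>, so here the special word \<open>[a, a, - t]\<close> takes over.\<close>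

lemma positive_proportion_fixed_type:
  assumes fin: "finite C" and aC: "a \<in> C" and irr: "irreducible (word_poly 2 [a])" and ty: "fixed_type a y"
    and types: "\<And>b. b \<in> C \<Longrightarrow> (\<exists>m. b = - (m ^ 2)) \<or> (\<exists>y. fixed_type b y)"
  shows "positive_proportion_irreducible (comp_semigroup (unicritical_poly 2 ` C))"
proof -
  have d2: "(2 :: nat) \<ge> 2" by simp
  define t where "t = y ^ 2"
  have a: "a = t - t ^ 2" and y2: "\<bar>y\<bar> \<ge> 2" using ty by (auto simp: fixed_type_def t_def)
  have "2 ^ 2 \<le> \<bar>y\<bar> ^ 2" using y2 by (intro power_mono) simp_all
  then have t4: "t \<ge> 4" by (simp add: t_def)
  have a0: "a \<noteq> 0" using irreducible_letter_no_root[OF d2 irr, of 0] by simp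
  have types': "(\<exists>m. b = - (m ^ 2)) \<or> (\<exists>n w. n = w ^ 2 \<and> n \<ge> 1 \<and> b = n - n ^ 2)" if "b \<in> C" for b
    using types[OF that]
  proof (elim disjE exE)
    fix w assume ty: "fixed_type b w"
    then have "w \<noteq> 0" by (auto simp: fixed_type_def)
    then have "w ^ 2 > 0" by simp
    then have "w ^ 2 \<ge> 1" by linarith
    with ty show ?thesis by (auto simp: fixed_type_def)
  qed blast
  have par: "even (n ^ 2 - n)" "even (n ^ 2 + n)" for n :: int by simp_all
  show ?thesis
  proof (cases "C \<subseteq> {a, - t}")
    case True
    show ?thesis
    proof (cases "- t \<in> C")
      case False
      with True aC have "C = {a}" by auto
      with positive_proportion_single[OF d2 irr] show ?thesis by simp
    next
      case tC: True
      show ?thesis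
      proof (rule positive_proportion_by_last_letter[OF d2 fin _ _ irreducible_quadratic_word[OF t_def a irr] aC])
        show "\<not> divisor_power 2 (word_val 2 [a, a, - t] (ucrit 2 a w))" for w
          using quadratic_word_no_square[OF t4 a] by simp
      qed (use tC aC in auto)
    qed
  next
    case False
    then obtain b where bC: "b \<in> C" and b: "b \<noteq> a" "b \<noteq> - t" by blast
    obtain k where k: "\<And>z. divisor_power 2 ((ucrit 2 a ^^ Suc k) z) \<Longrightarrow> periodic (ucrit 2 a) ((ucrit 2 a ^^ k) z)"
      using power_value_imp_periodic[OF d2 a0] by blast
    have neg: "b \<le> 0"
      using types'[OF bC]
    proof (elim disjE exE conjE)
      fix n w assume n: "1 \<le> n" "b = n - n ^ 2"
      have "n * 1 \<le> n * n" using n(1) by (intro mult_left_mono) simp_all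
      then show ?thesis using n by (simp add: power2_eq_square)
    qed simp
    show ?thesis
    proof (rule positive_proportion_avoiding[OF d2 fin aC irr bC, of "{t, - t}" k])
      fix z assume dp: "divisor_power 2 ((ucrit 2 a ^^ Suc k) z)"
      define w where "w = (ucrit 2 a ^^ k) z"
      obtain s where s: "ucrit 2 a w = s ^ 2" using dp by (auto simp: divisor_power_2 w_def)
      have "periodic (ucrit 2 a) w" using k[OF dp] by (simp add: w_def)
      from periodic_degree_2[OF this] have "w = t"
      proof
        assume fx: "ucrit 2 a w = w"
        then have "(w - t) * (w + t - 1) = 0" by (simp add: ucrit_def a power2_eq_square algebra_simps)
        then have "w = t \<or> w = 1 - t" by auto
        moreover have "w = s ^ 2" using fx s by simp
        then have "w \<ge> 0" by simp
        ultimately show ?thesis using t4 by linarith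
      next
        assume "w + ucrit 2 a w = - 1"
        then have "(w ^ 2 + w) + 1 = t ^ 2 - t" by (simp add: ucrit_def a)
        with par(2)[of w] par(1)[of t] show ?thesis by (metis even_plus_one_iff)
      qed
      then show "z \<in> {t, - t}" using fixed_type_backward[OF t4 a, of k z] by (simp add: w_def)
    next
      fix x assume x: "x \<in> {t, - t}"
      show "\<not> periodic (ucrit 2 b) x"
      proof
        assume "periodic (ucrit 2 b) x"
        from periodic_degree_2[OF this] show False
        proof
          assume "ucrit 2 b x = x"
          then have "b = x - x ^ 2" by (simp add: ucrit_def)
          with x b a have bt: "b = - (t ^ 2 + t)" by auto
          from types'[OF bC] show False
          proof (elim disjE exE conjE)
            fix m assume "b = - (m ^ 2)"
            with bt square_plus_self_not_square(1)[of t m] t4 show False by simp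
          next
            fix n w assume n: "n = w ^ 2" "1 \<le> n" "b = n - n ^ 2"
            with bt pronic_eq[of n t] t4 have "n = t + 1" by simp
            then have "w ^ 2 = y ^ 2 + 1" by (simp add: n(1) t_def)
            then have "y = 0" by (rule consecutive_squares)
            with y2 show False by simp
          qed
        next
          assume "x + ucrit 2 b x = - 1"
          then have bx: "b = - (x ^ 2 + x + 1)" by (simp add: ucrit_def)
          from types'[OF bC] show False
          proof (elim disjE exE conjE)
            fix m assume "b = - (m ^ 2)"
            with bx have "x ^ 2 + x + 1 = m ^ 2" by simp
            with x square_plus_self_not_square(2)[of t m] square_minus_self_plus_one_not_square[of t m] t4
            show False by auto
          next
            fix n w assume n: "b = n - n ^ 2"
            with bx have "n ^ 2 - n = (x ^ 2 + x) + 1" by simp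
            with par(1)[of n] par(2)[of x] show False by (metis even_plus_one_iff)
          qed
        qed
      qed
    next
      fix i :: nat assume i: "i \<ge> 1"
      show "(ucrit 2 b ^^ i) 0 \<notin> {t, - t}"
      proof
        assume mem: "(ucrit 2 b ^^ i) 0 \<in> {t, - t}"
        then have "\<bar>(ucrit 2 b ^^ i) 0\<bar> = \<bar>y\<bar> ^ 2" using t4 by (auto simp: t_def)
        from critical_orbit_power[OF d2 i _ _ this] mem have "t = 0 \<or> b = t \<or> b = - t" by auto
        with t4 neg b show False by auto
      qed
    qed simp
  qed
qed

text \<open>Without a positive proportion every irreducible letter is of one of the two types and every
  reducible one is minus a square. This information about the other letters is what makes the runs in
  the two preceding cases work, a letter of cycle type being used first if there is one.\<close>

lemma positive_proportion_quadratic: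
  assumes fin: "finite C" and aC: "a \<in> C" and irr: "irreducible (word_poly 2 [a])"
  shows "positive_proportion_irreducible (comp_semigroup (unicritical_poly 2 ` C))"
proof (rule ccontr)
  assume npos: "\<not> ?thesis"
  have letter: "\<exists>y. fixed_type c y \<or> cycle_type c y" if "c \<in> C" "irreducible (word_poly 2 [c])" for c
    by (rule quadratic_types[OF fin that npos])
  have types: "(\<exists>m. c = - (m ^ 2)) \<or> (\<exists>y. fixed_type c y \<or> cycle_type c y)" if "c \<in> C" for c
    using letter[OF that] reducible_quadratic_letter[of c] by blast
  have single: "C \<noteq> {c}" if "c \<in> C" "irreducible (word_poly 2 [c])" for c
    using positive_proportion_single[OF _ that(2)] npos by auto
  have no_cycle: "\<not> cycle_type c y" if c: "c \<in> C" "irreducible (word_poly 2 [c])" for c y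
  proof
    assume ct: "cycle_type c y"
    obtain b where "b \<in> C" "b \<noteq> c" using single[OF c] c(1) by blast
    with positive_proportion_cycle_type[OF fin c ct] types npos show False by blast
  qed
  have types': "(\<exists>m. c = - (m ^ 2)) \<or> (\<exists>y. fixed_type c y)" if "c \<in> C" for c
    using letter[OF that] no_cycle[OF that] reducible_quadratic_letter[of c] by blast
  obtain y where "fixed_type a y" using letter[OF aC irr] no_cycle[OF aC irr] by blast
  from positive_proportion_fixed_type[OF fin aC irr this types'] npos show False by blast
qed

section \<open>The dichotomy\<close>

theorem theorem1p1:
  fixes d s :: nat and c :: "nat \<Rightarrow> int" and G :: "rat poly set"
  assumes "d \<ge> 2" and "s \<ge> 1"
  defines "G \<equiv> comp_semigroup (unicritical_poly d ` c ` {1..s})"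
  shows "(positive_proportion_irreducible G \<longleftrightarrow> (\<exists>g\<in>G. irreducible g))
    \<or> (d \<ge> 4 \<and> even d \<and>
        (\<exists>(y::int) (p::nat). prime p \<and> p dvd d \<and>
          c ` {1..s} \<subseteq> {y ^ p - y ^ (p * d), y ^ p, - (y ^ p), - (y ^ p) - y ^ (p * d)}))
    \<or> (d \<ge> 5 \<and> odd d \<and>
        (\<exists>(y::int) (p::nat). prime p \<and> p dvd d \<and>
          c ` {1..s} \<subseteq> {y ^ p - y ^ (p * d), y ^ p}))"
proof (cases "positive_proportion_irreducible G \<or> \<not> (\<exists>g\<in>G. irreducible g)")
  case True
  then show ?thesis using positive_proportion_imp_irreducible[of G] by blast
next
  case False
  define C where "C = c ` {1..s}"
  have fin: "finite C" by (simp add: C_def)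
  have d0: "d > 0" using assms(1) by simp
  have npos: "\<not> positive_proportion_irreducible (comp_semigroup (unicritical_poly d ` C))"
    using False by (simp add: G_def C_def)
  obtain g where "g \<in> G" "irreducible g" using False by blast
  then obtain cs where cs: "cs \<noteq> []" "set cs \<subseteq> C" "irreducible (word_poly d cs)"
    unfolding G_def C_def[symmetric] comp_semigroup_unicritical by blast
  then obtain a ws where "cs = a # ws" by (cases cs) auto
  with cs irreducible_word_first_letter[of d a ws] d0
  have a: "a \<in> C" "irreducible (word_poly d [a])" by auto
  have "d \<noteq> 2" using positive_proportion_quadratic[OF fin, of a] a npos by auto
  moreover have "d \<noteq> 3" using positive_proportion_cubic[OF fin, of a] a npos by auto
  ultimately have d4: "d \<ge> 4" using assms(1) by linarith
  then have "d \<ge> 3" by simp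
  from positive_proportion_or_exceptional[OF this fin a npos]
  obtain y p where yp: "prime p" "p dvd d" "C \<subseteq> exceptional_constants d y p" by blast
  show ?thesis
  proof (cases "even d")
    case True
    with yp d4 show ?thesis unfolding exceptional_constants_def C_def by auto
  next
    case False
    with d4 have "d \<ge> 5" by (cases "d = 4") auto
    with False yp show ?thesis unfolding exceptional_constants_def C_def by auto
  qed
qed

end
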